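(* Let $k$ be a power of $2$ and $1/\varepsilon^2$ an integer. Let $\Pi$ be the transcript of any randomized blackboard protocol for $k$-BTX on input distribution $\nu$ with error probability $\delta$, for a sufficiently small constant $\delta$. Then $I(B;\Pi\mid M,D)\ge\Omega(n/(k\varepsilon^2))$, where information is measured with respect to $\nu$.
   Context: Each of $k$ sites holds $1/\varepsilon^2$ blocks of $n$ bits; $B$ denotes all sites' inputs; communication in the blackboard model (every message seen by all sites). $k$-XOR on one block: equals $1$ if there is a coordinate $j\in[n]$ in which exactly $k/2$ sites have a $1$, and $0$ otherwise. $k$-BTX: equals $1$ if $|\sum_{j}k\text{-XOR}(\text{block }j)-\frac{1}{2\varepsilon^2}|\ge2/\varepsilon$, equals $0$ if this quantity is $\le1/\varepsilon$, arbitrary otherwise. Distribution $\nu$: blocks independent, each drawn as follows: for each coordinate $\ell\in[n]$ choose $D^j_\ell$ uniformly from $[k]$; site $D^j_\ell$ gets a uniform bit, others $0$; then choose a special coordinate $M^j$ uniformly in $[n]$ and replace it: with probability $1/2$ all of the first $k/2$ sites get $0$ there, else all get $1$; independently the same for the last $k/2$ sites. $D=(D^j_\ell)_{j,\ell}$, $M=(M^1,\dots,M^{1/\varepsilon^2})$.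
   Formalization: The formal theorem assumes k ≥ 4, ε ≤ 1/4 and n ≥ 1: for k = 2 (n ≥ 2, small ε) always answering 1, and for ε > 1/4 always answering 0, has small error and reveals nothing, while for k = 1 or n = 0 the problem is undefined. *)

theory Defs
  imports "HOL-Probability.Probability"
begin

text \<open>Sites, blocks and coordinates are numbered from \<open>0\<close>. An input \<open>B\<close> is a function with
  \<open>B i j l\<close> the bit of site \<open>i\<close> in coordinate \<open>l\<close> of block \<open>j\<close>, so that \<open>B i\<close> is what site \<open>i\<close>
  sees; one block is a function with \<open>b i l\<close> the bit of site \<open>i\<close> in coordinate \<open>l\<close>.
  Bits outside the ranges \<open>i < k\<close>, \<open>j < N\<close>, \<open>l < n\<close> are \<open>False\<close> under the input distribution.\<close>

type_synonym block = "nat \<Rightarrow> nat \<Rightarrow> bool"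
type_synonym site_input = "nat \<Rightarrow> nat \<Rightarrow> bool"
type_synonym input = "nat \<Rightarrow> site_input"

definition k_XOR :: "nat \<Rightarrow> nat \<Rightarrow> block \<Rightarrow> bool" where
  "k_XOR k n b \<longleftrightarrow> (\<exists>l<n. card {i. i < k \<and> b i l} = k div 2)"

definition btx_deviation :: "nat \<Rightarrow> nat \<Rightarrow> nat \<Rightarrow> real \<Rightarrow> input \<Rightarrow> real" where
  "btx_deviation k n N \<epsilon> B =
     \<bar>(\<Sum>j<N. of_bool (k_XOR k n (\<lambda>i l. B i j l))) - 1 / (2 * \<epsilon>\<^sup>2)\<bar>"

definition k_BTX_answer :: "nat \<Rightarrow> nat \<Rightarrow> nat \<Rightarrow> real \<Rightarrow> input \<Rightarrow> bool \<Rightarrow> bool" where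
  "k_BTX_answer k n N \<epsilon> B v \<longleftrightarrow>
     (btx_deviation k n N \<epsilon> B \<ge> 2 / \<epsilon> \<longrightarrow> v) \<and>
     (btx_deviation k n N \<epsilon> B \<le> 1 / \<epsilon> \<longrightarrow> \<not> v)"

definition fair_bit :: "bool pmf" where
  "fair_bit = pmf_of_set UNIV"

text \<open>Joint law of a block, its special coordinate \<open>m\<close> and its vector \<open>d\<close>. The vector \<open>d\<close> keeps
  an entry for the special coordinate, although that entry does not influence the block.\<close>

definition block_pmf :: "nat \<Rightarrow> nat \<Rightarrow> (block \<times> nat \<times> (nat \<Rightarrow> nat)) pmf" where
  "block_pmf k n =
     do {
       d \<leftarrow> Pi_pmf {..<n} 0 (\<lambda>_. pmf_of_set {..<k});
       u \<leftarrow> Pi_pmf {..<n} False (\<lambda>_. fair_bit);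
       m \<leftarrow> pmf_of_set {..<n};
       s1 \<leftarrow> fair_bit;
       s2 \<leftarrow> fair_bit;
       return_pmf
         (\<lambda>i l. i < k \<and> l < n \<and>
            (if l = m then (if i < k div 2 then s1 else s2) else i = d l \<and> u l),
          m, d)
     }"

definition nu :: "nat \<Rightarrow> nat \<Rightarrow> nat \<Rightarrow> (input \<times> (nat \<Rightarrow> nat) \<times> (nat \<Rightarrow> nat \<Rightarrow> nat)) pmf" where
  "nu k n N =
     map_pmf (\<lambda>f. (\<lambda>i j l. fst (f j) i l, \<lambda>j. fst (snd (f j)), \<lambda>j. snd (snd (f j))))
       (Pi_pmf {..<N} (\<lambda>_ _. False, 0, \<lambda>_. 0) (\<lambda>_. block_pmf k n))"

text \<open>Blackboard protocols. A node of the tree is a state of the blackboard; the state determines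
  which site writes the next bit, and that bit is a function of the site's input and of the
  site's private coins. The private coins are drawn once, independently for every site and
  independently of the input, and stay available throughout the protocol. A longer message is a
  run of consecutive bits of one site. Public coins are not a separate ingredient: they would have
  to be part of the transcript, and a site can write some of its coins on the blackboard.\<close>

datatype protocol =
    Output bool
  | Speak nat "site_input \<Rightarrow> nat \<Rightarrow> bool" protocol protocol

primrec speakers :: "protocol \<Rightarrow> nat set" where
  "speakers (Output v) = {}"
| "speakers (Speak i f P0 P1) = insert i (speakers P0 \<union> speakers P1)"

primrec transcript :: "protocol \<Rightarrow> input \<Rightarrow> (nat \<Rightarrow> nat) \<Rightarrow> bool list" where
  "transcript (Output v) B r = []"
| "transcript (Speak i f P0 P1) B r =
     (if f (B i) (r i) then True # transcript P1 B r else False # transcript P0 B r)"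

text \<open>The last equation is never reached on a transcript of the protocol.\<close>

fun protocol_output :: "protocol \<Rightarrow> bool list \<Rightarrow> bool" where
  "protocol_output (Output v) t = v"
| "protocol_output (Speak i f P0 P1) (b # t) = protocol_output (if b then P1 else P0) t"
| "protocol_output (Speak i f P0 P1) [] = False"

definition transcript_pmf :: "nat \<Rightarrow> (nat \<Rightarrow> nat pmf) \<Rightarrow> protocol \<Rightarrow> input \<Rightarrow> bool list pmf" where
  "transcript_pmf k coins P B = map_pmf (transcript P B) (Pi_pmf {..<k} 0 coins)"

text \<open>Joint law of the input \<open>B\<close>, the vectors \<open>M\<close> and \<open>D\<close>, and the transcript.\<close>

definition run_pmf ::
  "nat \<Rightarrow> nat \<Rightarrow> nat \<Rightarrow> (nat \<Rightarrow> nat pmf) \<Rightarrow> protocol \<Rightarrow>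
     (input \<times> (nat \<Rightarrow> nat) \<times> (nat \<Rightarrow> nat \<Rightarrow> nat) \<times> bool list) pmf" where
  "run_pmf k n N coins P =
     do {
       (B, M, D) \<leftarrow> nu k n N;
       t \<leftarrow> transcript_pmf k coins P B;
       return_pmf (B, M, D, t)
     }"

definition btx_error :: "nat \<Rightarrow> nat \<Rightarrow> nat \<Rightarrow> real \<Rightarrow> (nat \<Rightarrow> nat pmf) \<Rightarrow> protocol \<Rightarrow> real" where
  "btx_error k n N \<epsilon> coins P =
     measure_pmf.prob (run_pmf k n N coins P)
       {(B, M, D, t). \<not> k_BTX_answer k n N \<epsilon> B (protocol_output P t)}"

text \<open>Conditional mutual information \<open>I(X; Y | Z)\<close> in bits. The measure is restricted to its support
  because the library's information measures for discrete variables assume simple functions,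
  that is, a finite range on the whole sample space.\<close>

definition pmf_cond_mutual_info ::
  "'a pmf \<Rightarrow> ('a \<Rightarrow> 'b) \<Rightarrow> ('a \<Rightarrow> 'c) \<Rightarrow> ('a \<Rightarrow> 'd) \<Rightarrow> real" where
  "pmf_cond_mutual_info p X Y Z =
     prob_space.conditional_mutual_information (restrict_space (measure_pmf p) (set_pmf p)) 2
       (count_space (X ` set_pmf p)) (count_space (Y ` set_pmf p)) (count_space (Z ` set_pmf p))
       X Y Z"

definition btx_info :: "nat \<Rightarrow> nat \<Rightarrow> nat \<Rightarrow> (nat \<Rightarrow> nat pmf) \<Rightarrow> protocol \<Rightarrow> real" where
  "btx_info k n N coins P =
     pmf_cond_mutual_info (run_pmf k n N coins P)
       (\<lambda>(B, M, D, t). B) (\<lambda>(B, M, D, t). t) (\<lambda>(B, M, D, t). (M, D))"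

end

theory Submission
  imports Defs "HOL-Combinatorics.Permutations"
begin

text \<open>Only the special coordinate of a block can contain exactly \<open>k/2\<close> ones, so a protocol for \<open>k\<close>-BTX
  decides, on the uniform special bits \<open>X, Y\<close> of the two halves, whether \<open>\<bar>\<langle>X, Y\<rangle>\<bar>\<close> is at least
  \<open>4 \<surd>N\<close> or at most \<open>2 \<surd>N\<close>, where \<open>N = 1/\<epsilon>\<^sup>2\<close>.

  Gap orthogonality needs information of order \<open>N\<close>. Conditioned on a transcript \<open>X\<close> and \<open>Y\<close> are independent; if
  the transcript carries little information their entropy deficits are small, and then their inner
  product is anticoncentrated: let \<open>v\<^sub>1, \<dots>, v\<^sub>r\<close> be a maximal orthonormal family with
  \<open>E \<langle>v\<^sub>i, Y\<rangle>\<^sup>2 \<ge> 4\<close>. Marton's transport inequality bounds \<open>r\<close>, so unbiased rounding of the numbers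
  \<open>\<langle>v\<^sub>i, X\<rangle>\<close> to an integer vector \<open>\<kappa>\<close> reveals little. Coupling \<open>X\<close> given \<open>\<kappa>\<close> with a uniform \<open>Z\<close> by transport
  yields \<open>\<langle>X, Y\<rangle> = s(\<kappa>, Y) + \<langle>Z, Y\<rangle> + error\<close> with \<open>Z\<close> independent of \<open>(\<kappa>, Y)\<close>, because \<open>Y\<close> has bounded
  second moments orthogonally to the \<open>v\<^sub>i\<close>. Hence a transcript that answers 0 errs with constant probability.

  For bounded \<open>n\<close> this suffices. For large \<open>n\<close> the information about the special bits is at most the sum
  of the sensitivities of the transcript to them. A zero column hides among the other coordinates, so
  the sensitivity at coordinate \<open>l\<close> is essentially the same when the special coordinate is elsewhere.
  There the Hellinger distance between the columns \<open>0\<close> and \<open>1\<close> at \<open>l\<close> is at most a constant times the sum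
  over the sites \<open>i\<close> of the distances between \<open>0\<close> and the unit column of \<open>i\<close> (merge sites along light
  perfect matchings, using the cut-and-paste property), and the average over \<open>i\<close> of the latter is a
  lower bound for the information about the single bit at \<open>l\<close>. Summing over the \<open>n N\<close> coordinates
  gives order \<open>n N / k\<close>.\<close>

section \<open>Averages over finite sets and over the cube\<close>

text \<open>The answer depends only on the special coordinates, whereas a bound that grows with
  \<open>n\<close> must be collected at the ordinary ones; this tension shapes the proof.
  Conditioning on \<open>M\<close> and \<open>D\<close> makes all remaining bits uniform and
  independent, each of them read by one site or by one half of the sites. Hence for fixed
  \<open>m\<close>, \<open>d\<close> the transcript law is a product over the sites even after the
  ordinary bits are averaged out. Both the two-party structure of gap orthogonality and the
  cut-and-paste property come from this product form. The factor \<open>1 / k\<close> is lost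
  because an ordinary coordinate exposes the bit of only one site, chosen uniformly.

  Square-root estimates, such as Marton's inequality or total variation against Hellinger distance,
  appear in a linear form with a free parameter, so that they can be averaged over transcripts,
  \<open>m\<close> and \<open>d\<close> without further convexity arguments. For the same reason the
  gap orthogonality bound is affine in the error. Probabilities are finite averages, and information
  is in natural units until the end, where the passage to bits only increases it.\<close>

definition avg :: "'a set \<Rightarrow> ('a \<Rightarrow> real) \<Rightarrow> real" where
  "avg A f = (\<Sum>x\<in>A. f x) / card A"

text \<open>A subset of the index set encodes a sign vector, so that the cube is
  \<open>Pow J\<close>; this is its coordinate at \<open>e\<close>.\<close>

definition sg :: "'a \<Rightarrow> 'a set \<Rightarrow> real" where
  "sg e C = (if e \<in> C then 1 else - 1)"

lemma avg_cong: "A = B \<Longrightarrow> (\<And>x. x \<in> B \<Longrightarrow> f x = g x) \<Longrightarrow> avg A f = avg B g"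
  unfolding avg_def by simp

lemma avg_mono: "(\<And>x. x \<in> A \<Longrightarrow> f x \<le> g x) \<Longrightarrow> avg A f \<le> avg A g"
  unfolding avg_def by (intro divide_right_mono sum_mono) auto

lemma avg_nonneg: "(\<And>x. x \<in> A \<Longrightarrow> 0 \<le> f x) \<Longrightarrow> 0 \<le> avg A f"
  unfolding avg_def by (simp add: sum_nonneg)

lemma avg_const: "finite A \<Longrightarrow> A \<noteq> {} \<Longrightarrow> avg A (\<lambda>_. c) = c"
  unfolding avg_def by simp

lemma avg_add: "avg A (\<lambda>x. f x + g x) = avg A f + avg A g"
  unfolding avg_def by (simp add: sum.distrib add_divide_distrib)

lemma avg_diff: "avg A (\<lambda>x. f x - g x) = avg A f - avg A g"
  unfolding avg_def by (simp add: sum_subtractf diff_divide_distrib)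

lemma avg_cmult: "avg A (\<lambda>x. c * f x) = c * avg A f"
  unfolding avg_def by (simp add: sum_distrib_left)

lemma avg_multc: "avg A (\<lambda>x. f x * c) = avg A f * c"
  unfolding avg_def by (simp add: sum_distrib_right)

lemma avg_divide: "avg A (\<lambda>x. f x / c) = avg A f / c"
  unfolding avg_def by (simp add: sum_divide_distrib[symmetric])

lemma avg_sum: "avg A (\<lambda>x. \<Sum>i\<in>I. f i x) = (\<Sum>i\<in>I. avg A (f i))"
  unfolding avg_def sum_divide_distrib by (subst sum.swap) simp

lemma avg_swap: "avg A (\<lambda>x. avg B (\<lambda>y. f x y)) = avg B (\<lambda>y. avg A (\<lambda>x. f x y))"
  unfolding avg_def by (subst sum_divide_distrib[symmetric], subst sum.swap)
    (simp add: sum_divide_distrib[symmetric] mult.commute)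

lemma avg_abs: "\<bar>avg A f\<bar> \<le> avg A (\<lambda>x. \<bar>f x\<bar>)"
  unfolding avg_def by (simp add: abs_divide divide_right_mono)

lemma avg_bij: "bij_betw h A B \<Longrightarrow> avg B f = avg A (\<lambda>x. f (h x))"
  unfolding avg_def by (simp add: sum.reindex_bij_betw bij_betw_same_card)

lemma avg_Times: "avg (A \<times> B) f = avg A (\<lambda>x. avg B (\<lambda>y. f (x, y)))"
  unfolding avg_def
  by (simp add: sum.cartesian_product' card_cartesian_product sum_divide_distrib[symmetric] mult.commute)

lemma avg_Pow_union:
  assumes "finite J" "finite E" "J \<inter> E = {}"
  shows "avg (Pow (J \<union> E)) f = avg (Pow J) (\<lambda>A. avg (Pow E) (\<lambda>C. f (A \<union> C)))"
proof -
  have "bij_betw (\<lambda>(A, C). A \<union> C) (Pow J \<times> Pow E) (Pow (J \<union> E))"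
    by (rule bij_betw_byWitness[where f' = "\<lambda>A. (A \<inter> J, A \<inter> E)"]) (use assms in auto)
  then show ?thesis
    by (subst avg_bij) (auto simp: avg_Times)
qed

lemma avg_Pow_insert:
  assumes "finite J" "e \<notin> J"
  shows "avg (Pow (insert e J)) f = (avg (Pow J) f + avg (Pow J) (\<lambda>C. f (insert e C))) / 2"
proof -
  have "avg (Pow (J \<union> {e})) f = avg (Pow J) (\<lambda>A. avg (Pow {e}) (\<lambda>C. f (A \<union> C)))"
    by (rule avg_Pow_union) (use assms in auto)
  also have "\<dots> = avg (Pow J) (\<lambda>A. (f A + f (insert e A)) / 2)"
    by (rule avg_cong) (auto simp: avg_def Pow_insert)
  finally show ?thesis by (simp add: avg_divide avg_add)
qed

lemma avg_Pow_Int: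
  assumes "finite J" "D \<subseteq> J"
  shows "avg (Pow J) (\<lambda>C. f (C \<inter> D)) = avg (Pow D) f"
proof -
  have fin: "finite D" "finite (J - D)" using assms finite_subset by auto
  have "avg (Pow (D \<union> (J - D))) (\<lambda>C. f (C \<inter> D)) =
      avg (Pow D) (\<lambda>A. avg (Pow (J - D)) (\<lambda>C. f ((A \<union> C) \<inter> D)))"
    by (rule avg_Pow_union) (use fin in auto)
  also have "\<dots> = avg (Pow D) (\<lambda>A. avg (Pow (J - D)) (\<lambda>C. f A))"
    by (intro avg_cong refl arg_cong[where f = f]) auto
  also have "\<dots> = avg (Pow D) f" using fin by (simp add: avg_const Pow_not_empty)
  also have "D \<union> (J - D) = J" using assms by auto
  finally show ?thesis .
qed

text \<open>Erasing a uniform bit yields the uniform law conditioned on the absence of that bit,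
  which has density 2 on that event. A change of the input thus becomes a change of weight, the form
  needed when the special coordinate is moved.\<close>

lemma avg_Pow_flip_out:
  assumes "finite J" "e \<in> J"
  shows "avg (Pow J) (\<lambda>C. f (C - {e})) = avg (Pow J) (\<lambda>C. (if e \<in> C then 0 else 2 * f C))"
proof -
  have J: "J = insert e (J - {e})" using assms by auto
  have f: "finite (J - {e})" "e \<notin> J - {e}" using assms by auto
  have "avg (Pow J) (\<lambda>C. f (C - {e})) = avg (Pow (J - {e})) f"
    by (subst J, subst avg_Pow_insert[OF f]) (auto simp: add_divide_distrib intro!: avg_cong
        arg_cong2[where f = "(+)"] arg_cong[where f = f] simp flip: add_divide_distrib
        simp: field_simps)
  moreover have "avg (Pow J) (\<lambda>C. (if e \<in> C then 0 else 2 * f C)) = avg (Pow (J - {e})) f"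
  proof -
    have 1: "avg (Pow (J - {e})) (\<lambda>C. if e \<in> C then 0 else 2 * f C) = avg (Pow (J - {e})) (\<lambda>C. 2 * f C)"
      by (rule avg_cong) auto
    have 2: "avg (Pow (J - {e})) (\<lambda>C. if e \<in> insert e C then 0 else 2 * f (insert e C)) = 0"
      by (simp add: avg_def)
    show ?thesis by (subst J, subst avg_Pow_insert[OF f]) (simp only: 1 2, simp add: avg_cmult)
  qed
  ultimately show ?thesis by simp
qed

lemma avg_Pow_prod:
  assumes "finite J"
  shows "avg (Pow J) (\<lambda>C. \<Prod>e\<in>J. f e (e \<in> C)) = (\<Prod>e\<in>J. (f e False + f e True) / 2)"
  using assms
proof (induction J rule: finite_induct)
  case empty
  then show ?case by (simp add: avg_def)
next
  case (insert x F)
  have 1: "avg (Pow F) (\<lambda>C. \<Prod>e\<in>insert x F. f e (e \<in> C)) = f x False * avg (Pow F) (\<lambda>C. \<Prod>e\<in>F. f e (e \<in> C))"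
    unfolding avg_cmult[symmetric]
  proof (rule avg_cong[OF refl])
    fix C assume "C \<in> Pow F"
    then have "x \<notin> C" using insert by auto
    then show "(\<Prod>e\<in>insert x F. f e (e \<in> C)) = f x False * (\<Prod>e\<in>F. f e (e \<in> C))"
      using insert by simp
  qed
  have 2: "avg (Pow F) (\<lambda>C. \<Prod>e\<in>insert x F. f e (e \<in> insert x C)) = f x True * avg (Pow F) (\<lambda>C. \<Prod>e\<in>F. f e (e \<in> C))"
    unfolding avg_cmult[symmetric]
    by (rule avg_cong) (use insert in \<open>auto intro!: prod.cong arg_cong2[where f="(*)"] arg_cong2[where f = f]\<close>)
  show ?case
    by (subst avg_Pow_insert) (use insert in \<open>simp_all only: 1 2 insert.IH, simp_all add: field_simps\<close>)
qed

text \<open>Distinct signs are uncorrelated: the induction pairs the two values of the new sign, and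
  the cross terms cancel.\<close>

lemma avg_Pow_sg_square:
  assumes "finite J"
  shows "avg (Pow J) (\<lambda>C. (\<Sum>e\<in>J. a e * sg e C)\<^sup>2) = (\<Sum>e\<in>J. (a e)\<^sup>2)"
  using assms
proof (induction J rule: finite_induct)
  case empty
  then show ?case by (simp add: avg_def)
next
  case (insert x F)
  let ?S = "\<lambda>C. \<Sum>e\<in>F. a e * sg e C"
  have 1: "avg (Pow F) (\<lambda>C. (\<Sum>e\<in>insert x F. a e * sg e C)\<^sup>2) = avg (Pow F) (\<lambda>C. (?S C - a x)\<^sup>2)"
    by (rule avg_cong) (use insert in \<open>auto simp: sg_def power2_commute\<close>)
  have eq: "(\<Sum>e\<in>F. a e * sg e (insert x C)) = ?S C" if "C \<in> Pow F" for C
    by (rule sum.cong) (use insert in \<open>auto simp: sg_def\<close>)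
  have 2: "avg (Pow F) (\<lambda>C. (\<Sum>e\<in>insert x F. a e * sg e (insert x C))\<^sup>2) = avg (Pow F) (\<lambda>C. (?S C + a x)\<^sup>2)"
    by (rule avg_cong) (use insert eq in \<open>auto simp: sg_def add.commute\<close>)
  have 3: "avg (Pow F) (\<lambda>C. (?S C - a x)\<^sup>2) + avg (Pow F) (\<lambda>C. (?S C + a x)\<^sup>2)
     = 2 * avg (Pow F) (\<lambda>C. (?S C)\<^sup>2) + 2 * (a x)\<^sup>2"
  proof -
    have "avg (Pow F) (\<lambda>C. (?S C - a x)\<^sup>2) + avg (Pow F) (\<lambda>C. (?S C + a x)\<^sup>2)
      = avg (Pow F) (\<lambda>C. 2 * (?S C)\<^sup>2 + 2 * (a x)\<^sup>2)"
      unfolding avg_add[symmetric] by (rule avg_cong) (auto simp: power2_eq_square algebra_simps)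
    also have "\<dots> = 2 * avg (Pow F) (\<lambda>C. (?S C)\<^sup>2) + 2 * (a x)\<^sup>2"
      using insert by (simp add: avg_add avg_cmult avg_const Pow_not_empty)
    finally show ?thesis .
  qed
  show ?case
    by (subst avg_Pow_insert) (use insert in \<open>simp_all only: 1 2 3 insert.IH, simp_all add: field_simps\<close>)
qed

section \<open>Independence of disjoint groups of uniform bits\<close>

lemma avg_Pow_indep:
  assumes "finite J" "D \<subseteq> J"
  shows "avg (Pow J) (\<lambda>C. f (C \<inter> D) * g (C - D)) = avg (Pow J) (\<lambda>C. f (C \<inter> D)) * avg (Pow J) (\<lambda>C. g (C - D))"
proof -
  have fin: "finite D" "finite (J - D)" using assms finite_subset by auto
  have J: "J = D \<union> (J - D)" using assms by auto
  have "avg (Pow J) (\<lambda>C. f (C \<inter> D) * g (C - D)) =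
      avg (Pow D) (\<lambda>A. avg (Pow (J - D)) (\<lambda>C. f ((A \<union> C) \<inter> D) * g ((A \<union> C) - D)))"
    by (subst J, rule avg_Pow_union) (use fin in auto)
  also have "\<dots> = avg (Pow D) (\<lambda>A. avg (Pow (J - D)) (\<lambda>C. f A * g C))"
    by (intro avg_cong refl arg_cong2[where f = "(*)"] arg_cong[where f = f] arg_cong[where f = g]) auto
  also have "\<dots> = avg (Pow D) f * avg (Pow (J - D)) g"
    by (simp add: avg_cmult avg_multc)
  also have "avg (Pow D) f = avg (Pow J) (\<lambda>C. f (C \<inter> D))"
    using avg_Pow_Int assms by metis
  also have "avg (Pow (J - D)) g = avg (Pow J) (\<lambda>C. g (C \<inter> (J - D)))"
    using avg_Pow_Int[OF assms(1), of "J - D" g] by auto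
  also have "\<dots> = avg (Pow J) (\<lambda>C. g (C - D))"
    by (intro avg_cong refl arg_cong[where f = g]) auto
  finally show ?thesis .
qed

lemma avg_Pow_indep_prod:
  fixes I :: "'i set"
  assumes "finite I" "finite J" "\<And>i. i \<in> I \<Longrightarrow> D i \<subseteq> J"
    "\<And>i i'. i \<in> I \<Longrightarrow> i' \<in> I \<Longrightarrow> i \<noteq> i' \<Longrightarrow> D i \<inter> D i' = {}"
  shows "avg (Pow J) (\<lambda>C. \<Prod>i\<in>I. f i (C \<inter> D i)) = (\<Prod>i\<in>I. avg (Pow J) (\<lambda>C. f i (C \<inter> D i)))"
  using assms(1,3,4)
proof (induction I rule: finite_induct)
  case empty
  then show ?case using assms(2) by (simp add: avg_const Pow_not_empty)
next
  case (insert x F)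
  have "avg (Pow J) (\<lambda>C. \<Prod>i\<in>insert x F. f i (C \<inter> D i)) =
     avg (Pow J) (\<lambda>C. f x (C \<inter> D x) * (\<Prod>i\<in>F. f i ((C - D x) \<inter> D i)))"
  proof (rule avg_cong[OF refl])
    fix C
    have "(C - D x) \<inter> D i = C \<inter> D i" if "i \<in> F" for i
      using insert.prems(2)[of x i] insert.hyps that by auto
    then show "(\<Prod>i\<in>insert x F. f i (C \<inter> D i)) = f x (C \<inter> D x) * (\<Prod>i\<in>F. f i ((C - D x) \<inter> D i))"
      using insert.hyps by simp
  qed
  also have "\<dots> = avg (Pow J) (\<lambda>C. f x (C \<inter> D x)) * avg (Pow J) (\<lambda>C. \<Prod>i\<in>F. f i ((C - D x) \<inter> D i))"
    by (rule avg_Pow_indep) (use insert assms in auto)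
  also have "avg (Pow J) (\<lambda>C. \<Prod>i\<in>F. f i ((C - D x) \<inter> D i)) = avg (Pow J) (\<lambda>C. \<Prod>i\<in>F. f i (C \<inter> D i))"
  proof (intro avg_cong refl prod.cong)
    fix C i assume "i \<in> F"
    then have "(C - D x) \<inter> D i = C \<inter> D i" using insert.prems(2)[of x i] insert.hyps by auto
    then show "f i ((C - D x) \<inter> D i) = f i (C \<inter> D i)" by simp
  qed
  also have "\<dots> = (\<Prod>i\<in>F. avg (Pow J) (\<lambda>C. f i (C \<inter> D i)))"
    using insert by simp
  finally show ?case using insert.hyps by simp
qed

section \<open>Mutual information of uniform bits\<close>

text \<open>Mutual information in nats between a uniform \<open>w\<close> and an output
  \<open>t\<close> drawn from \<open>p w\<close>: the mean divergence of \<open>p w\<close> from the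
  mixture. Where \<open>p w t = 0\<close> the summand vanishes whatever the value of the
  logarithm.\<close>

definition minfo :: "'a set \<Rightarrow> 't set \<Rightarrow> ('a \<Rightarrow> 't \<Rightarrow> real) \<Rightarrow> real" where
  "minfo \<Omega> T p = avg \<Omega> (\<lambda>w. \<Sum>t\<in>T. p w t * ln (p w t / avg \<Omega> (\<lambda>w. p w t)))"

text \<open>Twice the usual squared Hellinger distance; for probability vectors it is 2 minus twice
  the Bhattacharyya coefficient.\<close>

definition hdist :: "'t set \<Rightarrow> ('t \<Rightarrow> real) \<Rightarrow> ('t \<Rightarrow> real) \<Rightarrow> real" where
  "hdist T p q = (\<Sum>t\<in>T. (sqrt (p t) - sqrt (q t))\<^sup>2)"

lemma hdist_nonneg: "0 \<le> hdist T p q"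
  unfolding hdist_def by (simp add: sum_nonneg)

lemma avg_pos:
  assumes "finite A" "x \<in> A" "\<And>x. x \<in> A \<Longrightarrow> 0 \<le> f x" "0 < f x"
  shows "0 < avg A f"
proof -
  have "0 < sum f A" using assms by (intro sum_pos2) auto
  moreover have "card A > 0" using assms card_gt_0_iff by blast
  ultimately show ?thesis unfolding avg_def by simp
qed

lemma avg_eq_0_imp:
  assumes "finite A" "x \<in> A" "\<And>x. x \<in> A \<Longrightarrow> 0 \<le> f x" "avg A f = 0"
  shows "f x = 0"
  using avg_pos[of A x f] assms by force

text \<open>This is \<open>ln x \<le> x - 1\<close> at \<open>x = r / p\<close>. The slack
  \<open>p - r\<close> is kept so that after summation only the total masses of \<open>p\<close> and
  \<open>r\<close> enter.\<close>

lemma gibbs_pointwise: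
  fixes p r :: real
  assumes "0 \<le> p" "0 \<le> r" "0 < p \<Longrightarrow> 0 < r" "0 < p \<Longrightarrow> 0 < a"
  shows "p * ln (r / a) + (p - r) \<le> p * ln (p / a)"
proof (cases "p = 0")
  case True
  then show ?thesis using assms by simp
next
  case False
  then have p: "p > 0" "r > 0" "a > 0" using assms by auto
  have "ln (r / p) \<le> r / p - 1" using p by (intro ln_le_minus_one) auto
  then have "p * ln (r / p) \<le> p * (r / p - 1)" using p by (intro mult_left_mono) auto
  moreover have "p * (r / p - 1) = r - p" using p by (simp add: field_simps)
  ultimately have "p * (ln r - ln p) \<le> r - p" using p by (simp add: ln_div)
  then show ?thesis using p by (simp add: ln_div algebra_simps)
qed

text \<open>Variational form of mutual information: inside the logarithm the true density may be
  replaced by any competitor \<open>r\<close> of total mass at most 1 that is positive where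
  \<open>p\<close> is, and the value only drops. A well chosen \<open>r\<close> factorises and makes
  the logarithm additive.\<close>

lemma minfo_ge:
  assumes "finite \<Omega>" "\<Omega> \<noteq> {}" "finite T"
    and p0: "\<And>w t. w \<in> \<Omega> \<Longrightarrow> t \<in> T \<Longrightarrow> 0 \<le> p w t"
    and p1: "\<And>w. w \<in> \<Omega> \<Longrightarrow> (\<Sum>t\<in>T. p w t) = 1"
    and r0: "\<And>w t. w \<in> \<Omega> \<Longrightarrow> t \<in> T \<Longrightarrow> 0 \<le> r w t"
    and rp: "\<And>w t. w \<in> \<Omega> \<Longrightarrow> t \<in> T \<Longrightarrow> 0 < p w t \<Longrightarrow> 0 < r w t"
    and r1: "avg \<Omega> (\<lambda>w. \<Sum>t\<in>T. r w t) \<le> 1"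
  shows "avg \<Omega> (\<lambda>w. \<Sum>t\<in>T. p w t * ln (r w t / avg \<Omega> (\<lambda>w. p w t))) \<le> minfo \<Omega> T p"
proof -
  let ?a = "\<lambda>t. avg \<Omega> (\<lambda>w. p w t)"
  have "avg \<Omega> (\<lambda>w. \<Sum>t\<in>T. p w t * ln (r w t / ?a t) + (p w t - r w t)) \<le> minfo \<Omega> T p"
    unfolding minfo_def
    by (intro avg_mono sum_mono gibbs_pointwise p0 r0 rp avg_pos) (use assms in auto)
  moreover have "avg \<Omega> (\<lambda>w. \<Sum>t\<in>T. p w t * ln (r w t / ?a t) + (p w t - r w t)) =
     avg \<Omega> (\<lambda>w. \<Sum>t\<in>T. p w t * ln (r w t / ?a t)) + (avg \<Omega> (\<lambda>w. 1) - avg \<Omega> (\<lambda>w. \<Sum>t\<in>T. r w t))"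
    unfolding avg_diff[symmetric] avg_add[symmetric]
    by (rule avg_cong) (auto simp: sum.distrib sum_subtractf p1)
  ultimately show ?thesis using r1 assms by (simp add: avg_const)
qed

lemma minfo_nonneg:
  assumes "finite \<Omega>" "\<Omega> \<noteq> {}" "finite T"
    and p0: "\<And>w t. w \<in> \<Omega> \<Longrightarrow> t \<in> T \<Longrightarrow> 0 \<le> p w t"
    and p1: "\<And>w. w \<in> \<Omega> \<Longrightarrow> (\<Sum>t\<in>T. p w t) = 1"
  shows "0 \<le> minfo \<Omega> T p"
proof -
  let ?a = "\<lambda>t. avg \<Omega> (\<lambda>w. p w t)"
  have "avg \<Omega> (\<lambda>w. \<Sum>t\<in>T. p w t * ln (?a t / ?a t)) \<le> minfo \<Omega> T p"
  proof (rule minfo_ge)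
    show "0 < ?a t" if "w \<in> \<Omega>" "t \<in> T" "0 < p w t" for w t
      by (rule avg_pos[of _ w]) (use that assms in auto)
    have "(\<Sum>t\<in>T. ?a t) = avg \<Omega> (\<lambda>w. 1)"
      unfolding avg_sum[symmetric] by (rule avg_cong) (auto simp: p1)
    then show "avg \<Omega> (\<lambda>w. \<Sum>t\<in>T. ?a t) \<le> 1" using assms by (simp add: avg_const)
  qed (use assms in \<open>auto intro!: avg_nonneg\<close>)
  moreover have "avg \<Omega> (\<lambda>w. \<Sum>t\<in>T. p w t * ln (?a t / ?a t)) = 0"
  proof -
    have z: "ln (x / x) = 0" for x :: real by (cases "x = 0") auto
    show ?thesis by (simp only: z) (simp add: avg_def)
  qed
  ultimately show ?thesis by simp
qed

text \<open>Up to a factor 2, the right-hand side is what one output value contributes to the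
  information about a fair bit. With \<open>m\<close> the mean of \<open>p\<close> and
  \<open>q\<close>, \<open>ln y \<le> y - 1\<close> at \<open>y = sqrt (m / x)\<close> bounds each
  summand below by \<open>2 * x - 2 * sqrt x * sqrt m\<close>. The squared difference of the roots
  is \<open>(2 * sqrt m - s) * (2 * sqrt m + s)\<close>, where
  \<open>s = sqrt p + sqrt q \<le> 2 * sqrt m\<close>.\<close>

lemma bitinfo_lower:
  fixes p q :: real
  assumes "0 \<le> p" "0 \<le> q"
  shows "(sqrt p - sqrt q)\<^sup>2 / 2 \<le> p * ln (p / ((p + q) / 2)) + q * ln (q / ((p + q) / 2))"
proof -
  define m where "m = (p + q) / 2"
  have m0: "m \<ge> 0" using assms by (simp add: m_def)
  have one: "2 * x - 2 * sqrt x * sqrt m \<le> x * ln (x / m)" if "0 \<le> x" "x \<le> 2 * m" for x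
  proof (cases "x = 0")
    case False
    then have x: "x > 0" "m > 0" using that by auto
    have "ln (sqrt (m / x)) \<le> sqrt (m / x) - 1" using x by (intro ln_le_minus_one) auto
    then have "ln (m / x) \<le> 2 * (sqrt (m / x) - 1)" using x by (simp add: ln_sqrt)
    then have "x * ln (m / x) \<le> x * (2 * (sqrt (m / x) - 1))" using x by (intro mult_left_mono) auto
    moreover have "x * sqrt (m / x) = sqrt x * sqrt m"
      using x by (metis mult.commute real_div_sqrt real_sqrt_divide times_divide_eq_left times_divide_eq_right less_imp_le)
    ultimately have "x * ln (m / x) \<le> 2 * sqrt x * sqrt m - 2 * x" by (simp add: algebra_simps)
    then show ?thesis using x by (simp add: ln_div algebra_simps)
  qed simp
  define s where "s = sqrt p + sqrt q"
  have sq: "(sqrt p)\<^sup>2 = p" "(sqrt q)\<^sup>2 = q" "(sqrt m)\<^sup>2 = m" using assms m0 by auto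
  have id: "(sqrt p - sqrt q)\<^sup>2 = (2 * sqrt m - s) * (2 * sqrt m + s)"
  proof -
    have "(sqrt p - sqrt q)\<^sup>2 = 2 * ((sqrt p)\<^sup>2 + (sqrt q)\<^sup>2) - s\<^sup>2"
      unfolding s_def by (simp add: power2_eq_square algebra_simps)
    also have "\<dots> = 4 * (sqrt m)\<^sup>2 - s\<^sup>2" unfolding sq by (simp add: m_def)
    finally show ?thesis by (simp add: power2_eq_square algebra_simps)
  qed
  have "(2 * sqrt m)\<^sup>2 - s\<^sup>2 = (sqrt p - sqrt q)\<^sup>2"
    unfolding id by (simp add: power2_eq_square algebra_simps)
  then have "s\<^sup>2 \<le> (2 * sqrt m)\<^sup>2"
    using zero_le_power2[of "sqrt p - sqrt q"] by linarith
  then have s: "s \<le> 2 * sqrt m" by (rule power2_le_imp_le) (use m0 in auto)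
  have s0: "s \<ge> 0" using assms by (simp add: s_def)
  have "(sqrt p - sqrt q)\<^sup>2 \<le> (2 * sqrt m - s) * (4 * sqrt m)"
    unfolding id by (rule mult_left_mono) (use s in auto)
  also have "\<dots> = 2 * (2 * p - 2 * sqrt p * sqrt m + (2 * q - 2 * sqrt q * sqrt m))"
  proof -
    have "(2 * sqrt m - s) * (4 * sqrt m) = 8 * (sqrt m)\<^sup>2 - 4 * s * sqrt m"
      by (simp add: power2_eq_square algebra_simps)
    also have "\<dots> = 4 * (p + q) - 4 * s * sqrt m" unfolding sq by (simp add: m_def)
    finally show ?thesis by (simp add: s_def algebra_simps)
  qed
  also have "\<dots> \<le> 2 * (p * ln (p / m) + q * ln (q / m))"
    using one[of p] one[of q] assms by (simp add: m_def)
  finally show ?thesis by (simp add: m_def)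
qed

text \<open>The bound \<open>ln y \<le> y - 1\<close> at \<open>y = x / m\<close> gives the
  chi-square form \<open>(p - q) * ((p - q) / (2 * m))\<close>, and
  \<open>\<bar>p - q\<bar> \<le> 2 * m\<close>.\<close>

lemma bitinfo_upper:
  fixes p q :: real
  assumes "0 \<le> p" "0 \<le> q"
  shows "p * ln (p / ((p + q) / 2)) + q * ln (q / ((p + q) / 2)) \<le> \<bar>p - q\<bar>"
proof -
  define m where "m = (p + q) / 2"
  show ?thesis
  proof (cases "m = 0")
    case True
    then have "p = 0" "q = 0" using assms by (auto simp: m_def)
    then show ?thesis by simp
  next
    case False
    then have m: "m > 0" using assms by (simp add: m_def)
    have one: "x * ln (x / m) \<le> x * (x / m - 1)" if "0 \<le> x" for x
      using that m by (cases "x = 0") (auto intro!: mult_left_mono ln_le_minus_one)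
    have "p * ln (p / m) + q * ln (q / m) \<le> p * (p / m - 1) + q * (q / m - 1)"
      using one assms by (intro add_mono) auto
    also have "\<dots> = (p - q) * ((p - q) / (2 * m))"
    proof -
      have q: "q = 2 * m - p" by (simp add: m_def field_simps)
      show ?thesis using m unfolding q by (simp add: field_simps)
    qed
    also have "\<dots> \<le> \<bar>p - q\<bar> * 1"
    proof -
      have "\<bar>(p - q) / (2 * m)\<bar> \<le> 1" using m assms by (simp add: m_def abs_le_iff)
      then have "\<bar>(p - q) * ((p - q) / (2 * m))\<bar> \<le> \<bar>p - q\<bar> * 1"
        unfolding abs_mult by (intro mult_left_mono) auto
      then show ?thesis by linarith
    qed
    finally show ?thesis by (simp add: m_def)
  qed
qed

section \<open>Chain rules over individual bits\<close>

definition bitset :: "'a \<Rightarrow> bool \<Rightarrow> 'a set \<Rightarrow> 'a set" where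
  "bitset e b C = (if b then insert e C else C - {e})"

lemma avg_Pow_bit:
  assumes "finite E" "e \<in> E"
  shows "avg (Pow E) (\<lambda>C. f C * \<phi> (e \<in> C)) =
    (avg (Pow E) (\<lambda>C. f (bitset e False C)) * \<phi> False + avg (Pow E) (\<lambda>C. f (bitset e True C)) * \<phi> True) / 2"
proof -
  define F where "F = E - {e}"
  have F: "finite F" "e \<notin> F" "E = insert e F" using assms by (auto simp: F_def)
  have nC: "C \<in> Pow F \<Longrightarrow> e \<notin> C" for C using F by auto
  have 1: "avg (Pow F) (\<lambda>C. f C * \<phi> (e \<in> C)) = avg (Pow F) f * \<phi> False"
    unfolding avg_multc[symmetric] by (rule avg_cong) (use nC in auto)
  have 2: "avg (Pow F) (\<lambda>C. f (insert e C) * \<phi> (e \<in> insert e C)) = avg (Pow F) (\<lambda>C. f (insert e C)) * \<phi> True"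
    unfolding avg_multc[symmetric] by (rule avg_cong) auto
  have 3: "avg (Pow F) (\<lambda>C. f (bitset e False C)) = avg (Pow F) f"
    "avg (Pow F) (\<lambda>C. f (bitset e False (insert e C))) = avg (Pow F) f"
    by (rule avg_cong; use nC in \<open>auto simp: bitset_def\<close>)+
  show ?thesis unfolding F(3) avg_Pow_insert[OF F(1,2)] 1 2 3 by (simp add: bitset_def)
qed

text \<open>Gibbs' inequality against the posterior that treats the bits outside \<open>S\<close> as conditionally
  independent given the transcript and the bits in \<open>S\<close>.\<close>

lemma minfo_bits_lower:
  fixes p :: "'a set \<Rightarrow> 't \<Rightarrow> real"
  assumes fin: "finite S" "finite E" "S \<inter> E = {}" "finite T"
    and p0: "\<And>w t. w \<in> Pow (S \<union> E) \<Longrightarrow> t \<in> T \<Longrightarrow> 0 \<le> p w t"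
    and p1: "\<And>w. w \<in> Pow (S \<union> E) \<Longrightarrow> (\<Sum>t\<in>T. p w t) = 1"
  defines "pS \<equiv> \<lambda>A t. avg (Pow E) (\<lambda>C. p (A \<union> C) t)"
  defines "pe \<equiv> \<lambda>A e b t. avg (Pow E) (\<lambda>C. p (A \<union> bitset e b C) t)"
  shows "minfo (Pow S) T pS + avg (Pow S) (\<lambda>A. \<Sum>e\<in>E. hdist T (pe A e False) (pe A e True) / 4)
     \<le> minfo (Pow (S \<union> E)) T p"
proof -
  let ?J = "S \<union> E"
  let ?a = "\<lambda>t. avg (Pow ?J) (\<lambda>w. p w t)"
  define r where "r = (\<lambda>w t. pS (w \<inter> S) t * (\<Prod>e\<in>E. pe (w \<inter> S) e (e \<in> w) t / pS (w \<inter> S) t))"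
  have AC: "A \<union> C \<in> Pow ?J" if "A \<in> Pow S" "C \<in> Pow E" for A C using that by auto
  have pp: "0 \<le> p (A \<union> C) t" if "A \<in> Pow S" "C \<in> Pow E" "t \<in> T" for A C t
    by (intro p0 AC that)
  have ppe: "0 \<le> p (A \<union> bitset e b C) t" if "A \<in> Pow S" "C \<in> Pow E" "t \<in> T" "e \<in> E" for A C t e b
    by (rule p0) (use that in \<open>auto simp: bitset_def\<close>)
  have pS0: "0 \<le> pS A t" if "A \<in> Pow S" "t \<in> T" for A t
    unfolding pS_def by (rule avg_nonneg) (use pp that in auto)
  have pe0: "0 \<le> pe A e b t" if "A \<in> Pow S" "t \<in> T" "e \<in> E" for A e b t
    unfolding pe_def by (rule avg_nonneg) (use ppe that in auto)
  have pSe: "pS A t = (pe A e False t + pe A e True t) / 2" if "e \<in> E" for A e t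
    unfolding pS_def pe_def using avg_Pow_bit[OF fin(2) that, where f = "\<lambda>C. p (A \<union> C) t" and \<phi> = "\<lambda>_. 1"]
    by simp
  have pSpos: "0 < pS A t" if "A \<in> Pow S" "C \<in> Pow E" "t \<in> T" "0 < p (A \<union> C) t" for A C t
    unfolding pS_def by (rule avg_pos[of _ C]) (use that pp fin in auto)
  have pepos: "0 < pe A e (e \<in> C) t" if "A \<in> Pow S" "C \<in> Pow E" "t \<in> T" "0 < p (A \<union> C) t" "e \<in> E" for A C t e
    unfolding pe_def
  proof (rule avg_pos[of _ C])
    show "0 < p (A \<union> bitset e (e \<in> C) C) t"
      using that by (auto simp: bitset_def insert_absorb)
  qed (use that ppe fin in auto)
  have apos: "0 < ?a t" if "A \<in> Pow S" "C \<in> Pow E" "t \<in> T" "0 < p (A \<union> C) t" for A C t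
    by (rule avg_pos[of _ "A \<union> C"]) (use that p0 fin in auto)
  have rAC: "r (A \<union> C) t = pS A t * (\<Prod>e\<in>E. pe A e (e \<in> C) t / pS A t)"
    if "A \<in> Pow S" "C \<in> Pow E" for A C t
  proof -
    have *: "(A \<union> C) \<inter> S = A" "\<And>e. e \<in> E \<Longrightarrow> e \<in> A \<union> C \<longleftrightarrow> e \<in> C" using that fin(3) by auto
    show ?thesis unfolding r_def *(1) using *(2) by simp
  qed
  have split: "avg (Pow ?J) f = avg (Pow S) (\<lambda>A. avg (Pow E) (\<lambda>C. f (A \<union> C)))" for f
    by (rule avg_Pow_union) (use fin in auto)
  \<comment> \<open>For fixed \<open>A\<close> the bits are independent, and the two likelihood
    ratios of each bit average to 1 because \<open>pS\<close> is the mean of its two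
    \<open>pe\<close>. So the competitor has the mass of \<open>pS\<close>; both vanish when
    \<open>pS A t = 0\<close>.\<close>
  have sumr: "avg (Pow E) (\<lambda>C. r (A \<union> C) t) \<le> pS A t" if "A \<in> Pow S" "t \<in> T" for A t
  proof -
    have "avg (Pow E) (\<lambda>C. r (A \<union> C) t) = pS A t * avg (Pow E) (\<lambda>C. \<Prod>e\<in>E. pe A e (e \<in> C) t / pS A t)"
      unfolding avg_cmult[symmetric] by (rule avg_cong) (use that rAC in auto)
    also have "\<dots> = pS A t * (\<Prod>e\<in>E. (pe A e False t / pS A t + pe A e True t / pS A t) / 2)"
      by (subst avg_Pow_prod[OF fin(2)]) simp
    also have "\<dots> = pS A t"
    proof (cases "pS A t = 0")
      case False
      have "(pe A e False t / pS A t + pe A e True t / pS A t) / 2 = 1" if "e \<in> E" for e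
        using False pSe[OF that, of A t] by (simp add: field_simps)
      then show ?thesis by simp
    qed simp
    finally show ?thesis by simp
  qed
  have pS1: "(\<Sum>t\<in>T. pS A t) = 1" if "A \<in> Pow S" for A
  proof -
    have "(\<Sum>t\<in>T. pS A t) = avg (Pow E) (\<lambda>C. 1)"
      unfolding pS_def avg_sum[symmetric] by (intro avg_cong refl p1 AC that)
    then show ?thesis using fin by (simp add: avg_const Pow_not_empty)
  qed
  have main: "avg (Pow ?J) (\<lambda>w. \<Sum>t\<in>T. p w t * ln (r w t / ?a t)) \<le> minfo (Pow ?J) T p"
  proof (rule minfo_ge)
    show "avg (Pow ?J) (\<lambda>w. \<Sum>t\<in>T. r w t) \<le> 1"
    proof -
      have "avg (Pow ?J) (\<lambda>w. \<Sum>t\<in>T. r w t) = avg (Pow S) (\<lambda>A. \<Sum>t\<in>T. avg (Pow E) (\<lambda>C. r (A \<union> C) t))"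
        by (simp add: split avg_sum)
      also have "\<dots> \<le> avg (Pow S) (\<lambda>A. \<Sum>t\<in>T. pS A t)"
        by (intro avg_mono sum_mono sumr) auto
      also have "\<dots> = avg (Pow S) (\<lambda>A. 1)" by (rule avg_cong) (auto simp: pS1)
      also have "\<dots> = 1" using fin by (simp add: avg_const Pow_not_empty)
      finally show ?thesis .
    qed
    fix w t assume w: "w \<in> Pow ?J" and t: "t \<in> T"
    have w': "w = (w \<inter> S) \<union> (w \<inter> E)" "w \<inter> S \<in> Pow S" "w \<inter> E \<in> Pow E" using w by auto
    have rw: "r w t = pS (w \<inter> S) t * (\<Prod>e\<in>E. pe (w \<inter> S) e (e \<in> w) t / pS (w \<inter> S) t)"
      by (simp add: r_def)
    show "0 \<le> r w t" unfolding rw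
      by (intro mult_nonneg_nonneg prod_nonneg pS0 ballI divide_nonneg_nonneg pe0) (use t w' in auto)
    assume pos: "0 < p w t"
    have "0 < pS (w \<inter> S) t" using pSpos[OF w'(2,3) t] w'(1) pos by simp
    moreover have "0 < pe (w \<inter> S) e (e \<in> w) t" if "e \<in> E" for e
      using pepos[OF w'(2,3) t _ that] w'(1) pos that by simp
    ultimately show "0 < r w t" unfolding rw by (intro mult_pos_pos prod_pos ballI divide_pos_pos) auto
  qed (use fin p0 p1 in auto)
  \<comment> \<open>The logarithm splits into the term of the information about the bits in
    \<open>S\<close> and one single-bit term for each \<open>e\<close>; after averaging, the latter
    are bounded below by \<open>bitinfo_lower\<close>.\<close>
  have logr: "p (A \<union> C) t * ln (r (A \<union> C) t / ?a t) =
      p (A \<union> C) t * ln (pS A t / ?a t) + (\<Sum>e\<in>E. p (A \<union> C) t * ln (pe A e (e \<in> C) t / pS A t))"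
    if AC: "A \<in> Pow S" "C \<in> Pow E" "t \<in> T" for A C t
  proof (cases "p (A \<union> C) t = 0")
    case False
    then have pos: "0 < p (A \<union> C) t" using pp[OF AC] by simp
    have a: "0 < pS A t" "0 < ?a t" using pSpos[OF AC pos] apos[OF AC pos] by auto
    have b: "0 < pe A e (e \<in> C) t" if "e \<in> E" for e using pepos[OF AC pos that] .
    have "ln (r (A \<union> C) t / ?a t) = ln (pS A t / ?a t * (\<Prod>e\<in>E. pe A e (e \<in> C) t / pS A t))"
      using rAC AC by simp
    also have "\<dots> = ln (pS A t / ?a t) + ln (\<Prod>e\<in>E. pe A e (e \<in> C) t / pS A t)"
      by (rule ln_mult_pos) (use a b in \<open>auto intro!: prod_pos divide_pos_pos\<close>)
    also have "ln (\<Prod>e\<in>E. pe A e (e \<in> C) t / pS A t) = (\<Sum>e\<in>E. ln (pe A e (e \<in> C) t / pS A t))"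
    proof (rule ln_prod)
      show "pe A e (e \<in> C) t / pS A t \<noteq> 0" if "e \<in> E" for e
        using a b[OF that] by simp
    qed (use fin in auto)
    finally show ?thesis by (simp add: algebra_simps sum_distrib_left)
  qed simp
  have "avg (Pow ?J) (\<lambda>w. \<Sum>t\<in>T. p w t * ln (r w t / ?a t)) =
     avg (Pow S) (\<lambda>A. avg (Pow E) (\<lambda>C. \<Sum>t\<in>T. p (A \<union> C) t * ln (pS A t / ?a t) +
        (\<Sum>e\<in>E. p (A \<union> C) t * ln (pe A e (e \<in> C) t / pS A t))))"
    unfolding split[of "\<lambda>w. \<Sum>t\<in>T. p w t * ln (r w t / ?a t)"]
    by (intro avg_cong refl sum.cong logr)
  also have "\<dots> = avg (Pow S) (\<lambda>A. \<Sum>t\<in>T. pS A t * ln (pS A t / ?a t)) +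
     avg (Pow S) (\<lambda>A. \<Sum>e\<in>E. \<Sum>t\<in>T. avg (Pow E) (\<lambda>C. p (A \<union> C) t * ln (pe A e (e \<in> C) t / pS A t)))"
    unfolding avg_add[symmetric]
    by (intro avg_cong refl) (simp add: sum.distrib avg_add avg_sum avg_multc pS_def sum.swap[of _ E T])
  also have "avg (Pow S) (\<lambda>A. \<Sum>t\<in>T. pS A t * ln (pS A t / ?a t)) = minfo (Pow S) T pS"
    unfolding minfo_def pS_def split[of "\<lambda>w. p w _"] ..
  finally have eq: "avg (Pow ?J) (\<lambda>w. \<Sum>t\<in>T. p w t * ln (r w t / ?a t)) = minfo (Pow S) T pS +
    avg (Pow S) (\<lambda>A. \<Sum>e\<in>E. \<Sum>t\<in>T. avg (Pow E) (\<lambda>C. p (A \<union> C) t * ln (pe A e (e \<in> C) t / pS A t)))" .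
  have "avg (Pow S) (\<lambda>A. \<Sum>e\<in>E. hdist T (pe A e False) (pe A e True) / 4) \<le>
    avg (Pow S) (\<lambda>A. \<Sum>e\<in>E. \<Sum>t\<in>T. avg (Pow E) (\<lambda>C. p (A \<union> C) t * ln (pe A e (e \<in> C) t / pS A t)))"
  proof (intro avg_mono sum_mono)
    fix A e assume A: "A \<in> Pow S" and e: "e \<in> E"
    have "hdist T (pe A e False) (pe A e True) / 4 = (\<Sum>t\<in>T. (sqrt (pe A e False t) - sqrt (pe A e True t))\<^sup>2 / 2 / 2)"
      by (simp add: hdist_def sum_divide_distrib)
    also have "\<dots> \<le> (\<Sum>t\<in>T. avg (Pow E) (\<lambda>C. p (A \<union> C) t * ln (pe A e (e \<in> C) t / pS A t)))"
    proof (rule sum_mono)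
      fix t assume t: "t \<in> T"
      have *: "avg (Pow E) (\<lambda>C. p (A \<union> C) t * ln (pe A e (e \<in> C) t / pS A t)) =
        (pe A e False t * ln (pe A e False t / pS A t) + pe A e True t * ln (pe A e True t / pS A t)) / 2"
        using avg_Pow_bit[OF fin(2) e, where f = "\<lambda>C. p (A \<union> C) t" and \<phi> = "\<lambda>b. ln (pe A e b t / pS A t)"]
        by (simp add: pe_def)
      show "(sqrt (pe A e False t) - sqrt (pe A e True t))\<^sup>2 / 2 / 2 \<le>
        avg (Pow E) (\<lambda>C. p (A \<union> C) t * ln (pe A e (e \<in> C) t / pS A t))"
        using bitinfo_lower[OF pe0[OF A t e, of False] pe0[OF A t e, of True]]
        unfolding * pSe[OF e, of A t, symmetric] by (rule divide_right_mono) simp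
    qed
    finally show "hdist T (pe A e False) (pe A e True) / 4 \<le>
      (\<Sum>t\<in>T. avg (Pow E) (\<lambda>C. p (A \<union> C) t * ln (pe A e (e \<in> C) t / pS A t)))" .
  qed
  then show ?thesis using main eq by simp
qed

text \<open>Chain rule for one bit: the total information is the information about \<open>S\<close>
  under the kernel averaged over bit \<open>e\<close>, plus the mean information about
  \<open>e\<close> given the rest, which \<open>bitinfo_upper\<close> bounds by half an L1
  distance.\<close>

lemma minfo_Pow_insert:
  fixes p :: "'a set \<Rightarrow> 't \<Rightarrow> real"
  assumes fin: "finite S" "e \<notin> S" "finite T"
    and p0: "\<And>w t. w \<in> Pow (insert e S) \<Longrightarrow> t \<in> T \<Longrightarrow> 0 \<le> p w t"
  shows "minfo (Pow (insert e S)) T p \<le>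
    minfo (Pow S) T (\<lambda>A t. (p A t + p (insert e A) t) / 2) +
    avg (Pow S) (\<lambda>A. \<Sum>t\<in>T. \<bar>p A t - p (insert e A) t\<bar> / 2)"
proof -
  define m where "m = (\<lambda>A t. (p A t + p (insert e A) t) / 2)"
  define a where "a t = avg (Pow (insert e S)) (\<lambda>w. p w t)" for t
  have a': "a t = avg (Pow S) (\<lambda>A. m A t)" for t
    unfolding a_def m_def avg_Pow_insert[OF fin(1,2)] by (simp add: avg_add avg_divide add_divide_distrib)
  have "minfo (Pow (insert e S)) T p = avg (Pow S) (\<lambda>A. \<Sum>t\<in>T. (p A t * ln (p A t / a t) + p (insert e A) t * ln (p (insert e A) t / a t)) / 2)"
    unfolding minfo_def a_def[symmetric] avg_Pow_insert[OF fin(1,2)]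
    by (simp add: sum_divide_distrib[symmetric] sum.distrib avg_add avg_divide)
  also have "\<dots> \<le> avg (Pow S) (\<lambda>A. \<Sum>t\<in>T. m A t * ln (m A t / a t) + \<bar>p A t - p (insert e A) t\<bar> / 2)"
  proof (intro avg_mono sum_mono)
    fix A t assume A: "A \<in> Pow S" and t: "t \<in> T"
    have nn: "0 \<le> p A t" "0 \<le> p (insert e A) t"
      using p0[of A t] p0[of "insert e A" t] A t by auto
    have mp: "0 < a t" if "0 < m A t"
      unfolding a'
    proof (rule avg_pos[of _ A])
      show "0 \<le> m A' t" if "A' \<in> Pow S" for A'
        using p0[of A' t] p0[of "insert e A'" t] that t by (auto simp: m_def subset_insertI2)
    qed (use A that fin in auto)
    have one: "x * ln (x / a t) = x * ln (x / m A t) + x * ln (m A t / a t)" if "0 \<le> x" "x \<le> 2 * m A t" for x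
    proof (cases "x = 0")
      case False
      then have "0 < x" "0 < m A t" using that by auto
      with mp show ?thesis by (simp add: ln_div algebra_simps)
    qed simp
    have "p A t * ln (p A t / a t) + p (insert e A) t * ln (p (insert e A) t / a t) =
       (p A t * ln (p A t / m A t) + p (insert e A) t * ln (p (insert e A) t / m A t)) + 2 * m A t * ln (m A t / a t)"
    proof -
      have m2: "2 * m A t = p A t + p (insert e A) t" by (simp add: m_def)
      have le: "p A t \<le> 2 * m A t" "p (insert e A) t \<le> 2 * m A t" using nn m2 by auto
      show ?thesis unfolding m2 one[OF nn(1) le(1)] one[OF nn(2) le(2)] by (simp only: distrib_right)
    qed
    also have "\<dots> \<le> \<bar>p A t - p (insert e A) t\<bar> + 2 * m A t * ln (m A t / a t)"
      using bitinfo_upper[OF nn] by (simp add: m_def)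
    finally show "(p A t * ln (p A t / a t) + p (insert e A) t * ln (p (insert e A) t / a t)) / 2 \<le>
       m A t * ln (m A t / a t) + \<bar>p A t - p (insert e A) t\<bar> / 2" by simp
  qed
  also have "\<dots> = minfo (Pow S) T m + avg (Pow S) (\<lambda>A. \<Sum>t\<in>T. \<bar>p A t - p (insert e A) t\<bar> / 2)"
    by (simp add: minfo_def a' sum.distrib avg_add)
  finally show ?thesis by (simp add: m_def)
qed

text \<open>Bits are removed one at a time by the chain rule. By the triangle inequality, averaging
  the kernel over a removed bit does not increase the mean sensitivity to another bit, so every term
  can be written with the original kernel.\<close>

lemma minfo_bits_upper:
  fixes p :: "'a set \<Rightarrow> 't \<Rightarrow> real"
  assumes "finite S" "finite T" "\<And>w t. w \<in> Pow S \<Longrightarrow> t \<in> T \<Longrightarrow> 0 \<le> p w t"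
  shows "minfo (Pow S) T p \<le>
    (\<Sum>e\<in>S. avg (Pow S) (\<lambda>A. \<Sum>t\<in>T. \<bar>p (bitset e False A) t - p (bitset e True A) t\<bar> / 2))"
  using assms(1,3)
proof (induction S arbitrary: p rule: finite_induct)
  case empty
  have z: "x * ln (x / x) = 0" for x :: real by (cases "x = 0") auto
  have a: "avg (Pow {}) f = f {}" for f :: "'a set \<Rightarrow> real" by (simp add: avg_def)
  show ?case unfolding minfo_def a z by simp
next
  case (insert x F)
  let ?d = "\<lambda>p e A. \<Sum>t\<in>T. \<bar>p (bitset e False A) t - p (bitset e True A) t\<bar> / 2"
  define m where "m = (\<lambda>A t. (p A t + p (insert x A) t) / 2)"
  have "minfo (Pow (insert x F)) T p \<le> minfo (Pow F) T m + avg (Pow F) (\<lambda>A. \<Sum>t\<in>T. \<bar>p A t - p (insert x A) t\<bar> / 2)"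
    unfolding m_def by (rule minfo_Pow_insert) (use insert assms in auto)
  also have "avg (Pow F) (\<lambda>A. \<Sum>t\<in>T. \<bar>p A t - p (insert x A) t\<bar> / 2) = avg (Pow (insert x F)) (?d p x)"
  proof -
    have "bitset x False A = A" "bitset x False (insert x A) = A" "bitset x True (insert x A) = insert x A"
      "bitset x True A = insert x A" if "A \<in> Pow F" for A
      using that insert by (auto simp: bitset_def)
    note b = this
    have "avg (Pow F) (?d p x) = avg (Pow F) (\<lambda>A. \<Sum>t\<in>T. \<bar>p A t - p (insert x A) t\<bar> / 2)"
      "avg (Pow F) (\<lambda>A. ?d p x (insert x A)) = avg (Pow F) (\<lambda>A. \<Sum>t\<in>T. \<bar>p A t - p (insert x A) t\<bar> / 2)"
      by (rule avg_cong; simp add: b)+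
    then show ?thesis using insert by (subst avg_Pow_insert) auto
  qed
  also have "minfo (Pow F) T m \<le> (\<Sum>e\<in>F. avg (Pow F) (?d m e))"
  proof (rule insert.IH)
    show "0 \<le> m w t" if "w \<in> Pow F" "t \<in> T" for w t
      using insert.prems[of w t] insert.prems[of "insert x w" t] that by (auto simp: m_def subset_insertI2)
  qed
  also have "(\<Sum>e\<in>F. avg (Pow F) (?d m e)) \<le> (\<Sum>e\<in>F. avg (Pow (insert x F)) (?d p e))"
  proof (rule sum_mono)
    fix e assume e: "e \<in> F"
    then have "x \<noteq> e" using insert by auto
    then have b: "bitset e b (insert x A) = insert x (bitset e b A)" for b A by (auto simp: bitset_def)
    have "avg (Pow F) (?d m e) \<le> avg (Pow F) (\<lambda>A. (?d p e A + ?d p e (insert x A)) / 2)"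
    proof (rule avg_mono)
      fix A
      have "?d m e A \<le> (\<Sum>t\<in>T. (\<bar>p (bitset e False A) t - p (bitset e True A) t\<bar> / 2 +
         \<bar>p (bitset e False (insert x A)) t - p (bitset e True (insert x A)) t\<bar> / 2) / 2)"
        unfolding b m_def by (intro sum_mono) (simp add: abs_if field_simps)
      then show "?d m e A \<le> (?d p e A + ?d p e (insert x A)) / 2"
        by (simp add: sum.distrib sum_divide_distrib[symmetric])
    qed
    also have "\<dots> = avg (Pow (insert x F)) (?d p e)"
      using insert by (subst avg_Pow_insert) (auto simp: avg_divide avg_add)
    finally show "avg (Pow F) (?d m e) \<le> avg (Pow (insert x F)) (?d p e)" .
  qed
  finally show ?case using insert by simp
qed

section \<open>Transport to the uniform measure on the cube\<close>

text \<open>Four times the Hamming distance, written as a squared Euclidean distance because it is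
  compared with projections.\<close>

definition sqd :: "'a set \<Rightarrow> 'a set \<Rightarrow> 'a set \<Rightarrow> real" where
  "sqd J A B = (\<Sum>j\<in>J. (sg j A - sg j B)\<^sup>2)"

text \<open>With total mass \<open>m\<close>, this is \<open>m\<close> times the divergence of the
  normalised \<mu> from the uniform distribution. It is homogeneous in \<mu>, so that the deficits
  of the pieces of a decomposition can be added.\<close>

definition deficit :: "'a set \<Rightarrow> ('a set \<Rightarrow> real) \<Rightarrow> real" where
  "deficit J \<mu> = (\<Sum>A\<in>Pow J. \<mu> A * ln (2 ^ card J * \<mu> A / (\<Sum>A\<in>Pow J. \<mu> A)))"

lemma sum_Pow_insert:
  assumes "finite J" "e \<notin> J"
  shows "(\<Sum>C\<in>Pow (insert e J). f C) = (\<Sum>C\<in>Pow J. f C + f (insert e C))"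
proof -
  have "inj_on (insert e) (Pow J)" using assms by (auto simp: inj_on_def)
  moreover have "Pow J \<inter> insert e ` Pow J = {}" using assms by auto
  ultimately show ?thesis
    unfolding Pow_insert using assms by (subst sum.union_disjoint) (auto simp: sum.reindex sum.distrib)
qed

text \<open>A weak Pinsker inequality for one bit: \<open>bitinfo_lower\<close> at
  \<open>q = 1 - p\<close>, where the mean is 1/2, combined with
  \<open>(a + b)\<^sup>2 \<le> 2\<close> for the two roots.\<close>

lemma binary_deficit:
  fixes p :: real
  assumes "0 \<le> p" "p \<le> 1"
  shows "(p - 1/2)\<^sup>2 \<le> p * ln (2 * p) + (1 - p) * ln (2 * (1 - p))"
proof -
  define a b where "a = sqrt p" and "b = sqrt (1 - p)"
  have ab: "a\<^sup>2 = p" "b\<^sup>2 = 1 - p" "a \<ge> 0" "b \<ge> 0" using assms by (auto simp: a_def b_def)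
  have "(a + b)\<^sup>2 \<le> 2 * (a\<^sup>2 + b\<^sup>2)"
    using zero_le_power2[of "a - b"] by (simp add: power2_eq_square algebra_simps)
  then have "(a + b)\<^sup>2 \<le> 2" using ab by simp
  then have "(a - b)\<^sup>2 * (a + b)\<^sup>2 \<le> (a - b)\<^sup>2 * 2" by (intro mult_left_mono) auto
  moreover have "(a - b)\<^sup>2 * (a + b)\<^sup>2 = (a\<^sup>2 - b\<^sup>2)\<^sup>2"
    by (simp add: power2_eq_square algebra_simps)
  ultimately have "(2 * p - 1)\<^sup>2 \<le> (a - b)\<^sup>2 * 2" using ab by simp
  moreover have "(2 * p - 1)\<^sup>2 = 4 * (p - 1/2)\<^sup>2" by (simp add: power2_eq_square algebra_simps)
  ultimately have "(p - 1/2)\<^sup>2 \<le> (a - b)\<^sup>2 / 2" by linarith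
  also have "\<dots> \<le> p * ln (2 * p) + (1 - p) * ln (2 * (1 - p))"
    using bitinfo_lower[of p "1 - p"] assms by (simp add: a_def b_def mult.commute)
  finally show ?thesis .
qed

text \<open>The optimal coupling of a bit that is true with probability \<open>p\<close> (argument
  \<open>a\<close>) and a fair bit (argument \<open>b\<close>): they differ only with probability
  \<open>\<bar>p - 1/2\<bar>\<close>.\<close>

definition bitcoup :: "real \<Rightarrow> bool \<Rightarrow> bool \<Rightarrow> real" where
  "bitcoup p a b = (if a then (if b then min p (1/2) else max (p - 1/2) 0)
     else (if b then max (1/2 - p) 0 else min (1 - p) (1/2)))"

lemma bitcoup:
  assumes "0 \<le> p" "p \<le> 1"
  shows "0 \<le> bitcoup p a b" "bitcoup p a False + bitcoup p a True = (if a then p else 1 - p)"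
    "bitcoup p False b + bitcoup p True b = 1 / 2"
    "bitcoup p False True + bitcoup p True False = \<bar>p - 1/2\<bar>"
  using assms by (auto simp: bitcoup_def min_def max_def abs_if)

text \<open>Marton's inequality, linearised by the arithmetic-geometric mean inequality with parameter \<open>\<tau>\<close>.\<close>

lemma transport:
  fixes \<mu> :: "'a set \<Rightarrow> real"
  assumes "finite J" "0 < \<tau>" "\<And>A. A \<in> Pow J \<Longrightarrow> 0 \<le> \<mu> A"
  shows "\<exists>\<gamma>. (\<forall>A\<in>Pow J. \<forall>B\<in>Pow J. 0 \<le> \<gamma> A B) \<and>
     (\<forall>A\<in>Pow J. (\<Sum>B\<in>Pow J. \<gamma> A B) = \<mu> A) \<and>
     (\<forall>B\<in>Pow J. (\<Sum>A\<in>Pow J. \<gamma> A B) = (\<Sum>A\<in>Pow J. \<mu> A) / 2 ^ card J) \<and>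
     (\<Sum>A\<in>Pow J. \<Sum>B\<in>Pow J. \<gamma> A B * sqd J A B) \<le>
        4 * deficit J \<mu> / \<tau> + (\<Sum>A\<in>Pow J. \<mu> A) * card J * \<tau>"
  using assms(1,3)
proof (induction J arbitrary: \<mu> rule: finite_induct)
  case empty
  have z: "x * ln (x / x) = 0" for x :: real by (cases "x = 0") auto
  show ?case
    by (rule exI[of _ "\<lambda>_ _. \<mu> {}"]) (use empty z[of "\<mu> {}"] in \<open>auto simp: sqd_def deficit_def\<close>)
next
  case (insert x F)
  define \<nu> where "\<nu> A = \<mu> A + \<mu> (insert x A)" for A
  define w where "w = (\<Sum>A\<in>Pow F. \<nu> A)"
  have w: "(\<Sum>A\<in>Pow (insert x F). \<mu> A) = w"
    using insert by (simp add: sum_Pow_insert w_def \<nu>_def)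
  have \<mu>0: "0 \<le> \<mu> A" "0 \<le> \<mu> (insert x A)" if "A \<in> Pow F" for A
    using insert.prems[of A] insert.prems[of "insert x A"] that by auto
  have \<nu>0: "0 \<le> \<nu> A" if "A \<in> Pow F" for A
    using \<mu>0 that by (simp add: \<nu>_def)
  have "\<exists>g. (\<forall>A\<in>Pow F. \<forall>B\<in>Pow F. 0 \<le> g A B) \<and> (\<forall>A\<in>Pow F. (\<Sum>B\<in>Pow F. g A B) = \<nu> A) \<and>
     (\<forall>B\<in>Pow F. (\<Sum>A\<in>Pow F. g A B) = w / 2 ^ card F) \<and>
     (\<Sum>A\<in>Pow F. \<Sum>B\<in>Pow F. g A B * sqd F A B) \<le> 4 * deficit F \<nu> / \<tau> + w * card F * \<tau>"
    unfolding w_def by (rule insert.IH[OF \<nu>0])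
  then obtain g where G: "\<forall>A\<in>Pow F. \<forall>B\<in>Pow F. 0 \<le> g A B" "\<forall>A\<in>Pow F. (\<Sum>B\<in>Pow F. g A B) = \<nu> A"
     "\<forall>B\<in>Pow F. (\<Sum>A\<in>Pow F. g A B) = w / 2 ^ card F"
    and g3: "(\<Sum>A\<in>Pow F. \<Sum>B\<in>Pow F. g A B * sqd F A B) \<le> 4 * deficit F \<nu> / \<tau> + w * card F * \<tau>"
    by (elim exE conjE)
  note g0 = G(1)[rule_format] and g1 = G(2)[rule_format] and g2 = G(3)[rule_format]
  \<comment> \<open>Conditional probability of the new bit given the old ones; the default 1/2,
    where the condition has mass 0, keeps it in the unit interval.\<close>
  define p where "p A = (if \<nu> A = 0 then 1/2 else \<mu> (insert x A) / \<nu> A)" for A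
  have p01: "0 \<le> p A" "p A \<le> 1" if "A \<in> Pow F" for A
    using \<mu>0[OF that] by (auto simp: p_def \<nu>_def divide_le_eq_1)
  have p\<nu>: "\<nu> A * p A = \<mu> (insert x A)" "\<nu> A * (1 - p A) = \<mu> A" if "A \<in> Pow F" for A
  proof -
    show 1: "\<nu> A * p A = \<mu> (insert x A)"
      using \<mu>0[OF that] by (auto simp: p_def \<nu>_def)
    then show "\<nu> A * (1 - p A) = \<mu> A" by (simp add: right_diff_distrib \<nu>_def)
  qed
  \<comment> \<open>The old bits are coupled by induction, the new bit optimally given
    \<open>A\<close>. Its partner is fair for every \<open>A\<close>, hence independent of the rest
    of \<open>B\<close>, so that \<open>B\<close> stays uniform.\<close>
  define h where "h A B = g (A - {x}) (B - {x}) * bitcoup (p (A - {x})) (x \<in> A) (x \<in> B)" for A B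
  have rem: "A - {x} = A" "insert x A - {x} = A" "x \<notin> A" if "A \<in> Pow F" for A using that insert by auto
  have hF: "h A B = g A B * bitcoup (p A) False False" "h A (insert x B) = g A B * bitcoup (p A) False True"
    "h (insert x A) B = g A B * bitcoup (p A) True False"
    "h (insert x A) (insert x B) = g A B * bitcoup (p A) True True"
    if "A \<in> Pow F" "B \<in> Pow F" for A B
    unfolding h_def using rem[OF that(1)] rem[OF that(2)] by simp_all
  note SP = sum_Pow_insert[OF insert.hyps]
  have in_cases: "P A" if "A \<in> Pow (insert x F)" "\<And>A. A \<in> Pow F \<Longrightarrow> P A" "\<And>A. A \<in> Pow F \<Longrightarrow> P (insert x A)" for A P
    using that unfolding Pow_insert by auto
  have nonneg: "0 \<le> h A B" if "A \<in> Pow (insert x F)" "B \<in> Pow (insert x F)" for A B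
    unfolding h_def by (intro mult_nonneg_nonneg g0 bitcoup p01) (use that in auto)
  have m1: "(\<Sum>B\<in>Pow (insert x F). h A B) = \<mu> A" if "A \<in> Pow (insert x F)" for A
    using that
  proof (rule in_cases)
    fix A assume A: "A \<in> Pow F"
    have "(\<Sum>B\<in>Pow (insert x F). h A B) = (\<Sum>B\<in>Pow F. g A B * (bitcoup (p A) False False + bitcoup (p A) False True))"
      unfolding SP by (rule sum.cong) (use A hF in \<open>auto simp: algebra_simps\<close>)
    then show "(\<Sum>B\<in>Pow (insert x F). h A B) = \<mu> A"
      using g1[OF A] p\<nu>[OF A] by (simp add: bitcoup(2) p01[OF A] sum_distrib_right[symmetric])
    have "(\<Sum>B\<in>Pow (insert x F). h (insert x A) B) = (\<Sum>B\<in>Pow F. g A B * (bitcoup (p A) True False + bitcoup (p A) True True))"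
      unfolding SP by (rule sum.cong) (use A hF in \<open>auto simp: algebra_simps\<close>)
    then show "(\<Sum>B\<in>Pow (insert x F). h (insert x A) B) = \<mu> (insert x A)"
      using g1[OF A] p\<nu>[OF A] by (simp add: bitcoup(2) p01[OF A] sum_distrib_right[symmetric])
  qed
  have m2: "(\<Sum>A\<in>Pow (insert x F). h A B) = w / 2 ^ card (insert x F)" if "B \<in> Pow (insert x F)" for B
    using that
  proof (rule in_cases)
    fix B assume B: "B \<in> Pow F"
    have "(\<Sum>A\<in>Pow (insert x F). h A B) = (\<Sum>A\<in>Pow F. g A B * (bitcoup (p A) False False + bitcoup (p A) True False))"
      unfolding SP by (rule sum.cong) (use B hF in \<open>auto simp: algebra_simps\<close>)
    also have "\<dots> = (\<Sum>A\<in>Pow F. g A B * (1 / 2))"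
      by (intro sum.cong refl arg_cong2[where f = "(*)"] bitcoup p01)
    finally show "(\<Sum>A\<in>Pow (insert x F). h A B) = w / 2 ^ card (insert x F)"
      using g2[OF B] insert by (simp add: sum_divide_distrib[symmetric])
    have "(\<Sum>A\<in>Pow (insert x F). h A (insert x B)) = (\<Sum>A\<in>Pow F. g A B * (bitcoup (p A) False True + bitcoup (p A) True True))"
      unfolding SP by (rule sum.cong) (use B hF in \<open>auto simp: algebra_simps\<close>)
    also have "\<dots> = (\<Sum>A\<in>Pow F. g A B * (1 / 2))"
      by (intro sum.cong refl arg_cong2[where f = "(*)"] bitcoup p01)
    finally show "(\<Sum>A\<in>Pow (insert x F). h A (insert x B)) = w / 2 ^ card (insert x F)"
      using g2[OF B] insert by (simp add: sum_divide_distrib[symmetric])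
  qed
  define q where "q A = p A * ln (2 * p A) + (1 - p A) * ln (2 * (1 - p A))" for A
  \<comment> \<open>Chain rule for relative entropy: the deficit of the marginal plus the mean
    deficit \<open>q A\<close> of the new bit.\<close>
  have def_eq: "deficit (insert x F) \<mu> = deficit F \<nu> + (\<Sum>A\<in>Pow F. \<nu> A * q A)"
  proof -
    have "deficit (insert x F) \<mu> = (\<Sum>A\<in>Pow F. \<mu> A * ln (2 ^ card (insert x F) * \<mu> A / w) + \<mu> (insert x A) * ln (2 ^ card (insert x F) * \<mu> (insert x A) / w))"
      unfolding deficit_def w by (rule SP)
    also have "\<dots> = (\<Sum>A\<in>Pow F. \<nu> A * ln (2 ^ card F * \<nu> A / w) + \<nu> A * q A)"
    proof (rule sum.cong[OF refl])
      fix A assume A: "A \<in> Pow F"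
      show "\<mu> A * ln (2 ^ card (insert x F) * \<mu> A / w) + \<mu> (insert x A) * ln (2 ^ card (insert x F) * \<mu> (insert x A) / w) =
        \<nu> A * ln (2 ^ card F * \<nu> A / w) + \<nu> A * q A"
      proof (cases "\<nu> A = 0")
        case True
        then have "\<mu> A = 0" "\<mu> (insert x A) = 0" using \<mu>0[OF A] by (auto simp: \<nu>_def)
        then show ?thesis using True by simp
      next
        case False
        then have n: "\<nu> A > 0" using \<nu>0[OF A] by simp
        have "\<nu> A \<le> w" unfolding w_def using A \<nu>0 insert by (intro member_le_sum) auto
        then have wp: "w > 0" using n by simp
        have one: "\<nu> A * y * ln (2 ^ card (insert x F) * (\<nu> A * y) / w) = \<nu> A * y * ln (2 ^ card F * \<nu> A / w) + \<nu> A * (y * ln (2 * y))"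
          if "0 \<le> y" for y
        proof (cases "y = 0")
          case False
          have "2 ^ card (insert x F) * (\<nu> A * y) / w = (2 ^ card F * \<nu> A / w) * (2 * y)"
            using insert by simp
          moreover have "ln ((2 ^ card F * \<nu> A / w) * (2 * y)) = ln (2 ^ card F * \<nu> A / w) + ln (2 * y)"
            by (rule ln_mult_pos) (use n wp False that in auto)
          ultimately have e: "ln (2 ^ card (insert x F) * (\<nu> A * y) / w) = ln (2 ^ card F * \<nu> A / w) + ln (2 * y)"
            by (simp only:)
          show ?thesis unfolding e by (simp only: distrib_left mult.assoc)
        qed simp
        have alg: "n * (1 - y) * L + n * ((1 - y) * L1) + (n * y * L + n * (y * L2)) = n * L + n * (y * L2 + (1 - y) * L1)"
          for n y L L1 L2 :: real by (simp add: algebra_simps)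
        have o: "\<nu> A * (1 - p A) * ln (2 ^ card (insert x F) * (\<nu> A * (1 - p A)) / w) =
            \<nu> A * (1 - p A) * ln (2 ^ card F * \<nu> A / w) + \<nu> A * ((1 - p A) * ln (2 * (1 - p A)))"
          by (rule one) (use p01[OF A] in simp)
        show ?thesis
          unfolding p\<nu>(1)[OF A, symmetric] p\<nu>(2)[OF A, symmetric] q_def one[OF p01(1)[OF A]] o by (rule alg)
      qed
    qed
    also have "\<dots> = deficit F \<nu> + (\<Sum>A\<in>Pow F. \<nu> A * q A)"
      by (simp add: deficit_def w_def sum.distrib)
    finally show ?thesis .
  qed
  have sqdF: "sqd (insert x F) A B = sqd F (A - {x}) (B - {x}) + (if (x \<in> A) \<noteq> (x \<in> B) then 4 else 0)" for A B
  proof -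
    have "sqd F A B = sqd F (A - {x}) (B - {x})"
      unfolding sqd_def by (rule sum.cong) (use insert in \<open>auto simp: sg_def\<close>)
    then show ?thesis using insert by (auto simp: sqd_def sg_def)
  qed
  have "(\<Sum>A\<in>Pow (insert x F). \<Sum>B\<in>Pow (insert x F). h A B * sqd (insert x F) A B) =
    (\<Sum>A\<in>Pow F. \<Sum>B\<in>Pow F. g A B * sqd F A B + 4 * g A B * \<bar>p A - 1/2\<bar>)"
    unfolding SP sum.distrib[symmetric]
  proof (intro sum.cong refl)
    fix A B assume A: "A \<in> Pow F" and B: "B \<in> Pow F"
    have "h A B * sqd (insert x F) A B + h A (insert x B) * sqd (insert x F) A (insert x B) +
       (h (insert x A) B * sqd (insert x F) (insert x A) B + h (insert x A) (insert x B) * sqd (insert x F) (insert x A) (insert x B))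
      = g A B * sqd F A B * ((bitcoup (p A) False False + bitcoup (p A) False True) + (bitcoup (p A) True False + bitcoup (p A) True True))
        + 4 * g A B * (bitcoup (p A) False True + bitcoup (p A) True False)"
      unfolding sqdF hF[OF A B] using rem[OF A] rem[OF B] by (simp add: algebra_simps)
    then show "h A B * sqd (insert x F) A B + h A (insert x B) * sqd (insert x F) A (insert x B) +
       (h (insert x A) B * sqd (insert x F) (insert x A) B + h (insert x A) (insert x B) * sqd (insert x F) (insert x A) (insert x B))
      = g A B * sqd F A B + 4 * g A B * \<bar>p A - 1/2\<bar>"
      using bitcoup(2)[OF p01[OF A], of True] bitcoup(2)[OF p01[OF A], of False] bitcoup(4)[OF p01[OF A]] by simp
  qed
  also have "\<dots> = (\<Sum>A\<in>Pow F. \<Sum>B\<in>Pow F. g A B * sqd F A B) + (\<Sum>A\<in>Pow F. 4 * \<nu> A * \<bar>p A - 1/2\<bar>)"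
    unfolding sum.distrib by (simp add: g1[symmetric] sum_distrib_left sum_distrib_right)
  \<comment> \<open>A disagreement costs 4, and its probability is at most the square root of the
    binary deficit; the root is linearised by
    \<open>4 * y \<le> 4 * y\<^sup>2 / \<tau> + \<tau>\<close>.\<close>
  also have "(\<Sum>A\<in>Pow F. 4 * \<nu> A * \<bar>p A - 1/2\<bar>) \<le> (\<Sum>A\<in>Pow F. 4 * (\<nu> A * q A) / \<tau> + \<nu> A * \<tau>)"
  proof (rule sum_mono)
    fix A assume A: "A \<in> Pow F"
    define y where "y = \<bar>p A - 1/2\<bar>"
    have "0 \<le> (2 * y - \<tau>)\<^sup>2" by simp
    then have "4 * \<tau> * y \<le> 4 * y\<^sup>2 + \<tau>\<^sup>2" by (simp add: power2_eq_square algebra_simps)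
    also have "y\<^sup>2 \<le> q A" unfolding y_def q_def using binary_deficit[OF p01[OF A]] by simp
    finally have "4 * \<tau> * y \<le> 4 * q A + \<tau>\<^sup>2" by simp
    then have "4 * y \<le> 4 * q A / \<tau> + \<tau>" using assms(2) by (simp add: field_simps power2_eq_square)
    then have "\<nu> A * (4 * y) \<le> \<nu> A * (4 * q A / \<tau> + \<tau>)" using \<nu>0[OF A] by (intro mult_left_mono)
    then show "4 * \<nu> A * \<bar>p A - 1/2\<bar> \<le> 4 * (\<nu> A * q A) / \<tau> + \<nu> A * \<tau>"
      by (simp add: y_def algebra_simps)
  qed
  also have "\<dots> = 4 * (\<Sum>A\<in>Pow F. \<nu> A * q A) / \<tau> + w * \<tau>"
    by (simp add: sum.distrib w_def sum_distrib_right sum_distrib_left sum_divide_distrib)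
  finally have "(\<Sum>A\<in>Pow (insert x F). \<Sum>B\<in>Pow (insert x F). h A B * sqd (insert x F) A B) \<le>
     4 * deficit F \<nu> / \<tau> + w * card F * \<tau> + (4 * (\<Sum>A\<in>Pow F. \<nu> A * q A) / \<tau> + w * \<tau>)"
    using g3 by linarith
  also have "\<dots> = 4 * deficit (insert x F) \<mu> / \<tau> + w * card (insert x F) * \<tau>"
    unfolding def_eq using insert.hyps by (simp add: distrib_left distrib_right add_divide_distrib)
  finally show ?case
    unfolding w using nonneg m1 m2 by (intro exI[of _ h] conjI ballI)
qed

section \<open>Anticoncentration of inner products\<close>

definition ip :: "'a set \<Rightarrow> ('a \<Rightarrow> real) \<Rightarrow> ('a \<Rightarrow> real) \<Rightarrow> real" where
  "ip J v w = (\<Sum>j\<in>J. v j * w j)"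

abbreviation sgv :: "'a set \<Rightarrow> 'a \<Rightarrow> real" where
  "sgv A \<equiv> (\<lambda>j. sg j A)"

definition orthon :: "'a set \<Rightarrow> nat \<Rightarrow> (nat \<Rightarrow> 'a \<Rightarrow> real) \<Rightarrow> bool" where
  "orthon J r v \<longleftrightarrow> (\<forall>i<r. \<forall>i'<r. ip J (v i) (v i') = of_bool (i = i'))"

definition proj :: "'a set \<Rightarrow> nat \<Rightarrow> (nat \<Rightarrow> 'a \<Rightarrow> real) \<Rightarrow> ('a \<Rightarrow> real) \<Rightarrow> 'a \<Rightarrow> real" where
  "proj J r v w = (\<lambda>j. \<Sum>i<r. ip J (v i) w * v i j)"

lemma ip_commute: "ip J v w = ip J w v"
  by (simp add: ip_def mult.commute)

lemma ip_diff: "ip J v (\<lambda>j. x j - y j) = ip J v x - ip J v y"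
  by (simp add: ip_def algebra_simps sum_subtractf)

lemma ip_diff_left: "ip J (\<lambda>j. x j - y j) v = ip J x v - ip J y v"
  by (simp add: ip_def algebra_simps sum_subtractf)

lemma ip_scale: "ip J v (\<lambda>j. c * x j) = c * ip J v x" "ip J (\<lambda>j. c * x j) v = c * ip J x v"
  by (simp_all add: ip_def sum_distrib_left algebra_simps)

lemma ip_lincomb: "ip J w (\<lambda>j. \<Sum>i<r. c i * v i j) = (\<Sum>i<r. c i * ip J w (v i))"
  unfolding ip_def sum_distrib_left by (subst sum.swap) (simp add: algebra_simps)

lemma ip_self_nonneg: "0 \<le> ip J w w"
  unfolding ip_def by (simp add: sum_nonneg)

lemma sqd_ip: "sqd J A B = ip J (\<lambda>j. sg j A - sg j B) (\<lambda>j. sg j A - sg j B)"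
  by (simp add: sqd_def ip_def power2_eq_square)

lemma ip_proj:
  assumes "orthon J r v" "i < r"
  shows "ip J (v i) (proj J r v w) = ip J (v i) w"
proof -
  have "ip J (v i) (proj J r v w) = (\<Sum>i'<r. ip J (v i') w * ip J (v i) (v i'))"
    unfolding proj_def by (rule ip_lincomb)
  also have "\<dots> = (\<Sum>i'<r. ip J (v i') w * of_bool (i = i'))"
    using assms by (intro sum.cong refl) (simp add: orthon_def)
  finally show ?thesis using assms by (simp add: of_bool_def if_distrib sum.delta cong: if_cong)
qed

lemma proj_resid:
  assumes "orthon J r v"
  shows "ip J (\<lambda>j. w j - proj J r v w j) (\<lambda>j. w j - proj J r v w j) = ip J w w - (\<Sum>i<r. (ip J (v i) w)\<^sup>2)"
proof -
  let ?e = "\<lambda>j. w j - proj J r v w j"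
  have "ip J ?e (proj J r v w) = (\<Sum>i<r. ip J (v i) w * ip J ?e (v i))"
    unfolding proj_def[of J r v w] by (rule ip_lincomb)
  also have "\<dots> = 0"
    using ip_proj[OF assms] by (intro sum.neutral) (simp add: ip_commute[of J _ "v _"] ip_diff)
  finally have z: "ip J ?e (proj J r v w) = 0" .
  have "ip J ?e ?e = ip J ?e w - ip J ?e (proj J r v w)" by (rule ip_diff)
  also have "\<dots> = ip J w w - ip J (proj J r v w) w" unfolding z by (simp add: ip_diff_left)
  also have "ip J (proj J r v w) w = (\<Sum>i<r. (ip J (v i) w)\<^sup>2)"
  proof -
    have "ip J w (proj J r v w) = (\<Sum>i<r. ip J (v i) w * ip J w (v i))"
      unfolding proj_def by (rule ip_lincomb)
    moreover have "ip J w (v i) = ip J (v i) w" for i by (rule ip_commute)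
    ultimately show ?thesis by (simp add: power2_eq_square ip_commute[of J "proj J r v w" w])
  qed
  finally show ?thesis .
qed

lemma bessel:
  assumes "orthon J r v"
  shows "(\<Sum>i<r. (ip J (v i) w)\<^sup>2) \<le> ip J w w"
  using proj_resid[OF assms, of w] ip_self_nonneg[of J "\<lambda>j. w j - proj J r v w j"] by linarith

lemma avg_ip_square:
  assumes "finite J"
  shows "avg (Pow J) (\<lambda>A. (ip J v (sgv A))\<^sup>2) = ip J v v"
  using avg_Pow_sg_square[OF assms, of v] by (simp add: ip_def power2_eq_square)

lemma sum_Pow_avg: "finite J \<Longrightarrow> (\<Sum>B\<in>Pow J. c / 2 ^ card J * f B) = c * avg (Pow J) f"
  by (simp add: avg_def card_Pow sum_distrib_left sum_divide_distrib)

text \<open>Couple \<mu> with a uniform sign vector. The uniform vector has second moment 1 in each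
  direction, in total \<open>r\<close>, and by Bessel's inequality the displacement contributes at
  most its squared length; squaring the sum of the two costs the factors 2.\<close>

lemma proj_moment:
  fixes \<tau> :: real
  assumes J: "finite J" and "0 < \<tau>" and \<mu>0: "\<And>A. A \<in> Pow J \<Longrightarrow> 0 \<le> \<mu> A" and \<mu>1: "(\<Sum>A\<in>Pow J. \<mu> A) = 1"
    and v: "orthon J r v"
  shows "(\<Sum>A\<in>Pow J. \<mu> A * (\<Sum>i<r. (ip J (v i) (sgv A))\<^sup>2)) \<le> 2 * real r + 2 * (4 * deficit J \<mu> / \<tau> + card J * \<tau>)"
proof -
  obtain g where g: "\<forall>A\<in>Pow J. \<forall>B\<in>Pow J. 0 \<le> g A B" "\<forall>A\<in>Pow J. (\<Sum>B\<in>Pow J. g A B) = \<mu> A"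
     "\<forall>B\<in>Pow J. (\<Sum>A\<in>Pow J. g A B) = (\<Sum>A\<in>Pow J. \<mu> A) / 2 ^ card J"
     "(\<Sum>A\<in>Pow J. \<Sum>B\<in>Pow J. g A B * sqd J A B) \<le> 4 * deficit J \<mu> / \<tau> + (\<Sum>A\<in>Pow J. \<mu> A) * card J * \<tau>"
    by (rule exE[OF transport[of J \<tau> \<mu>, OF J assms(2)]], erule \<mu>0, elim conjE, rule that)
  let ?f = "\<lambda>A. \<Sum>i<r. (ip J (v i) (sgv A))\<^sup>2"
  have pw: "?f A \<le> 2 * ?f B + 2 * sqd J A B" for A B
  proof -
    have "?f A \<le> (\<Sum>i<r. 2 * (ip J (v i) (sgv B))\<^sup>2 + 2 * (ip J (v i) (\<lambda>j. sg j A - sg j B))\<^sup>2)"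
    proof (rule sum_mono)
      fix i
      define a b where "a = ip J (v i) (sgv A)" and "b = ip J (v i) (sgv B)"
      have "a\<^sup>2 \<le> 2 * b\<^sup>2 + 2 * (a - b)\<^sup>2"
        using zero_le_power2[of "2 * b - a"] by (simp add: power2_eq_square algebra_simps)
      then show "(ip J (v i) (sgv A))\<^sup>2 \<le> 2 * (ip J (v i) (sgv B))\<^sup>2 + 2 * (ip J (v i) (\<lambda>j. sg j A - sg j B))\<^sup>2"
        by (simp add: ip_diff a_def b_def)
    qed
    also have "\<dots> = 2 * ?f B + 2 * (\<Sum>i<r. (ip J (v i) (\<lambda>j. sg j A - sg j B))\<^sup>2)"
      by (simp add: sum.distrib sum_distrib_left)
    finally show ?thesis using bessel[OF v, of "\<lambda>j. sg j A - sg j B"] by (simp add: sqd_ip)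
  qed
  have "(\<Sum>A\<in>Pow J. \<mu> A * ?f A) = (\<Sum>A\<in>Pow J. \<Sum>B\<in>Pow J. g A B * ?f A)"
    using g(2) by (simp add: sum_distrib_right[symmetric])
  also have "\<dots> \<le> (\<Sum>A\<in>Pow J. \<Sum>B\<in>Pow J. g A B * (2 * ?f B + 2 * sqd J A B))"
    using g(1) by (intro sum_mono mult_left_mono pw) auto
  also have "\<dots> = (\<Sum>A\<in>Pow J. \<Sum>B\<in>Pow J. g A B * (2 * ?f B)) + 2 * (\<Sum>A\<in>Pow J. \<Sum>B\<in>Pow J. g A B * sqd J A B)"
    by (simp add: distrib_left sum.distrib sum_distrib_left algebra_simps)
  also have "(\<Sum>A\<in>Pow J. \<Sum>B\<in>Pow J. g A B * (2 * ?f B)) = (\<Sum>B\<in>Pow J. (1 / 2 ^ card J) * (2 * ?f B))"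
    using g(3) \<mu>1 by (subst sum.swap) (simp add: sum_distrib_right[symmetric])
  also have "\<dots> = 2 * (\<Sum>i<r. avg (Pow J) (\<lambda>B. (ip J (v i) (sgv B))\<^sup>2))"
    unfolding sum_Pow_avg[OF J] by (simp add: avg_cmult avg_sum)
  also have "\<dots> = 2 * real r"
    using v by (simp add: avg_ip_square[OF J] orthon_def)
  finally show ?thesis using g(4) \<mu>1 by simp
qed

text \<open>Take families whose members all have second moment at least 4. With transport cost
  \<open>c\<close>, \<open>proj_moment\<close> gives \<open>4 * r \<le> 2 * r + 2 * c\<close>, so
  their size is bounded and a largest one exists. A direction orthogonal to it with second moment
  above 4 would extend it.\<close>

lemma large_second_moment_family:
  fixes \<tau> :: real
  assumes J: "finite J" and "0 < \<tau>" and \<nu>0: "\<And>B. B \<in> Pow J \<Longrightarrow> 0 \<le> \<nu> B" and \<nu>1: "(\<Sum>B\<in>Pow J. \<nu> B) = 1"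
  shows "\<exists>r v. orthon J r v \<and> real r \<le> 4 * deficit J \<nu> / \<tau> + card J * \<tau> \<and>
    (\<forall>w. (\<forall>i<r. ip J (v i) w = 0) \<longrightarrow> (\<Sum>B\<in>Pow J. \<nu> B * (ip J w (sgv B))\<^sup>2) \<le> 4 * ip J w w)"
proof -
  define c where "c = 4 * deficit J \<nu> / \<tau> + card J * \<tau>"
  define good where "good = (\<lambda>r v. orthon J r v \<and> (\<forall>i<r. 4 \<le> (\<Sum>B\<in>Pow J. \<nu> B * (ip J (v i) (sgv B))\<^sup>2)))"
  have bound: "real r \<le> c" if "good r v" for r v
  proof -
    have "4 * real r = (\<Sum>i<r. 4)" by simp
    also have "\<dots> \<le> (\<Sum>i<r. \<Sum>B\<in>Pow J. \<nu> B * (ip J (v i) (sgv B))\<^sup>2)"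
      using that by (intro sum_mono) (auto simp: good_def)
    also have "\<dots> = (\<Sum>B\<in>Pow J. \<nu> B * (\<Sum>i<r. (ip J (v i) (sgv B))\<^sup>2))"
      by (subst sum.swap) (simp add: sum_distrib_left)
    also have "\<dots> \<le> 2 * real r + 2 * c"
      unfolding c_def by (rule proj_moment) (use assms that in \<open>auto simp: good_def\<close>)
    finally show ?thesis by simp
  qed
  define r where "r = (GREATEST r. \<exists>v. good r v)"
  have g0: "\<exists>v. good 0 v" by (simp add: good_def orthon_def)
  have gb: "\<forall>r. (\<exists>v. good r v) \<longrightarrow> r \<le> nat \<lfloor>c\<rfloor>"
    using bound by (auto intro!: le_nat_floor)
  have r: "\<exists>v. good r v" "\<And>r'. \<exists>v. good r' v \<Longrightarrow> r' \<le> r"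
    unfolding r_def using GreatestI_nat[of "\<lambda>r. \<exists>v. good r v", OF g0 gb[rule_format]]
      Greatest_le_nat[of "\<lambda>r. \<exists>v. good r v", OF _ gb[rule_format]] by auto
  then obtain v where v: "good r v" by auto
  have "(\<Sum>B\<in>Pow J. \<nu> B * (ip J w (sgv B))\<^sup>2) \<le> 4 * ip J w w" if w: "\<forall>i<r. ip J (v i) w = 0" for w
  proof (rule ccontr)
    assume a: "\<not> ?thesis"
    define s where "s = ip J w w"
    \<comment> \<open>A vector of norm zero on \<open>J\<close> has only zero inner products and
      cannot violate the bound, so a violating vector can be normalised.\<close>
    have s: "s > 0"
    proof (rule ccontr)
      assume "\<not> 0 < s"
      then have "s = 0" using ip_self_nonneg[of J w] by (simp add: s_def)
      then have "w j = 0" if "j \<in> J" for j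
        using that J unfolding s_def ip_def by (simp add: sum_nonneg_eq_0_iff)
      then have "ip J w (sgv B) = 0" for B by (simp add: ip_def)
      then show False using a \<open>s = 0\<close> by (simp add: s_def)
    qed
    define u where "u = (\<lambda>j. (1 / sqrt s) * w j)"
    have "sqrt s * sqrt s = s" using s by simp
    then have uu: "ip J u u = 1" unfolding u_def ip_scale s_def[symmetric] using s
      by (simp add: divide_simps)
    have uv: "ip J (v i) u = 0" "ip J u (v i) = 0" if "i < r" for i
      unfolding u_def ip_scale ip_commute[of J w] using w that by simp_all
    have "good (Suc r) (v(r := u))"
    proof -
      have "orthon J (Suc r) (v(r := u))"
        unfolding orthon_def using v uu uv by (auto simp: good_def orthon_def less_Suc_eq)
      moreover have "4 \<le> (\<Sum>B\<in>Pow J. \<nu> B * (ip J u (sgv B))\<^sup>2)"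
      proof -
        have e: "(\<Sum>B\<in>Pow J. \<nu> B * (ip J u (sgv B))\<^sup>2) = (1 / s) * (\<Sum>B\<in>Pow J. \<nu> B * (ip J w (sgv B))\<^sup>2)"
          unfolding u_def ip_scale sum_distrib_left using s
          by (intro sum.cong refl) (simp add: power_mult_distrib power_divide)
        have "4 * s \<le> (\<Sum>B\<in>Pow J. \<nu> B * (ip J w (sgv B))\<^sup>2)" using a by (simp add: s_def)
        then show ?thesis unfolding e using s by (simp add: pos_le_divide_eq)
      qed
      ultimately show ?thesis using v by (auto simp: good_def less_Suc_eq)
    qed
    then show False using r(2)[of "Suc r"] by auto
  qed
  then show ?thesis using v bound[OF v] unfolding c_def[symmetric] good_def by blast
qed

section \<open>Product measures and randomised rounding\<close>

lemma prod_moment2: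
  assumes I: "finite I" and B: "\<And>i. i \<in> I \<Longrightarrow> finite (B i)"
    and one: "\<And>i. i \<in> I \<Longrightarrow> (\<Sum>y\<in>B i. \<rho> i y) = (1::real)"
    and zero: "\<And>i. i \<in> I \<Longrightarrow> (\<Sum>y\<in>B i. \<rho> i y * e i y) = 0"
  shows "(\<Sum>g\<in>PiE I B. (\<Prod>i\<in>I. \<rho> i (g i)) * (\<Sum>i\<in>I. b i * e i (g i))\<^sup>2) =
    (\<Sum>i\<in>I. (b i)\<^sup>2 * (\<Sum>y\<in>B i. \<rho> i y * (e i y)\<^sup>2))"
proof -
  \<comment> \<open>Under the product measure a mixed term factorises and contains the mean of
    \<open>e a\<close>, which is 0.\<close>
  have cross: "(\<Sum>g\<in>PiE I B. (\<Prod>i\<in>I. \<rho> i (g i)) * (e a (g a) * e c (g c))) =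
     (if a = c then (\<Sum>y\<in>B a. \<rho> a y * (e a y)\<^sup>2) else 0)" if ac: "a \<in> I" "c \<in> I" for a c
  proof -
    define f where "f = (\<lambda>i y. \<rho> i y * ((if i = a then e i y else 1) * (if i = c then e i y else 1)))"
    have "(\<Prod>i\<in>I. f i (g i)) = (\<Prod>i\<in>I. \<rho> i (g i)) * (e a (g a) * e c (g c))" for g
      unfolding f_def prod.distrib using I ac by simp
    then have "(\<Sum>g\<in>PiE I B. (\<Prod>i\<in>I. \<rho> i (g i)) * (e a (g a) * e c (g c))) = (\<Sum>g\<in>PiE I B. \<Prod>i\<in>I. f i (g i))"
      by simp
    also have "\<dots> = (\<Prod>i\<in>I. \<Sum>y\<in>B i. f i y)"
      using I B by (simp add: prod_sum_PiE)
    also have "\<dots> = (if a = c then (\<Sum>y\<in>B a. \<rho> a y * (e a y)\<^sup>2) else 0)"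
    proof (cases "a = c")
      case True
      have "(\<Prod>i\<in>I. \<Sum>y\<in>B i. f i y) = (\<Sum>y\<in>B a. f a y) * (\<Prod>i\<in>I - {a}. \<Sum>y\<in>B i. f i y)"
        using I ac by (simp add: prod.remove)
      also have "(\<Prod>i\<in>I - {a}. \<Sum>y\<in>B i. f i y) = 1"
        using True one by (intro prod.neutral) (auto simp: f_def)
      finally show ?thesis using True by (simp add: f_def power2_eq_square)
    next
      case False
      then have "(\<Sum>y\<in>B a. f a y) = 0" using zero[OF ac(1)] by (simp add: f_def)
      then show ?thesis using False I ac by (auto intro: prod_zero)
    qed
    finally show ?thesis .
  qed
  have "(\<Sum>g\<in>PiE I B. (\<Prod>i\<in>I. \<rho> i (g i)) * (\<Sum>i\<in>I. b i * e i (g i))\<^sup>2) =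
    (\<Sum>g\<in>PiE I B. \<Sum>a\<in>I. \<Sum>c\<in>I. b a * b c * ((\<Prod>i\<in>I. \<rho> i (g i)) * (e a (g a) * e c (g c))))"
  proof (rule sum.cong[OF refl])
    fix g
    show "(\<Prod>i\<in>I. \<rho> i (g i)) * (\<Sum>i\<in>I. b i * e i (g i))\<^sup>2 =
      (\<Sum>a\<in>I. \<Sum>c\<in>I. b a * b c * ((\<Prod>i\<in>I. \<rho> i (g i)) * (e a (g a) * e c (g c))))"
      unfolding power2_eq_square sum_product unfolding sum_distrib_left
      by (intro sum.cong refl) (simp add: algebra_simps)
  qed
  also have "\<dots> = (\<Sum>a\<in>I. \<Sum>c\<in>I. \<Sum>g\<in>PiE I B. b a * b c * ((\<Prod>i\<in>I. \<rho> i (g i)) * (e a (g a) * e c (g c))))"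
    by (subst sum.swap) (intro sum.cong refl sum.swap)
  also have "\<dots> = (\<Sum>a\<in>I. \<Sum>c\<in>I. b a * b c * (if a = c then (\<Sum>y\<in>B a. \<rho> a y * (e a y)\<^sup>2) else 0))"
    unfolding sum_distrib_left[symmetric] by (intro sum.cong refl) (simp add: cross)
  also have "\<dots> = (\<Sum>a\<in>I. (b a)\<^sup>2 * (\<Sum>y\<in>B a. \<rho> a y * (e a y)\<^sup>2))"
    using I by (intro sum.cong refl) (simp add: power2_eq_square if_distrib sum.delta cong: if_cong)
  finally show ?thesis .
qed

lemma prod_marginal:
  assumes I: "finite I" and B: "\<And>i. i \<in> I \<Longrightarrow> finite (B i)"
    and one: "\<And>i. i \<in> I \<Longrightarrow> (\<Sum>y\<in>B i. \<rho> i y) = (1::real)"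
  shows "(\<Sum>g\<in>PiE I B. (\<Prod>i\<in>I. \<rho> i (g i)) * (\<Sum>i\<in>I. \<phi> i (g i))) = (\<Sum>i\<in>I. \<Sum>y\<in>B i. \<rho> i y * \<phi> i y)"
proof -
  have "(\<Sum>g\<in>PiE I B. (\<Prod>i\<in>I. \<rho> i (g i)) * \<phi> a (g a)) = (\<Sum>y\<in>B a. \<rho> a y * \<phi> a y)" if a: "a \<in> I" for a
  proof -
    define f where "f = (\<lambda>i y. \<rho> i y * (if i = a then \<phi> i y else 1))"
    have "(\<Prod>i\<in>I. f i (g i)) = (\<Prod>i\<in>I. \<rho> i (g i)) * \<phi> a (g a)" for g
      unfolding f_def prod.distrib using I a by simp
    then have "(\<Sum>g\<in>PiE I B. (\<Prod>i\<in>I. \<rho> i (g i)) * \<phi> a (g a)) = (\<Sum>g\<in>PiE I B. \<Prod>i\<in>I. f i (g i))"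
      by simp
    also have "\<dots> = (\<Prod>i\<in>I. \<Sum>y\<in>B i. f i y)" using I B by (simp add: prod_sum_PiE)
    also have "\<dots> = (\<Sum>y\<in>B a. f a y) * (\<Prod>i\<in>I - {a}. \<Sum>y\<in>B i. f i y)"
      using I a by (simp add: prod.remove)
    also have "(\<Prod>i\<in>I - {a}. \<Sum>y\<in>B i. f i y) = 1"
      using one by (intro prod.neutral) (auto simp: f_def)
    finally show ?thesis by (simp add: f_def)
  qed
  then have "(\<Sum>i\<in>I. \<Sum>y\<in>B i. \<rho> i y * \<phi> i y) = (\<Sum>a\<in>I. \<Sum>g\<in>PiE I B. (\<Prod>i\<in>I. \<rho> i (g i)) * \<phi> a (g a))"
    by simp
  also have "\<dots> = (\<Sum>g\<in>PiE I B. (\<Prod>i\<in>I. \<rho> i (g i)) * (\<Sum>i\<in>I. \<phi> i (g i)))"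
    by (subst sum.swap) (simp add: sum_distrib_left)
  finally show ?thesis by simp
qed

text \<open>Probability that \<open>c\<close> is rounded to the integer \<open>z\<close>: up with
  probability \<open>frac c\<close>, otherwise down. The mean is then \<open>c\<close> and the
  variance at most 1/4.\<close>

definition rnd :: "real \<Rightarrow> int \<Rightarrow> real" where
  "rnd c z = (if z = \<lfloor>c\<rfloor> then 1 - frac c else if z = \<lfloor>c\<rfloor> + 1 then frac c else 0)"

lemma rnd_nonneg: "0 \<le> rnd c z" and rnd_le_1: "rnd c z \<le> 1"
  using frac_ge_0[of c] frac_lt_1[of c] by (auto simp: rnd_def)

lemma rnd_sum:
  assumes "\<bar>c\<bar> \<le> real L"
  shows "(\<Sum>z\<in>{- int L - 1..int L + 1}. rnd c z * f z) = (1 - frac c) * f \<lfloor>c\<rfloor> + frac c * f (\<lfloor>c\<rfloor> + 1)"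
proof -
  have "{\<lfloor>c\<rfloor>, \<lfloor>c\<rfloor> + 1} \<subseteq> {- int L - 1..int L + 1}"
  proof -
    have "\<lfloor>c\<rfloor> \<le> int L" "- int L \<le> \<lfloor>c\<rfloor>"
      using assms by (auto simp: floor_le_iff le_floor_iff abs_le_iff)
    then show ?thesis by auto
  qed
  then have "(\<Sum>z\<in>{- int L - 1..int L + 1}. rnd c z * f z) = (\<Sum>z\<in>{\<lfloor>c\<rfloor>, \<lfloor>c\<rfloor> + 1}. rnd c z * f z)"
    by (intro sum.mono_neutral_right) (auto simp: rnd_def)
  then show ?thesis by (simp add: rnd_def)
qed

lemma rnd_moments:
  assumes "\<bar>c\<bar> \<le> real L"
  shows "(\<Sum>z\<in>{- int L - 1..int L + 1}. rnd c z) = 1"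
    "(\<Sum>z\<in>{- int L - 1..int L + 1}. rnd c z * (of_int z - c)) = 0"
    "(\<Sum>z\<in>{- int L - 1..int L + 1}. rnd c z * (of_int z - c)\<^sup>2) \<le> 1 / 4"
    "(\<Sum>z\<in>{- int L - 1..int L + 1}. rnd c z * (of_int z)\<^sup>2) \<le> c\<^sup>2 + 1 / 4"
proof -
  define f where "f = frac c"
  define a where "a = real_of_int \<lfloor>c\<rfloor>"
  have c: "c = a + f" by (simp add: f_def a_def frac_def)
  show "(\<Sum>z\<in>{- int L - 1..int L + 1}. rnd c z) = 1"
    using rnd_sum[OF assms, of "\<lambda>_. 1"] by simp
  show "(\<Sum>z\<in>{- int L - 1..int L + 1}. rnd c z * (of_int z - c)) = 0"
    unfolding rnd_sum[OF assms] by (simp add: a_def[symmetric] f_def[symmetric]) (simp add: c algebra_simps)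
  have sq: "f - f\<^sup>2 \<le> 1 / 4" using zero_le_power2[of "f - 1/2"] by (simp add: power2_eq_square algebra_simps)
  show "(\<Sum>z\<in>{- int L - 1..int L + 1}. rnd c z * (of_int z - c)\<^sup>2) \<le> 1 / 4"
    unfolding rnd_sum[OF assms] using sq
    by (simp add: a_def[symmetric] f_def[symmetric]) (simp add: c power2_eq_square algebra_simps)
  show "(\<Sum>z\<in>{- int L - 1..int L + 1}. rnd c z * (of_int z)\<^sup>2) \<le> c\<^sup>2 + 1 / 4"
    unfolding rnd_sum[OF assms] using sq
    by (simp add: a_def[symmetric] f_def[symmetric]) (simp add: c power2_eq_square algebra_simps)
qed

text \<open>Normalisation of the two-sided geometric weights that serve as reference law for the
  rounded coordinates.\<close>

lemma sum_half_powers: "(\<Sum>z\<in>{- int L..int L}. (1 / 2) ^ nat \<bar>z\<bar>) = 3 - 2 * (1 / 2 :: real) ^ L"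
proof (induction L)
  case (Suc L)
  have "{- int (Suc L)..int (Suc L)} = insert (- int (Suc L)) (insert (int (Suc L)) {- int L..int L})"
    by auto
  then show ?case using Suc by (simp add: nat_add_distrib)
qed simp

lemma sgv_norm: "ip J (sgv A) (sgv A) = card J"
proof -
  have "sg j A * sg j A = 1" for j by (simp add: sg_def)
  then show ?thesis by (simp add: ip_def)
qed

text \<open>Unbiased randomised rounding of the coordinates of \<open>sgv A\<close> along \<open>v\<close> to integers: the rounded
  value has small entropy, hence conditioning on it hardly changes the deficit, while the
  rounding error is uncorrelated with every fixed direction.\<close>

lemma rounding:
  fixes \<mu> :: "'a set \<Rightarrow> real"
  assumes J: "finite J" and \<mu>0: "\<And>A. A \<in> Pow J \<Longrightarrow> 0 \<le> \<mu> A" and \<mu>1: "(\<Sum>A\<in>Pow J. \<mu> A) = 1"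
    and v: "orthon J r v"
  shows "\<exists>(K :: (nat \<Rightarrow> int) set) \<rho>. finite K \<and> (\<forall>\<kappa>\<in>K. \<forall>A\<in>Pow J. 0 \<le> \<rho> \<kappa> A) \<and>
    (\<forall>A\<in>Pow J. (\<Sum>\<kappa>\<in>K. \<rho> \<kappa> A) = 1) \<and>
    (\<forall>A\<in>Pow J. \<forall>b. (\<Sum>\<kappa>\<in>K. \<rho> \<kappa> A * (\<Sum>i<r. b i * (of_int (\<kappa> i) - ip J (v i) (sgv A)))\<^sup>2) \<le> (\<Sum>i<r. (b i)\<^sup>2) / 4) \<and>
    (\<Sum>\<kappa>\<in>K. deficit J (\<lambda>A. \<mu> A * \<rho> \<kappa> A)) \<le>
      deficit J \<mu> + 3 * real r + (\<Sum>A\<in>Pow J. \<mu> A * (\<Sum>i<r. (ip J (v i) (sgv A))\<^sup>2))"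
proof -
  \<comment> \<open>A coordinate along a unit vector is bounded by the root of
    \<open>card J\<close>; the cruder integer bound \<open>card J\<close> is enough to keep the
    rounded values in a finite range.\<close>
  define L where "L = card J"
  define Z where "Z = {- int L - 1..int L + 1}"
  define K where "K = PiE {..<r} (\<lambda>_. Z)"
  define c where "c A i = ip J (v i) (sgv A)" for A i
  define \<rho> where "\<rho> \<kappa> A = (\<Prod>i<r. rnd (c A i) (\<kappa> i))" for \<kappa> A
  have fin: "finite K" unfolding K_def Z_def by (intro finite_PiE) auto
  have \<rho>0: "0 \<le> \<rho> \<kappa> A" "\<rho> \<kappa> A \<le> 1" for \<kappa> A
    unfolding \<rho>_def by (auto intro!: prod_nonneg prod_le_1 rnd_nonneg rnd_le_1)
  have cL: "\<bar>c A i\<bar> \<le> real L" if "i < r" for A i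
  proof -
    have "(c A i)\<^sup>2 \<le> (\<Sum>i<r. (c A i)\<^sup>2)" using that by (intro member_le_sum) auto
    also have "\<dots> \<le> real L" using bessel[OF v, of "sgv A"] sgv_norm[of J A] by (simp add: c_def L_def)
    also have "real L \<le> (real L)\<^sup>2"
      unfolding power2_eq_square of_nat_mult[symmetric] of_nat_le_iff by (rule le_square)
    finally show ?thesis by (metis abs_le_square_iff abs_of_nat)
  qed
  have mom: "(\<Sum>z\<in>Z. rnd (c A i) z) = 1" "(\<Sum>z\<in>Z. rnd (c A i) z * (of_int z - c A i)) = 0"
    "(\<Sum>z\<in>Z. rnd (c A i) z * (of_int z - c A i)\<^sup>2) \<le> 1 / 4" "(\<Sum>z\<in>Z. rnd (c A i) z * (of_int z)\<^sup>2) \<le> (c A i)\<^sup>2 + 1 / 4"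
    if "i < r" for A i
    unfolding Z_def using rnd_moments[OF cL[OF that]] by auto
  have \<rho>1: "(\<Sum>\<kappa>\<in>K. \<rho> \<kappa> A) = 1" for A
  proof -
    have "(\<Sum>\<kappa>\<in>K. \<rho> \<kappa> A) = (\<Prod>i<r. \<Sum>z\<in>Z. rnd (c A i) z)"
      unfolding K_def \<rho>_def by (subst prod_sum_PiE) (auto simp: Z_def)
    also have "\<dots> = 1" using mom(1) by (intro prod.neutral) auto
    finally show ?thesis .
  qed
  have var: "(\<Sum>\<kappa>\<in>K. \<rho> \<kappa> A * (\<Sum>i<r. b i * (of_int (\<kappa> i) - c A i))\<^sup>2) \<le> (\<Sum>i<r. (b i)\<^sup>2) / 4" for A b
  proof -
    have "(\<Sum>\<kappa>\<in>K. \<rho> \<kappa> A * (\<Sum>i<r. b i * (of_int (\<kappa> i) - c A i))\<^sup>2) =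
       (\<Sum>i<r. (b i)\<^sup>2 * (\<Sum>z\<in>Z. rnd (c A i) z * (of_int z - c A i)\<^sup>2))"
      unfolding K_def \<rho>_def
      by (rule prod_moment2[where e = "\<lambda>i z. of_int z - c A i" and \<rho> = "\<lambda>i. rnd (c A i)" and B = "\<lambda>_. Z"])
         (use mom in \<open>auto simp: Z_def\<close>)
    also have "\<dots> \<le> (\<Sum>i<r. (b i)\<^sup>2 * (1 / 4))"
      using mom(3) by (intro sum_mono mult_left_mono) auto
    finally show ?thesis by (simp add: sum_divide_distrib)
  qed
  \<comment> \<open>A product of two-sided geometric weights, subnormalised by the factors 1/3. By
    Gibbs' inequality the entropy of the rounded vector is at most its mean of
    \<open>- ln (q \<kappa>)\<close>, which is linear in the absolute values and hence bounded
    through their squares.\<close>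
  define q where "q \<kappa> = (\<Prod>i<r. (1 / 2 :: real) ^ nat \<bar>\<kappa> i\<bar> / 3)" for \<kappa> :: "nat \<Rightarrow> int"
  have q0: "0 < q \<kappa>" for \<kappa> unfolding q_def by (intro prod_pos) auto
  have q1: "(\<Sum>\<kappa>\<in>K. q \<kappa>) \<le> 1"
  proof -
    have "(\<Sum>\<kappa>\<in>K. q \<kappa>) = (\<Prod>i<r. \<Sum>z\<in>Z. (1 / 2 :: real) ^ nat \<bar>z\<bar> / 3)"
      unfolding K_def q_def by (subst prod_sum_PiE) (auto simp: Z_def)
    also have "\<dots> \<le> 1"
    proof (intro prod_le_1 conjI)
      have "(\<Sum>z\<in>Z. (1 / 2 :: real) ^ nat \<bar>z\<bar>) \<le> 3"
      proof -
        have "Z = {- int (Suc L)..int (Suc L)}" by (auto simp: Z_def)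
        then show ?thesis by (simp only: sum_half_powers) simp
      qed
      then show "(\<Sum>z\<in>Z. (1 / 2 :: real) ^ nat \<bar>z\<bar> / 3) \<le> 1"
        by (simp add: sum_divide_distrib[symmetric])
    qed (auto intro: sum_nonneg)
    finally show ?thesis .
  qed
  have lnq: "- ln (q \<kappa>) \<le> (\<Sum>i<r. 2 + (of_int (\<kappa> i))\<^sup>2)" for \<kappa>
  proof -
    have "- ln (q \<kappa>) = (\<Sum>i<r. - ln ((1 / 2 :: real) ^ nat \<bar>\<kappa> i\<bar> / 3))"
      unfolding q_def by (subst ln_prod) (auto simp: sum_negf)
    also have "\<dots> \<le> (\<Sum>i<r. 2 + (of_int (\<kappa> i))\<^sup>2)"
    proof (rule sum_mono)
      fix i
      have "- ln ((1 / 2 :: real) ^ nat \<bar>\<kappa> i\<bar> / 3) = ln 3 + real (nat \<bar>\<kappa> i\<bar>) * ln 2"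
        by (simp add: ln_div ln_realpow)
      also have "\<dots> \<le> 2 + real (nat \<bar>\<kappa> i\<bar>) * 1"
        using ln_le_minus_one[of "3::real"] ln_le_minus_one[of "2::real"]
        by (intro add_mono mult_left_mono) auto
      also have "real (nat \<bar>\<kappa> i\<bar>) \<le> (of_int (\<kappa> i))\<^sup>2"
      proof -
        have "x * 1 \<le> x * x" if "0 \<le> x" for x :: int
          using that by (cases "x = 0") (auto simp del: mult_1_right intro!: mult_left_mono)
        from this[of "\<bar>\<kappa> i\<bar>"] have "real_of_int \<bar>\<kappa> i\<bar> \<le> of_int (\<bar>\<kappa> i\<bar> * \<bar>\<kappa> i\<bar>)" by linarith
        then show ?thesis by (simp add: power2_eq_square)
      qed
      finally show "- ln ((1 / 2 :: real) ^ nat \<bar>\<kappa> i\<bar> / 3) \<le> 2 + (of_int (\<kappa> i))\<^sup>2" by simp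
    qed
    finally show ?thesis .
  qed
  define m where "m \<kappa> = (\<Sum>A\<in>Pow J. \<mu> A * \<rho> \<kappa> A)" for \<kappa>
  have m0: "0 \<le> m \<kappa>" for \<kappa> unfolding m_def using \<mu>0 \<rho>0 by (intro sum_nonneg mult_nonneg_nonneg) auto
  have swap: "(\<Sum>\<kappa>\<in>K. m \<kappa> * f \<kappa>) = (\<Sum>A\<in>Pow J. \<mu> A * (\<Sum>\<kappa>\<in>K. \<rho> \<kappa> A * f \<kappa>))" for f
    unfolding m_def sum_distrib_right sum_distrib_left by (subst sum.swap) (simp add: algebra_simps)
  have m1: "(\<Sum>\<kappa>\<in>K. m \<kappa>) = 1" using swap[of "\<lambda>_. 1"] \<rho>1 \<mu>1 by simp
  have gibbs: "(\<Sum>\<kappa>\<in>K. - m \<kappa> * ln (m \<kappa>)) \<le> (\<Sum>\<kappa>\<in>K. m \<kappa> * - ln (q \<kappa>))"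
  proof -
    have "(\<Sum>\<kappa>\<in>K. m \<kappa> * ln (q \<kappa> / 1) + (m \<kappa> - q \<kappa>)) \<le> (\<Sum>\<kappa>\<in>K. m \<kappa> * ln (m \<kappa> / 1))"
      by (intro sum_mono gibbs_pointwise m0 less_imp_le[OF q0] q0) auto
    then show ?thesis using q1 m1 by (simp add: sum.distrib sum_subtractf sum_negf)
  qed
  \<comment> \<open>Splitting \<mu> into the pieces \<open>\<mu> A * \<rho> \<kappa> A\<close>
    raises the total deficit by at most the entropy of the masses \<open>m \<kappa>\<close>: inside
    the logarithm \<open>\<rho> \<kappa> A\<close> is replaced by 1.\<close>
  have "(\<Sum>\<kappa>\<in>K. deficit J (\<lambda>A. \<mu> A * \<rho> \<kappa> A)) \<le> (\<Sum>\<kappa>\<in>K. \<Sum>A\<in>Pow J. \<mu> A * \<rho> \<kappa> A * (ln (2 ^ card J * \<mu> A) - ln (m \<kappa>)))"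
    unfolding deficit_def m_def[symmetric]
  proof (intro sum_mono)
    fix \<kappa> A assume A: "A \<in> Pow J"
    show "\<mu> A * \<rho> \<kappa> A * ln (2 ^ card J * (\<mu> A * \<rho> \<kappa> A) / m \<kappa>) \<le> \<mu> A * \<rho> \<kappa> A * (ln (2 ^ card J * \<mu> A) - ln (m \<kappa>))"
    proof (cases "\<mu> A * \<rho> \<kappa> A = 0")
      case False
      then have p: "\<mu> A > 0" "\<rho> \<kappa> A > 0" using \<mu>0[OF A] \<rho>0(1)[of \<kappa> A] by auto
      have "\<mu> A * \<rho> \<kappa> A \<le> m \<kappa>" unfolding m_def using A J \<mu>0 \<rho>0
        by (intro member_le_sum[where f = "\<lambda>A. \<mu> A * \<rho> \<kappa> A"]) auto
      then have mp: "m \<kappa> > 0" using p mult_pos_pos[OF p] by linarith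
      have "ln (2 ^ card J * (\<mu> A * \<rho> \<kappa> A) / m \<kappa>) = ln (2 ^ card J * \<mu> A * \<rho> \<kappa> A) - ln (m \<kappa>)"
        using p mp by (simp add: ln_div mult.assoc)
      also have "ln (2 ^ card J * \<mu> A * \<rho> \<kappa> A) \<le> ln (2 ^ card J * \<mu> A)"
        using p \<rho>0(2)[of \<kappa> A] by (subst ln_le_cancel_iff) (auto intro: mult_left_le)
      finally show ?thesis using p by (intro mult_left_mono) auto
    qed (simp only: mult_zero_left order_refl)
  qed
  also have "\<dots> = (\<Sum>\<kappa>\<in>K. \<Sum>A\<in>Pow J. \<mu> A * ln (2 ^ card J * \<mu> A) * \<rho> \<kappa> A) - (\<Sum>\<kappa>\<in>K. \<Sum>A\<in>Pow J. \<mu> A * \<rho> \<kappa> A * ln (m \<kappa>))"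
    unfolding sum_subtractf[symmetric] by (intro sum.cong refl) (simp only: right_diff_distrib mult_ac)
  also have "(\<Sum>\<kappa>\<in>K. \<Sum>A\<in>Pow J. \<mu> A * ln (2 ^ card J * \<mu> A) * \<rho> \<kappa> A) = deficit J \<mu>"
    unfolding deficit_def \<mu>1 by (subst sum.swap) (simp add: sum_distrib_left[symmetric] \<rho>1)
  also have "(\<Sum>\<kappa>\<in>K. \<Sum>A\<in>Pow J. \<mu> A * \<rho> \<kappa> A * ln (m \<kappa>)) = - (\<Sum>\<kappa>\<in>K. - m \<kappa> * ln (m \<kappa>))"
    by (simp add: sum_distrib_right[symmetric] m_def[symmetric] sum_negf)
  finally have "(\<Sum>\<kappa>\<in>K. deficit J (\<lambda>A. \<mu> A * \<rho> \<kappa> A)) \<le> deficit J \<mu> + (\<Sum>\<kappa>\<in>K. m \<kappa> * - ln (q \<kappa>))"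
    using gibbs by linarith
  also have "(\<Sum>\<kappa>\<in>K. m \<kappa> * - ln (q \<kappa>)) \<le> (\<Sum>\<kappa>\<in>K. m \<kappa> * (\<Sum>i<r. 2 + (of_int (\<kappa> i))\<^sup>2))"
    using m0 lnq by (intro sum_mono mult_left_mono) auto
  also have "\<dots> = (\<Sum>A\<in>Pow J. \<mu> A * (\<Sum>\<kappa>\<in>K. \<rho> \<kappa> A * (\<Sum>i<r. 2 + (of_int (\<kappa> i))\<^sup>2)))"
    by (rule swap)
  also have "\<dots> \<le> (\<Sum>A\<in>Pow J. \<mu> A * (\<Sum>i<r. 3 + (c A i)\<^sup>2))"
  proof (intro sum_mono mult_left_mono \<mu>0)
    fix A
    have "(\<Sum>\<kappa>\<in>K. \<rho> \<kappa> A * (\<Sum>i<r. 2 + (of_int (\<kappa> i))\<^sup>2)) = (\<Sum>i<r. \<Sum>z\<in>Z. rnd (c A i) z * (2 + (of_int z)\<^sup>2))"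
      unfolding K_def \<rho>_def
      by (rule prod_marginal[where \<rho> = "\<lambda>i. rnd (c A i)" and \<phi> = "\<lambda>i z. 2 + (of_int z)\<^sup>2" and B = "\<lambda>_. Z"])
        (use mom in \<open>auto simp: Z_def\<close>)
    also have "\<dots> \<le> (\<Sum>i<r. 3 + (c A i)\<^sup>2)"
    proof (rule sum_mono)
      fix i assume "i \<in> {..<r}"
      then have i: "i < r" by simp
      have "(\<Sum>z\<in>Z. rnd (c A i) z * (2 + (of_int z)\<^sup>2)) = (\<Sum>z\<in>Z. rnd (c A i) z) * 2 + (\<Sum>z\<in>Z. rnd (c A i) z * (of_int z)\<^sup>2)"
        by (simp add: distrib_left sum.distrib sum_distrib_right)
      then show "(\<Sum>z\<in>Z. rnd (c A i) z * (2 + (of_int z)\<^sup>2)) \<le> 3 + (c A i)\<^sup>2"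
        using mom(1)[OF i, of A] mom(4)[OF i, of A] by simp
    qed
    finally show "(\<Sum>\<kappa>\<in>K. \<rho> \<kappa> A * (\<Sum>i<r. 2 + (of_int (\<kappa> i))\<^sup>2)) \<le> (\<Sum>i<r. 3 + (c A i)\<^sup>2)" .
  qed
  also have "\<dots> = 3 * real r + (\<Sum>A\<in>Pow J. \<mu> A * (\<Sum>i<r. (c A i)\<^sup>2))"
    using \<mu>1 by (simp add: sum.distrib distrib_left sum_distrib_right[symmetric] sum_distrib_left[symmetric])
  finally have fd: "(\<Sum>\<kappa>\<in>K. deficit J (\<lambda>A. \<mu> A * \<rho> \<kappa> A)) \<le> deficit J \<mu> + 3 * real r + (\<Sum>A\<in>Pow J. \<mu> A * (\<Sum>i<r. (c A i)\<^sup>2))"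
    by simp
  show ?thesis
    by (rule exI[of _ K], rule exI[of _ \<rho>]) (use fin \<rho>0 \<rho>1 var fd in \<open>auto simp: c_def\<close>)
qed

text \<open>Two transport scales are balanced. Deficits of order \<open>\<sigma> ^ 4\<close> per
  coordinate allow the parameter \<open>\<sigma>\<^sup>2\<close> for the family of directions;
  rounding then leaves pieces of total deficit of order \<open>\<sigma>\<^sup>2\<close> per
  coordinate, which are coupled with parameter \<sigma>. The tail is assumed for every shift
  \<open>s\<close>, since the shift produced by the rounded coordinates is arbitrary, though
  independent of the uniform vector once \<kappa> is fixed; \<open>h\<close> is the room left for
  the error.\<close>

lemma anticoncentration:
  fixes \<mu> \<nu> :: "'a set \<Rightarrow> real" and \<sigma> h t \<beta> :: real
  assumes J: "finite J"
    and \<mu>0: "\<And>A. A \<in> Pow J \<Longrightarrow> 0 \<le> \<mu> A" and \<mu>1: "(\<Sum>A\<in>Pow J. \<mu> A) = 1"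
    and \<nu>0: "\<And>B. B \<in> Pow J \<Longrightarrow> 0 \<le> \<nu> B" and \<nu>1: "(\<Sum>B\<in>Pow J. \<nu> B) = 1"
    and \<sigma>: "0 < \<sigma>" "\<sigma> \<le> 1" and h: "0 < h"
    and d: "deficit J \<mu> \<le> \<sigma> ^ 4 * card J" "deficit J \<nu> \<le> \<sigma> ^ 4 * card J"
    and tail: "\<And>B s. B \<in> Pow J \<Longrightarrow> \<beta> \<le> avg (Pow J) (\<lambda>A. of_bool (t + h \<le> \<bar>s + ip J (sgv A) (sgv B)\<bar>))"
  shows "\<beta> - 2000 * \<sigma> * card J / h\<^sup>2 \<le>
    (\<Sum>A\<in>Pow J. \<Sum>B\<in>Pow J. \<mu> A * \<nu> B * of_bool (t \<le> \<bar>ip J (sgv A) (sgv B)\<bar>))"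
proof -
  define N where "N = real (card J)"
  have N0: "0 \<le> N" by (simp add: N_def)
  have "\<sigma>\<^sup>2 \<le> \<sigma>" using \<sigma> by (simp add: power2_eq_square)
  then have \<sigma>2: "0 < \<sigma>\<^sup>2" "\<sigma>\<^sup>2 * N \<le> \<sigma> * N"
    using \<sigma> N0 by (auto intro!: mult_right_mono)
  have cost: "4 * x / \<sigma>\<^sup>2 + card J * \<sigma>\<^sup>2 \<le> 5 * \<sigma>\<^sup>2 * N" if "x \<le> \<sigma> ^ 4 * card J" for x
  proof -
    have "4 * x / \<sigma>\<^sup>2 \<le> 4 * (\<sigma> ^ 4 * N) / \<sigma>\<^sup>2" using that \<sigma>2 by (intro divide_right_mono mult_left_mono) (auto simp: N_def)
    also have "\<dots> = 4 * \<sigma>\<^sup>2 * N" using \<sigma> by (simp add: power2_eq_square power4_eq_xxxx)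
    finally show ?thesis by (simp add: N_def algebra_simps)
  qed
  obtain r v where v: "orthon J r v" and r: "real r \<le> 4 * deficit J \<nu> / \<sigma>\<^sup>2 + card J * \<sigma>\<^sup>2"
    and sm: "\<And>w. \<forall>i<r. ip J (v i) w = 0 \<Longrightarrow> (\<Sum>B\<in>Pow J. \<nu> B * (ip J w (sgv B))\<^sup>2) \<le> 4 * ip J w w"
    using large_second_moment_family[of J "\<sigma>\<^sup>2" \<nu>] J \<sigma>2 \<nu>0 \<nu>1 by auto
  have r5: "real r \<le> 5 * \<sigma>\<^sup>2 * N" using r cost[OF d(2)] by simp
  have pm: "(\<Sum>A\<in>Pow J. \<mu> A * (\<Sum>i<r. (ip J (v i) (sgv A))\<^sup>2)) \<le> 20 * \<sigma>\<^sup>2 * N"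
    using proj_moment[of J "\<sigma>\<^sup>2" \<mu> r v] J \<sigma>2 \<mu>0 \<mu>1 v cost[OF d(1)] r5 by simp
  have pn: "(\<Sum>B\<in>Pow J. \<nu> B * (\<Sum>i<r. (ip J (v i) (sgv B))\<^sup>2)) \<le> 20 * \<sigma>\<^sup>2 * N"
    using proj_moment[of J "\<sigma>\<^sup>2" \<nu> r v] J \<sigma>2 \<nu>0 \<nu>1 v cost[OF d(2)] r5 by simp
  obtain K :: "(nat \<Rightarrow> int) set" and \<rho> where K: "finite K"
    and R: "\<forall>\<kappa>\<in>K. \<forall>A\<in>Pow J. 0 \<le> \<rho> \<kappa> A" "\<forall>A\<in>Pow J. (\<Sum>\<kappa>\<in>K. \<rho> \<kappa> A) = 1"
      "\<forall>A\<in>Pow J. \<forall>b. (\<Sum>\<kappa>\<in>K. \<rho> \<kappa> A * (\<Sum>i<r. b i * (of_int (\<kappa> i) - ip J (v i) (sgv A)))\<^sup>2) \<le> (\<Sum>i<r. (b i)\<^sup>2) / 4"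
    and \<rho>d: "(\<Sum>\<kappa>\<in>K. deficit J (\<lambda>A. \<mu> A * \<rho> \<kappa> A)) \<le> deficit J \<mu> + 3 * real r + (\<Sum>A\<in>Pow J. \<mu> A * (\<Sum>i<r. (ip J (v i) (sgv A))\<^sup>2))"
    by (rule exE[OF rounding[of J \<mu> r v, OF J _ \<mu>1 v]], erule \<mu>0, elim exE conjE, rule that)
  note \<rho>0 = R(1)[rule_format] and \<rho>1 = R(2)[rule_format] and \<rho>var = R(3)[rule_format]
  have "\<sigma> ^ 4 \<le> \<sigma>\<^sup>2" using \<sigma> by (intro power_decreasing) auto
  then have "\<sigma> ^ 4 * N \<le> \<sigma>\<^sup>2 * N" using N0 by (rule mult_right_mono)
  then have \<rho>d': "(\<Sum>\<kappa>\<in>K. deficit J (\<lambda>A. \<mu> A * \<rho> \<kappa> A)) \<le> 36 * \<sigma>\<^sup>2 * N"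
    using \<rho>d d(1) r5 pm by (simp add: N_def)
  define m where "m \<kappa> = (\<Sum>A\<in>Pow J. \<mu> A * \<rho> \<kappa> A)" for \<kappa>
  have m1: "(\<Sum>\<kappa>\<in>K. m \<kappa>) = 1"
    unfolding m_def using \<mu>1 by (subst sum.swap) (simp add: sum_distrib_left[symmetric] \<rho>1)
  have "\<forall>\<kappa>\<in>K. \<exists>g. (\<forall>A\<in>Pow J. \<forall>C\<in>Pow J. 0 \<le> g A C) \<and>
     (\<forall>A\<in>Pow J. (\<Sum>C\<in>Pow J. g A C) = \<mu> A * \<rho> \<kappa> A) \<and>
     (\<forall>C\<in>Pow J. (\<Sum>A\<in>Pow J. g A C) = m \<kappa> / 2 ^ card J) \<and>
     (\<Sum>A\<in>Pow J. \<Sum>C\<in>Pow J. g A C * sqd J A C) \<le> 4 * deficit J (\<lambda>A. \<mu> A * \<rho> \<kappa> A) / \<sigma> + m \<kappa> * card J * \<sigma>"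
    unfolding m_def by (intro ballI transport) (use J \<sigma> \<mu>0 \<rho>0 in auto)
  from bchoice[OF this] obtain g where
    G: "\<forall>\<kappa>\<in>K. (\<forall>A\<in>Pow J. \<forall>C\<in>Pow J. 0 \<le> g \<kappa> A C) \<and>
     (\<forall>A\<in>Pow J. (\<Sum>C\<in>Pow J. g \<kappa> A C) = \<mu> A * \<rho> \<kappa> A) \<and>
     (\<forall>C\<in>Pow J. (\<Sum>A\<in>Pow J. g \<kappa> A C) = m \<kappa> / 2 ^ card J) \<and>
     (\<Sum>A\<in>Pow J. \<Sum>C\<in>Pow J. g \<kappa> A C * sqd J A C) \<le> 4 * deficit J (\<lambda>A. \<mu> A * \<rho> \<kappa> A) / \<sigma> + m \<kappa> * card J * \<sigma>"
    by (elim exE)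
  have g0: "0 \<le> g \<kappa> A C" if "\<kappa> \<in> K" "A \<in> Pow J" "C \<in> Pow J" for \<kappa> A C
    using bspec[OF G that(1)] that by blast
  have gA: "(\<Sum>C\<in>Pow J. g \<kappa> A C) = \<mu> A * \<rho> \<kappa> A" if "\<kappa> \<in> K" "A \<in> Pow J" for \<kappa> A
    using bspec[OF G that(1)] that by blast
  have gC: "(\<Sum>A\<in>Pow J. g \<kappa> A C) = m \<kappa> / 2 ^ card J" if "\<kappa> \<in> K" "C \<in> Pow J" for \<kappa> C
    using bspec[OF G that(1)] that by blast
  have gcost: "(\<Sum>A\<in>Pow J. \<Sum>C\<in>Pow J. g \<kappa> A C * sqd J A C) \<le> 4 * deficit J (\<lambda>A. \<mu> A * \<rho> \<kappa> A) / \<sigma> + m \<kappa> * card J * \<sigma>"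
    if "\<kappa> \<in> K" for \<kappa>
    using bspec[OF G that(1)] by blast
  \<comment> \<open>Expectation over the rounded value \<kappa>, the pair \<open>A\<close>,
    \<open>C\<close> coupled for it, and an independent \<open>B\<close>. Summing out
    \<open>C\<close> recovers \<mu> and \<rho>; summing out \<open>A\<close> leaves \<open>C\<close>
    uniform and independent of \<kappa> and \<open>B\<close>.\<close>
  define EE where "EE f = (\<Sum>\<kappa>\<in>K. \<Sum>A\<in>Pow J. \<Sum>C\<in>Pow J. \<Sum>B\<in>Pow J. g \<kappa> A C * \<nu> B * f \<kappa> A C B)" for f :: "(nat \<Rightarrow> int) \<Rightarrow> 'a set \<Rightarrow> 'a set \<Rightarrow> 'a set \<Rightarrow> real"
  have EE_mono: "EE f1 \<le> EE f2" if "\<And>\<kappa> A C B. f1 \<kappa> A C B \<le> f2 \<kappa> A C B" for f1 f2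
    unfolding EE_def by (intro sum_mono mult_left_mono mult_nonneg_nonneg g0 \<nu>0 that)
  have EE_add: "EE (\<lambda>\<kappa> A C B. f1 \<kappa> A C B + f2 \<kappa> A C B) = EE f1 + EE f2" for f1 f2
    unfolding EE_def by (simp add: distrib_left sum.distrib)
  have EE_scale: "EE (\<lambda>\<kappa> A C B. c * f \<kappa> A C B) = c * EE f" for c f
    unfolding EE_def sum_distrib_left by (intro sum.cong refl) (simp add: algebra_simps)
  have EE_A: "EE (\<lambda>\<kappa> A C B. f \<kappa> A B) = (\<Sum>A\<in>Pow J. \<Sum>B\<in>Pow J. \<mu> A * \<nu> B * (\<Sum>\<kappa>\<in>K. \<rho> \<kappa> A * f \<kappa> A B))" for f
  proof -
    have "EE (\<lambda>\<kappa> A C B. f \<kappa> A B) = (\<Sum>\<kappa>\<in>K. \<Sum>A\<in>Pow J. \<Sum>B\<in>Pow J. \<Sum>C\<in>Pow J. g \<kappa> A C * (\<nu> B * f \<kappa> A B))"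
      unfolding EE_def mult.assoc by (rule sum.cong[OF refl], rule sum.cong[OF refl], rule sum.swap)
    also have "\<dots> = (\<Sum>\<kappa>\<in>K. \<Sum>A\<in>Pow J. \<Sum>B\<in>Pow J. \<mu> A * \<rho> \<kappa> A * (\<nu> B * f \<kappa> A B))"
      unfolding sum_distrib_right[symmetric] by (intro sum.cong refl) (simp add: gA)
    also have "\<dots> = (\<Sum>A\<in>Pow J. \<Sum>B\<in>Pow J. \<Sum>\<kappa>\<in>K. \<mu> A * \<rho> \<kappa> A * (\<nu> B * f \<kappa> A B))"
      by (subst sum.swap) (rule sum.cong[OF refl], rule sum.swap)
    finally show ?thesis by (simp add: sum_distrib_left algebra_simps)
  qed
  have EE_C: "EE (\<lambda>\<kappa> A C B. f \<kappa> C B) = (\<Sum>\<kappa>\<in>K. \<Sum>B\<in>Pow J. m \<kappa> * \<nu> B * avg (Pow J) (\<lambda>C. f \<kappa> C B))" for f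
  proof -
    have "EE (\<lambda>\<kappa> A C B. f \<kappa> C B) = (\<Sum>\<kappa>\<in>K. \<Sum>C\<in>Pow J. \<Sum>A\<in>Pow J. g \<kappa> A C * (\<Sum>B\<in>Pow J. \<nu> B * f \<kappa> C B))"
      unfolding EE_def mult.assoc sum_distrib_left by (rule sum.cong[OF refl], rule sum.swap)
    also have "\<dots> = (\<Sum>\<kappa>\<in>K. \<Sum>C\<in>Pow J. m \<kappa> / 2 ^ card J * (\<Sum>B\<in>Pow J. \<nu> B * f \<kappa> C B))"
      unfolding sum_distrib_right[symmetric] by (intro sum.cong refl) (simp add: gC)
    also have "\<dots> = (\<Sum>\<kappa>\<in>K. m \<kappa> * avg (Pow J) (\<lambda>C. \<Sum>B\<in>Pow J. \<nu> B * f \<kappa> C B))"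
      by (simp only: sum_Pow_avg[OF J])
    finally show ?thesis by (simp add: avg_sum avg_cmult sum_distrib_left algebra_simps)
  qed
  have EE_AC: "EE (\<lambda>\<kappa> A C B. f A C B) = (\<Sum>\<kappa>\<in>K. \<Sum>A\<in>Pow J. \<Sum>C\<in>Pow J. g \<kappa> A C * (\<Sum>B\<in>Pow J. \<nu> B * f A C B))" for f
    unfolding EE_def by (simp add: sum_distrib_left mult.assoc)
  define b where "b B i = ip J (v i) (sgv B)" for B i
  define e1 where "e1 \<kappa> A C B = (\<Sum>i<r. b B i * (of_int (\<kappa> i) - b A i))" for \<kappa> :: "nat \<Rightarrow> int" and A C B :: "'a set"
  define e2 where "e2 \<kappa> A C B = (\<Sum>i<r. b B i * b C i)" for \<kappa> :: "nat \<Rightarrow> int" and A C B :: "'a set"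
  define dd where "dd A C = (\<lambda>j. sg j C - sg j A)" for A C :: "'a set"
  define e3 where "e3 \<kappa> A C B = ip J (\<lambda>j. dd A C j - proj J r v (dd A C) j) (sgv B)" for \<kappa> :: "nat \<Rightarrow> int" and A C B :: "'a set"
  define s where "s \<kappa> B = (\<Sum>i<r. of_int (\<kappa> i) * b B i)" for \<kappa> :: "nat \<Rightarrow> int" and B
  define err where "err \<kappa> A C B = - e1 \<kappa> A C B - e2 \<kappa> A C B - e3 \<kappa> A C B" for \<kappa> A C B
  \<comment> \<open>Decompose \<open>C - A\<close> into its projection on the family and the rest.
    The rounded coordinates give the shift \<open>s\<close>; the errors are the rounding of
    \<open>A\<close>, the part of \<open>C\<close> in the span, and the displacement orthogonal to
    the span.\<close>
  have dec: "ip J (sgv A) (sgv B) = s \<kappa> B + ip J (sgv C) (sgv B) + err \<kappa> A C B" for \<kappa> A C B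
  proof -
    have p: "ip J (proj J r v (dd A C)) (sgv B) = (\<Sum>i<r. (b C i - b A i) * b B i)"
    proof -
      have "ip J (sgv B) (proj J r v (dd A C)) = (\<Sum>i<r. ip J (v i) (dd A C) * ip J (sgv B) (v i))"
        unfolding proj_def by (rule ip_lincomb)
      moreover have "ip J (sgv B) (v i) = b B i" for i unfolding b_def by (rule ip_commute)
      moreover have "ip J (v i) (dd A C) = b C i - b A i" for i unfolding b_def dd_def by (rule ip_diff)
      ultimately show ?thesis by (simp add: ip_commute[of J "proj J r v (dd A C)" "sgv B"])
    qed
    have "e3 \<kappa> A C B = ip J (sgv C) (sgv B) - ip J (sgv A) (sgv B) - (\<Sum>i<r. (b C i - b A i) * b B i)"
      unfolding e3_def ip_diff_left p by (simp add: dd_def ip_diff_left)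
    moreover have "s \<kappa> B - e1 \<kappa> A C B - e2 \<kappa> A C B + (\<Sum>i<r. (b C i - b A i) * b B i) = 0"
      unfolding s_def e1_def e2_def sum_subtractf[symmetric] sum.distrib[symmetric]
      by (intro sum.neutral ballI) (simp add: algebra_simps)
    ultimately show ?thesis unfolding err_def by linarith
  qed
  \<comment> \<open>Given \<open>A\<close> and \<open>B\<close>, the mean square of the rounding
    error is at most a quarter of the squared length of the projection of \<open>B\<close>, hence a
    quarter of the bound in \<open>pn\<close>.\<close>
  have E1: "EE (\<lambda>\<kappa> A C B. (e1 \<kappa> A C B)\<^sup>2) \<le> 5 * \<sigma>\<^sup>2 * N"
  proof -
    have "EE (\<lambda>\<kappa> A C B. (e1 \<kappa> A C B)\<^sup>2) = (\<Sum>A\<in>Pow J. \<Sum>B\<in>Pow J. \<mu> A * \<nu> B * (\<Sum>\<kappa>\<in>K. \<rho> \<kappa> A * (\<Sum>i<r. b B i * (of_int (\<kappa> i) - b A i))\<^sup>2))"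
      unfolding e1_def by (rule EE_A)
    also have "\<dots> \<le> (\<Sum>A\<in>Pow J. \<Sum>B\<in>Pow J. \<mu> A * \<nu> B * ((\<Sum>i<r. (b B i)\<^sup>2) / 4))"
      unfolding b_def by (intro sum_mono mult_left_mono \<rho>var mult_nonneg_nonneg \<mu>0 \<nu>0)
    also have "\<dots> = (\<Sum>A\<in>Pow J. \<mu> A) * (\<Sum>B\<in>Pow J. \<nu> B * ((\<Sum>i<r. (b B i)\<^sup>2) / 4))"
      unfolding sum_product by (simp only: mult.assoc)
    also have "(\<Sum>B\<in>Pow J. \<nu> B * ((\<Sum>i<r. (b B i)\<^sup>2) / 4)) = (\<Sum>B\<in>Pow J. \<nu> B * (\<Sum>i<r. (b B i)\<^sup>2)) / 4"
      by (simp only: times_divide_eq_right sum_divide_distrib[symmetric])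
    finally show ?thesis using pn \<mu>1 by (simp add: b_def)
  qed
  \<comment> \<open>\<open>C\<close> is uniform and independent of \<open>B\<close>, so the mean
    square is that of the projection of \<open>B\<close>.\<close>
  have E2: "EE (\<lambda>\<kappa> A C B. (e2 \<kappa> A C B)\<^sup>2) \<le> 20 * \<sigma>\<^sup>2 * N"
  proof -
    have av: "avg (Pow J) (\<lambda>C. (\<Sum>i<r. b B i * b C i)\<^sup>2) = (\<Sum>i<r. (b B i)\<^sup>2)" for B
    proof -
      define x where "x = (\<lambda>j. \<Sum>i<r. b B i * v i j)"
      have xw: "ip J w x = (\<Sum>i<r. b B i * ip J w (v i))" for w unfolding x_def by (rule ip_lincomb)
      have xv: "ip J (v i) x = b B i" if "i < r" for i
      proof -
        have "ip J (v i) x = (\<Sum>i'<r. b B i' * of_bool (i = i'))"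
          unfolding xw using v that by (intro sum.cong refl) (simp add: orthon_def)
        then show ?thesis using that by (simp add: of_bool_def if_distrib sum.delta cong: if_cong)
      qed
      have "(\<Sum>i<r. b B i * b C i) = ip J x (sgv C)" for C
        unfolding ip_commute[of J x] xw b_def[of C] by (simp add: ip_commute[of J "sgv C" "v _"])
      then have "avg (Pow J) (\<lambda>C. (\<Sum>i<r. b B i * b C i)\<^sup>2) = ip J x x"
        by (simp add: avg_ip_square[OF J])
      also have "\<dots> = (\<Sum>i<r. b B i * ip J x (v i))" by (rule xw)
      also have "\<dots> = (\<Sum>i<r. (b B i)\<^sup>2)"
        by (intro sum.cong refl) (simp add: ip_commute[of J x "v _"] xv power2_eq_square)
      finally show ?thesis .
    qed
    have "EE (\<lambda>\<kappa> A C B. (e2 \<kappa> A C B)\<^sup>2) = (\<Sum>\<kappa>\<in>K. \<Sum>B\<in>Pow J. m \<kappa> * \<nu> B * avg (Pow J) (\<lambda>C. (\<Sum>i<r. b B i * b C i)\<^sup>2))"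
      unfolding e2_def by (rule EE_C)
    also have "\<dots> = (\<Sum>\<kappa>\<in>K. m \<kappa>) * (\<Sum>B\<in>Pow J. \<nu> B * (\<Sum>i<r. (b B i)\<^sup>2))"
      unfolding av sum_product by (simp add: mult.assoc)
    finally show ?thesis using pn m1 by (simp add: b_def)
  qed
  \<comment> \<open>\<open>B\<close> is independent of the pair \<open>A\<close>, \<open>C\<close>,
    and the displacement is orthogonal to the family, so \<open>sm\<close> applies; projecting does
    not lengthen it. The total transport cost gives \<open>4 * (4 * 36 + 1) = 580\<close>.\<close>
  have E3: "EE (\<lambda>\<kappa> A C B. (e3 \<kappa> A C B)\<^sup>2) \<le> 580 * \<sigma> * N"
  proof -
    have "EE (\<lambda>\<kappa> A C B. (e3 \<kappa> A C B)\<^sup>2) = (\<Sum>\<kappa>\<in>K. \<Sum>A\<in>Pow J. \<Sum>C\<in>Pow J. g \<kappa> A C * (\<Sum>B\<in>Pow J. \<nu> B * (ip J (\<lambda>j. dd A C j - proj J r v (dd A C) j) (sgv B))\<^sup>2))"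
      unfolding e3_def by (rule EE_AC)
    also have "\<dots> \<le> (\<Sum>\<kappa>\<in>K. \<Sum>A\<in>Pow J. \<Sum>C\<in>Pow J. g \<kappa> A C * (4 * sqd J A C))"
    proof (intro sum_mono mult_left_mono g0)
      fix A C :: "'a set"
      let ?w = "\<lambda>j. dd A C j - proj J r v (dd A C) j"
      have "(\<Sum>B\<in>Pow J. \<nu> B * (ip J ?w (sgv B))\<^sup>2) \<le> 4 * ip J ?w ?w"
        by (rule sm) (simp add: ip_diff ip_proj[OF v])
      also have "ip J ?w ?w \<le> ip J (dd A C) (dd A C)"
        unfolding proj_resid[OF v] by (simp add: sum_nonneg)
      also have "\<dots> = sqd J A C" unfolding sqd_def dd_def ip_def by (simp add: power2_eq_square algebra_simps)
      finally show "(\<Sum>B\<in>Pow J. \<nu> B * (ip J ?w (sgv B))\<^sup>2) \<le> 4 * sqd J A C" by simp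
    qed
    also have "\<dots> = 4 * (\<Sum>\<kappa>\<in>K. \<Sum>A\<in>Pow J. \<Sum>C\<in>Pow J. g \<kappa> A C * sqd J A C)"
      by (simp add: sum_distrib_left algebra_simps)
    also have "\<dots> \<le> 4 * (\<Sum>\<kappa>\<in>K. 4 * deficit J (\<lambda>A. \<mu> A * \<rho> \<kappa> A) / \<sigma> + m \<kappa> * card J * \<sigma>)"
      using gcost by (intro mult_left_mono sum_mono) auto
    also have "\<dots> = 4 * (4 * (\<Sum>\<kappa>\<in>K. deficit J (\<lambda>A. \<mu> A * \<rho> \<kappa> A)) / \<sigma> + N * \<sigma>)"
      using m1 by (simp add: sum.distrib sum_distrib_left[symmetric] sum_divide_distrib[symmetric] sum_distrib_right[symmetric] N_def)
    also have "\<dots> \<le> 4 * (4 * (36 * \<sigma>\<^sup>2 * N) / \<sigma> + N * \<sigma>)"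
      using \<rho>d' \<sigma> N0 by (intro mult_left_mono add_mono divide_right_mono) auto
    also have "\<dots> = 580 * \<sigma> * N" using \<sigma> by (simp add: power2_eq_square field_simps)
    finally show ?thesis .
  qed
  have E: "EE (\<lambda>\<kappa> A C B. (err \<kappa> A C B)\<^sup>2) \<le> 2000 * \<sigma> * N"
  proof -
    have "EE (\<lambda>\<kappa> A C B. (err \<kappa> A C B)\<^sup>2) \<le> EE (\<lambda>\<kappa> A C B. 3 * ((e1 \<kappa> A C B)\<^sup>2 + ((e2 \<kappa> A C B)\<^sup>2 + (e3 \<kappa> A C B)\<^sup>2)))"
    proof (rule EE_mono)
      fix \<kappa> A C B
      have "(- x - y - z)\<^sup>2 \<le> 3 * (x\<^sup>2 + (y\<^sup>2 + z\<^sup>2))" for x y z :: real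
        using zero_le_power2[of "x - y"] zero_le_power2[of "y - z"] zero_le_power2[of "x - z"]
        by (simp add: power2_eq_square algebra_simps)
      then show "(err \<kappa> A C B)\<^sup>2 \<le> 3 * ((e1 \<kappa> A C B)\<^sup>2 + ((e2 \<kappa> A C B)\<^sup>2 + (e3 \<kappa> A C B)\<^sup>2))"
        unfolding err_def .
    qed
    also have "\<dots> = 3 * (EE (\<lambda>\<kappa> A C B. (e1 \<kappa> A C B)\<^sup>2) + (EE (\<lambda>\<kappa> A C B. (e2 \<kappa> A C B)\<^sup>2) + EE (\<lambda>\<kappa> A C B. (e3 \<kappa> A C B)\<^sup>2)))"
      unfolding EE_scale EE_add ..
    also have "\<dots> \<le> 3 * (5 * \<sigma>\<^sup>2 * N + (20 * \<sigma>\<^sup>2 * N + 580 * \<sigma> * N))"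
      by (intro mult_left_mono add_mono E1 E2 E3) simp
    also have "\<dots> \<le> 2000 * \<sigma> * N"
    proof -
      have "0 \<le> \<sigma> * N" using \<sigma> N0 by simp
      moreover have "3 * (5 * \<sigma>\<^sup>2 * N + (20 * \<sigma>\<^sup>2 * N + 580 * \<sigma> * N)) = 75 * (\<sigma>\<^sup>2 * N) + 1740 * (\<sigma> * N)" by simp
      ultimately show ?thesis using \<sigma>2(2) by linarith
    qed
    finally show ?thesis .
  qed
  have "\<beta> \<le> EE (\<lambda>\<kappa> A C B. of_bool (t + h \<le> \<bar>s \<kappa> B + ip J (sgv C) (sgv B)\<bar>))"
  proof -
    have m0: "0 \<le> m \<kappa>" if "\<kappa> \<in> K" for \<kappa>
      unfolding m_def using that by (intro sum_nonneg mult_nonneg_nonneg \<mu>0 \<rho>0)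
    have "\<beta> = (\<Sum>\<kappa>\<in>K. \<Sum>B\<in>Pow J. m \<kappa> * \<nu> B * \<beta>)"
      using m1 \<nu>1 by (simp add: sum_distrib_right[symmetric] sum_distrib_left[symmetric])
    also have "\<dots> \<le> (\<Sum>\<kappa>\<in>K. \<Sum>B\<in>Pow J. m \<kappa> * \<nu> B * avg (Pow J) (\<lambda>C. of_bool (t + h \<le> \<bar>s \<kappa> B + ip J (sgv C) (sgv B)\<bar>)))"
      by (intro sum_mono mult_left_mono tail mult_nonneg_nonneg m0 \<nu>0)
    also have "\<dots> = EE (\<lambda>\<kappa> A C B. of_bool (t + h \<le> \<bar>s \<kappa> B + ip J (sgv C) (sgv B)\<bar>))"
      by (rule EE_C[symmetric])
    finally show ?thesis .
  qed
  \<comment> \<open>If the shifted uniform product reaches \<open>t + h\<close> in absolute value,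
    then the true product reaches \<open>t\<close> or the error reaches \<open>h\<close>; the latter
    is charged to the scaled square of the error.\<close>
  also have "\<dots> \<le> EE (\<lambda>\<kappa> A C B. of_bool (t \<le> \<bar>ip J (sgv A) (sgv B)\<bar>) + (1 / h\<^sup>2) * (err \<kappa> A C B)\<^sup>2)"
  proof (rule EE_mono)
    fix \<kappa> A C B
    have "1 \<le> (1 / h\<^sup>2) * (err \<kappa> A C B)\<^sup>2" if "h \<le> \<bar>err \<kappa> A C B\<bar>"
    proof -
      have "h\<^sup>2 \<le> \<bar>err \<kappa> A C B\<bar>\<^sup>2" using that h by (intro power_mono) auto
      then show ?thesis using h by (simp add: field_simps)
    qed
    moreover have "0 \<le> (1 / h\<^sup>2) * (err \<kappa> A C B)\<^sup>2" by simp
    moreover have "t \<le> \<bar>ip J (sgv A) (sgv B)\<bar> \<or> h \<le> \<bar>err \<kappa> A C B\<bar>"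
      if "t + h \<le> \<bar>s \<kappa> B + ip J (sgv C) (sgv B)\<bar>"
      using that dec[of A B \<kappa> C] by linarith
    ultimately show "of_bool (t + h \<le> \<bar>s \<kappa> B + ip J (sgv C) (sgv B)\<bar>) \<le>
      of_bool (t \<le> \<bar>ip J (sgv A) (sgv B)\<bar>) + (1 / h\<^sup>2) * (err \<kappa> A C B)\<^sup>2"
      by (auto simp: of_bool_def)
  qed
  also have "\<dots> = EE (\<lambda>\<kappa> A C B. of_bool (t \<le> \<bar>ip J (sgv A) (sgv B)\<bar>)) + (1 / h\<^sup>2) * EE (\<lambda>\<kappa> A C B. (err \<kappa> A C B)\<^sup>2)"
    unfolding EE_add EE_scale ..
  also have "EE (\<lambda>\<kappa> A C B. of_bool (t \<le> \<bar>ip J (sgv A) (sgv B)\<bar>)) =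
    (\<Sum>A\<in>Pow J. \<Sum>B\<in>Pow J. \<mu> A * \<nu> B * of_bool (t \<le> \<bar>ip J (sgv A) (sgv B)\<bar>))"
    unfolding EE_A[of "\<lambda>\<kappa> A B. of_bool (t \<le> \<bar>ip J (sgv A) (sgv B)\<bar>)"]
    by (intro sum.cong refl) (simp add: \<rho>1 sum_distrib_right[symmetric])
  also have "(1 / h\<^sup>2) * EE (\<lambda>\<kappa> A C B. (err \<kappa> A C B)\<^sup>2) \<le> (1 / h\<^sup>2) * (2000 * \<sigma> * N)"
    using E by (intro mult_left_mono) auto
  finally show ?thesis by (simp add: N_def)
qed

section \<open>Gap orthogonality under the uniform distribution\<close>

lemma cosh_bounds:
  fixes y :: real
  assumes "0 \<le> y" "y \<le> 1"
  shows "1 + y\<^sup>2 / 4 \<le> (exp (- y) + exp y) / 2" "(exp (- y) + exp y) / 2 \<le> 1 + y\<^sup>2"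
proof -
  have 1: "1 + y + y\<^sup>2 / 2 \<le> exp y" using assms by (intro exp_lower_Taylor_quadratic)
  have 2: "1 + (- y) \<le> exp (- y)" by (rule exp_ge_add_one_self)
  show "1 + y\<^sup>2 / 4 \<le> (exp (- y) + exp y) / 2" using 1 2 by simp
  have 3: "exp y \<le> 1 + y + y\<^sup>2" using assms by (intro exp_bound)
  have "exp (- y) \<le> 1 / (1 + y)"
    using exp_ge_add_one_self[of y] assms by (simp add: exp_minus field_simps)
  also have "\<dots> \<le> 1 - y + y\<^sup>2"
  proof -
    have "1 \<le> (1 - y + y\<^sup>2) * (1 + y)"
      using assms by (simp add: power2_eq_square algebra_simps)
    then show ?thesis using assms by (simp add: divide_le_eq)
  qed
  finally show "(exp (- y) + exp y) / 2 \<le> 1 + y\<^sup>2" using 3 by simp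
qed

text \<open>A linearised Cauchy-Schwarz inequality: on the event
  \<open>V \<le> V\<^sup>2 / (2 * c) + c / 2\<close>, off it \<open>V\<close> is below half its
  mean. The choice of \<open>c\<close> makes the square term a quarter of the mean.\<close>

lemma paley_zygmund_avg:
  fixes V :: "'b \<Rightarrow> real"
  assumes "finite \<Omega>" "\<Omega> \<noteq> {}" "\<And>x. x \<in> \<Omega> \<Longrightarrow> 0 \<le> V x" and E: "0 < avg \<Omega> V" and E2: "0 < avg \<Omega> (\<lambda>x. (V x)\<^sup>2)"
  shows "(avg \<Omega> V)\<^sup>2 / (4 * avg \<Omega> (\<lambda>x. (V x)\<^sup>2)) \<le> avg \<Omega> (\<lambda>x. of_bool (avg \<Omega> V / 2 \<le> V x))"
proof -
  define e where "e = avg \<Omega> V"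
  define e2 where "e2 = avg \<Omega> (\<lambda>x. (V x)\<^sup>2)"
  define P where "P = avg \<Omega> (\<lambda>x. of_bool (e / 2 \<le> V x))"
  define c where "c = 2 * e2 / e"
  have pos: "0 < e" "0 < e2" "0 < c" using E E2 by (auto simp: e_def e2_def c_def)
  have "avg \<Omega> V \<le> avg \<Omega> (\<lambda>x. (1 / (2 * c)) * (V x)\<^sup>2 + (c / 2 * of_bool (e / 2 \<le> V x) + e / 2))"
  proof (rule avg_mono)
    fix x assume x: "x \<in> \<Omega>"
    have "0 \<le> (V x - c)\<^sup>2" by simp
    then have "2 * c * V x \<le> (V x)\<^sup>2 + c\<^sup>2" by (simp add: power2_eq_square algebra_simps)
    then have "V x \<le> ((V x)\<^sup>2 + c\<^sup>2) / (2 * c)" using pos by (simp add: field_simps)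
    also have "\<dots> = (1 / (2 * c)) * (V x)\<^sup>2 + c / 2" using pos by (simp add: field_simps power2_eq_square)
    finally have 1: "V x \<le> (1 / (2 * c)) * (V x)\<^sup>2 + c / 2" .
    have 2: "0 \<le> (1 / (2 * c)) * (V x)\<^sup>2" using pos by simp
    show "V x \<le> (1 / (2 * c)) * (V x)\<^sup>2 + (c / 2 * of_bool (e / 2 \<le> V x) + e / 2)"
    proof (cases "e / 2 \<le> V x")
      case True
      then have "of_bool (e / 2 \<le> V x) = (1::real)" by simp
      then show ?thesis using 1 pos by (simp only: mult_1_right)
    next
      case False
      then have "of_bool (e / 2 \<le> V x) = (0::real)" by simp
      then show ?thesis using 2 False pos by (simp only: mult_zero_right)
    qed
  qed
  also have "\<dots> = (1 / (2 * c)) * e2 + (c / 2 * P + e / 2)"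
    unfolding avg_add avg_cmult e2_def P_def using assms by (simp add: avg_const)
  also have "(1 / (2 * c)) * e2 = e / 4" using pos by (simp add: c_def field_simps)
  finally have "e / 4 \<le> c / 2 * P" by (simp add: e_def)
  then have "e / 4 \<le> e2 / e * P" by (simp add: c_def)
  then have "e\<^sup>2 / (4 * e2) \<le> P" using pos by (simp add: field_simps power2_eq_square)
  then show ?thesis by (simp add: P_def e_def e2_def)
qed

lemma avg_exp_ip:
  assumes J: "finite J" and B: "B \<in> Pow J"
  shows "avg (Pow J) (\<lambda>A. exp (y * ip J (sgv A) (sgv B))) = ((exp (- y) + exp y) / 2) ^ card J"
proof -
  have "avg (Pow J) (\<lambda>A. exp (y * ip J (sgv A) (sgv B))) = avg (Pow J) (\<lambda>A. \<Prod>j\<in>J. exp (y * ((if j \<in> A then 1 else -1) * sg j B)))"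
    unfolding ip_def sum_distrib_left exp_sum[OF J] sg_def ..
  also have "\<dots> = (\<Prod>j\<in>J. (exp (y * ((if False then 1 else -1) * sg j B)) + exp (y * ((if True then 1 else -1) * sg j B))) / 2)"
    by (rule avg_Pow_prod[OF J])
  also have "\<dots> = (\<Prod>j\<in>J. (exp (- y) + exp y) / 2)"
    by (intro prod.cong refl) (auto simp: sg_def add.commute)
  finally show ?thesis by simp
qed

text \<open>Paley-Zygmund for an exponential tilt with \<open>y = 24 / sqrt N\<close>. The mean is
  at least \<open>(1 + 144 / N) ^ N\<close>, whose logarithm is at least 135; the second moment is
  at most \<open>exp 2304\<close>, where \<open>2304 = N * (2 * y)\<^sup>2\<close>. Exceeding half
  the mean forces the exponent above 122, more than the required \<open>24 * 5\<close>. Dimension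
  \<open>2304 = 48 * 48\<close> or more ensures \<open>2 * y \<le> 1\<close>, the range of
  \<open>cosh_bounds\<close>.\<close>

lemma ip_tail:
  fixes s \<epsilon> :: real
  assumes J: "finite J" "2304 \<le> card J" and B: "B \<in> Pow J" and \<epsilon>: "\<epsilon> = 1 \<or> \<epsilon> = - 1"
  shows "exp (- 2304) / 4 \<le> avg (Pow J) (\<lambda>A. of_bool (5 * sqrt (card J) \<le> \<epsilon> * ip J (sgv A) (sgv B)))"
proof -
  define N where "N = real (card J)"
  have N: "2304 \<le> N" using J by (simp add: N_def)
  define y where "y = 24 / sqrt N"
  have sN: "48 \<le> sqrt N" using N real_le_rsqrt[of 48 N] by simp
  have y: "0 < y" "y \<le> 1" "2 * y \<le> 1" using sN N by (auto simp: y_def divide_le_eq)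
  have y2: "y\<^sup>2 = 576 / N" using N by (simp add: y_def power_divide)
  define q where "q y = (exp (- y) + exp y) / 2" for y :: real
  define V where "V A = exp (y * \<epsilon> * ip J (sgv A) (sgv B))" for A
  have q_eps: "q (z * \<epsilon>) = q z" for z using \<epsilon> by (auto simp: q_def)
  have EV: "avg (Pow J) V = q y ^ card J"
    unfolding V_def avg_exp_ip[OF J(1) B] q_def[symmetric] q_eps ..
  have EV2: "avg (Pow J) (\<lambda>A. (V A)\<^sup>2) = q (2 * y) ^ card J"
  proof -
    have "(V A)\<^sup>2 = exp ((2 * y) * \<epsilon> * ip J (sgv A) (sgv B))" for A
      by (simp add: V_def power2_eq_square exp_add[symmetric])
    then show ?thesis by (simp add: avg_exp_ip[OF J(1) B] q_def[symmetric] q_eps del: mult.assoc)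
  qed
  have ql: "1 + y\<^sup>2 / 4 \<le> q y" and qu: "q (2 * y) \<le> 1 + (2 * y)\<^sup>2"
    unfolding q_def using cosh_bounds[of y] cosh_bounds[of "2 * y"] y by auto
  have q1: "1 \<le> q y" using ql by (smt (verit) zero_le_power2 divide_nonneg_nonneg)
  have q0: "0 < q (2 * y)" by (simp add: q_def add_pos_pos)
  have E1: "1 \<le> avg (Pow J) V" unfolding EV using q1 by (rule one_le_power)
  have E2: "avg (Pow J) (\<lambda>A. (V A)\<^sup>2) \<le> exp 2304"
  proof -
    have "q (2 * y) ^ card J \<le> exp ((2 * y)\<^sup>2) ^ card J"
      by (intro power_mono order_trans[OF qu exp_ge_add_one_self] less_imp_le[OF q0])
    also have "\<dots> = exp (N * (2 * y)\<^sup>2)" by (simp add: exp_of_nat_mult[symmetric] N_def)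
    also have "N * (2 * y)\<^sup>2 = 2304" using N by (simp add: power_mult_distrib y2)
    finally show ?thesis unfolding EV2 .
  qed
  have E2p: "0 < avg (Pow J) (\<lambda>A. (V A)\<^sup>2)" unfolding EV2 using q0 by simp
  have lnE: "122 \<le> ln (avg (Pow J) V / 2)"
  proof -
    define x where "x = y\<^sup>2 / 4"
    have x: "x = 144 / N" by (simp add: x_def y2)
    have x01: "0 \<le> x" "x \<le> 1" using N by (auto simp: x)
    have "x - x\<^sup>2 \<le> ln (1 + x)" using x01 by (intro ln_one_plus_pos_lower_bound)
    also have "\<dots> \<le> ln (q y)" using ql x01(1) q1 by (subst ln_le_cancel_iff) (simp_all add: x_def add_pos_nonneg)
    finally have "N * (x - x\<^sup>2) \<le> N * ln (q y)" using N by (intro mult_left_mono) auto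
    moreover have "N * (x - x\<^sup>2) = 144 - 20736 / N"
      using N by (simp add: x power2_eq_square field_simps)
    moreover have "20736 / N \<le> 9" using N by (simp add: divide_le_eq)
    ultimately have "135 \<le> N * ln (q y)" by linarith
    moreover have "ln (avg (Pow J) V / 2) = N * ln (q y) - ln 2"
      unfolding EV using q1 by (simp add: ln_div ln_realpow N_def)
    moreover have "ln (2::real) \<le> 1" using ln_le_minus_one[of "2::real"] by simp
    ultimately show ?thesis by linarith
  qed
  have "exp (- 2304) / 4 \<le> (avg (Pow J) V)\<^sup>2 / (4 * avg (Pow J) (\<lambda>A. (V A)\<^sup>2))"
  proof -
    have "exp (- 2304) / 4 = 1 / (4 * exp (2304::real))" by (simp add: exp_minus field_simps)
    also have "\<dots> \<le> (avg (Pow J) V)\<^sup>2 / (4 * avg (Pow J) (\<lambda>A. (V A)\<^sup>2))"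
      using E1 E2 E2p by (intro frac_le) (auto simp: one_le_power)
    finally show ?thesis .
  qed
  also have "\<dots> \<le> avg (Pow J) (\<lambda>A. of_bool (avg (Pow J) V / 2 \<le> V A))"
    by (rule paley_zygmund_avg) (use J E1 E2p in \<open>auto simp: V_def\<close>)
  also have "\<dots> \<le> avg (Pow J) (\<lambda>A. of_bool (5 * sqrt (card J) \<le> \<epsilon> * ip J (sgv A) (sgv B)))"
  proof (rule avg_mono)
    fix A
    have "5 * sqrt N \<le> \<epsilon> * ip J (sgv A) (sgv B)" if "avg (Pow J) V / 2 \<le> V A"
    proof -
      have "ln (avg (Pow J) V / 2) \<le> ln (V A)" using that E1 by (subst ln_le_cancel_iff) (auto simp: V_def)
      then have "122 \<le> y * (\<epsilon> * ip J (sgv A) (sgv B))" using lnE by (simp add: V_def)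
      then have "120 \<le> 24 / sqrt N * (\<epsilon> * ip J (sgv A) (sgv B))" by (simp add: y_def)
      moreover have "sqrt N > 0" using sN by linarith
      ultimately show ?thesis by (simp add: field_simps)
    qed
    then show "of_bool (avg (Pow J) V / 2 \<le> V A) \<le> (of_bool (5 * sqrt (card J) \<le> \<epsilon> * ip J (sgv A) (sgv B)) :: real)"
      by (simp add: N_def)
  qed
  finally show ?thesis .
qed

text \<open>The one-sided tail is taken in the direction of the sign of the shift, which then only
  helps.\<close>

lemma ip_shift_tail:
  assumes J: "finite J" "2304 \<le> card J" and B: "B \<in> Pow J"
  shows "exp (- 2304) / 4 \<le> avg (Pow J) (\<lambda>A. of_bool (4 * sqrt (card J) + sqrt (card J) \<le> \<bar>s + ip J (sgv A) (sgv B)\<bar>))"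
proof -
  define \<epsilon> where "\<epsilon> = (if 0 \<le> s then 1 else - 1 :: real)"
  have "exp (- 2304) / 4 \<le> avg (Pow J) (\<lambda>A. of_bool (5 * sqrt (card J) \<le> \<epsilon> * ip J (sgv A) (sgv B)))"
    by (rule ip_tail[OF J B]) (simp add: \<epsilon>_def)
  also have "\<dots> \<le> avg (Pow J) (\<lambda>A. of_bool (4 * sqrt (card J) + sqrt (card J) \<le> \<bar>s + ip J (sgv A) (sgv B)\<bar>))"
    by (rule avg_mono) (auto simp: \<epsilon>_def)
  finally show ?thesis .
qed

text \<open>In the coupling with the uniform law, mass arriving at \<open>C\<close> from other
  points travels squared distance at least 4, so at most a quarter of the transport cost is missing
  at \<open>C\<close>. This replaces the tail bound in bounded dimension.\<close>

lemma point_mass_lower: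
  fixes \<mu> :: "'a set \<Rightarrow> real" and \<tau> :: real
  assumes J: "finite J" and \<mu>0: "\<And>A. A \<in> Pow J \<Longrightarrow> 0 \<le> \<mu> A" and \<mu>1: "(\<Sum>A\<in>Pow J. \<mu> A) = 1"
    and \<tau>: "0 < \<tau>" and C: "C \<in> Pow J"
  shows "1 / 2 ^ card J - (4 * deficit J \<mu> / \<tau> + card J * \<tau>) / 4 \<le> \<mu> C"
proof -
  obtain g where G: "\<forall>A\<in>Pow J. \<forall>B\<in>Pow J. 0 \<le> g A B" "\<forall>A\<in>Pow J. (\<Sum>B\<in>Pow J. g A B) = \<mu> A"
     "\<forall>B\<in>Pow J. (\<Sum>A\<in>Pow J. g A B) = (\<Sum>A\<in>Pow J. \<mu> A) / 2 ^ card J"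
     "(\<Sum>A\<in>Pow J. \<Sum>B\<in>Pow J. g A B * sqd J A B) \<le> 4 * deficit J \<mu> / \<tau> + (\<Sum>A\<in>Pow J. \<mu> A) * card J * \<tau>"
    by (rule exE[OF transport[of J \<tau> \<mu>, OF J \<tau>]], erule \<mu>0, elim conjE, rule that)
  note g0 = G(1)[rule_format]
  have sqd0: "0 \<le> sqd J A B" for A B unfolding sqd_def by (simp add: sum_nonneg)
  have sqd4: "4 \<le> sqd J A C" if A: "A \<in> Pow J" "A \<noteq> C" for A
  proof -
    obtain j where j: "(j \<in> A) \<noteq> (j \<in> C)" using A(2) unfolding set_eq_iff by blast
    then have "j \<in> J" using A(1) C by auto
    note j = this j
    have "(sg j A - sg j C)\<^sup>2 \<le> sqd J A C" unfolding sqd_def using j J by (intro member_le_sum) auto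
    moreover have "(sg j A - sg j C)\<^sup>2 = 4" using j by (auto simp: sg_def)
    ultimately show ?thesis by simp
  qed
  have f: "finite (Pow J)" using J by simp
  have "1 / 2 ^ card J = (\<Sum>A\<in>Pow J. g A C)" using G(3) C \<mu>1 by simp
  also have "\<dots> = g C C + (\<Sum>A\<in>Pow J - {C}. g A C)" using f C by (rule sum.remove)
  also have "g C C \<le> \<mu> C"
  proof -
    have "g C C \<le> (\<Sum>B\<in>Pow J. g C B)" using f C g0 by (intro member_le_sum) auto
    then show ?thesis using G(2) C by simp
  qed
  also have "(\<Sum>A\<in>Pow J - {C}. g A C) \<le> (\<Sum>A\<in>Pow J. g A C * sqd J A C) / 4"
  proof -
    have "(\<Sum>A\<in>Pow J - {C}. g A C * 4) \<le> (\<Sum>A\<in>Pow J - {C}. g A C * sqd J A C)"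
      using g0 C sqd4 by (intro sum_mono mult_left_mono) auto
    also have "\<dots> \<le> (\<Sum>A\<in>Pow J. g A C * sqd J A C)"
      using f C g0 sqd0 by (intro sum_mono2) auto
    finally show ?thesis by (simp add: sum_distrib_right[symmetric])
  qed
  also have "(\<Sum>A\<in>Pow J. g A C * sqd J A C) \<le> (\<Sum>A\<in>Pow J. \<Sum>B\<in>Pow J. g A B * sqd J A B)"
  proof (rule sum_mono)
    fix A assume A: "A \<in> Pow J"
    show "g A C * sqd J A C \<le> (\<Sum>B\<in>Pow J. g A B * sqd J A B)"
      using f A C g0 sqd0 by (intro member_le_sum[where f = "\<lambda>B. g A B * sqd J A B"]) auto
  qed
  also have "\<dots> \<le> 4 * deficit J \<mu> / \<tau> + card J * \<tau>" using G(4) \<mu>1 by simp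
  finally show ?thesis by simp
qed

text \<open>From dimension 2304 on, the tail at \<open>5 * sqrt N\<close> leaves the room
  \<open>h = sqrt N\<close>. Below, both measures have point masses bounded away from 0, and one
  pair suffices: two empty sets have inner product \<open>N\<close>, and
  \<open>N \<ge> 4 * sqrt N\<close> because \<open>N \<ge> 16\<close>.\<close>

lemma anticoncentration_uniform:
  "\<exists>c>0. \<exists>\<beta>>0. \<forall>(J :: 'a set) \<mu> \<nu>. finite J \<longrightarrow> 16 \<le> card J \<longrightarrow>
     (\<forall>A\<in>Pow J. 0 \<le> \<mu> A) \<longrightarrow> (\<Sum>A\<in>Pow J. \<mu> A) = 1 \<longrightarrow> (\<forall>A\<in>Pow J. 0 \<le> \<nu> A) \<longrightarrow> (\<Sum>A\<in>Pow J. \<nu> A) = 1 \<longrightarrow>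
     deficit J \<mu> \<le> c * real (card J) \<longrightarrow> deficit J \<nu> \<le> c * real (card J) \<longrightarrow>
     \<beta> \<le> (\<Sum>A\<in>Pow J. \<Sum>B\<in>Pow J. \<mu> A * \<nu> B * of_bool (4 * sqrt (card J) \<le> \<bar>ip J (sgv A) (sgv B)\<bar>))"
proof -
  define \<beta>0 :: real where "\<beta>0 = exp (- 2304) / 4"
  \<comment> \<open>The first bound makes the error \<open>2000 * \<sigma>\<close> at most half of
    \<open>\<beta>0\<close>. The second serves dimensions up to 2304: the loss
    \<open>2880 * \<sigma>\<^sup>2\<close> is at most half of \<open>(1 / 2) ^ 2304\<close>, since
    \<open>2880 \<le> 2 ^ 15\<close>.\<close>
  define \<sigma> :: real where "\<sigma> = min (\<beta>0 / 4000) ((1 / 2) ^ 2320)"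
  define \<beta> :: real where "\<beta> = min (\<beta>0 / 2) ((1 / 2) ^ 2305 * (1 / 2) ^ 2305)"
  have \<beta>0: "0 < \<beta>0" by (simp add: \<beta>0_def)
  have \<sigma>: "0 < \<sigma>" "\<sigma> \<le> 1" "\<sigma> \<le> \<beta>0 / 4000" "\<sigma> \<le> (1 / 2) ^ 2320"
    using \<beta>0 by (auto simp: \<sigma>_def power_le_one min_le_iff_disj)
  have main: "\<beta> \<le> (\<Sum>A\<in>Pow J. \<Sum>B\<in>Pow J. \<mu> A * \<nu> B * of_bool (4 * sqrt (card J) \<le> \<bar>ip J (sgv A) (sgv B)\<bar>))"
    if J: "finite J" "16 \<le> card J" and \<mu>: "\<forall>A\<in>Pow J. 0 \<le> \<mu> A" "(\<Sum>A\<in>Pow J. \<mu> A) = 1"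
      and \<nu>: "\<forall>A\<in>Pow J. 0 \<le> \<nu> A" "(\<Sum>A\<in>Pow J. \<nu> A) = 1"
      and d: "deficit J \<mu> \<le> \<sigma> ^ 4 * card J" "deficit J \<nu> \<le> \<sigma> ^ 4 * card J" for J :: "'a set" and \<mu> \<nu>
  proof (cases "2304 \<le> card J")
    case True
    have "\<beta>0 - 2000 * \<sigma> * card J / (sqrt (card J))\<^sup>2 \<le>
      (\<Sum>A\<in>Pow J. \<Sum>B\<in>Pow J. \<mu> A * \<nu> B * of_bool (4 * sqrt (card J) \<le> \<bar>ip J (sgv A) (sgv B)\<bar>))"
    proof (rule anticoncentration)
      show "\<beta>0 \<le> avg (Pow J) (\<lambda>A. of_bool (4 * sqrt (card J) + sqrt (card J) \<le> \<bar>s + ip J (sgv A) (sgv B)\<bar>))"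
        if "B \<in> Pow J" for B s
        unfolding \<beta>0_def by (rule ip_shift_tail[OF J(1) True that])
    qed (use J \<mu> \<nu> d \<sigma> True in auto)
    moreover have "2000 * \<sigma> * card J / (sqrt (card J))\<^sup>2 = 2000 * \<sigma>" using True by simp
    moreover have "\<beta> \<le> \<beta>0 - 2000 * \<sigma>" using \<sigma> by (simp add: \<beta>_def)
    ultimately show ?thesis by linarith
  next
    case False
    define N where "N = card J"
    have N: "16 \<le> N" "N \<le> 2304" using J False by (auto simp: N_def)
    have pm: "(1 / 2) ^ 2305 \<le> \<mu> {}" if \<mu>: "\<forall>A\<in>Pow J. 0 \<le> \<mu> A" "(\<Sum>A\<in>Pow J. \<mu> A) = 1"
      and d: "deficit J \<mu> \<le> \<sigma> ^ 4 * card J" for \<mu>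
    proof -
      define z where "z = \<sigma>\<^sup>2 * N"
      have gen: "a - 5 * y / 4 \<le> m" if "a - (b + y) / 4 \<le> m" "b \<le> 4 * y" for a b m y :: real
        using that by argo
      have "4 * deficit J \<mu> / \<sigma>\<^sup>2 \<le> 4 * (\<sigma> ^ 4 * N) / \<sigma>\<^sup>2"
        using d \<sigma> by (intro divide_right_mono mult_left_mono) (auto simp: N_def)
      also have "\<dots> = 4 * z" using \<sigma> by (simp add: z_def power2_eq_square power4_eq_xxxx)
      finally have b: "4 * deficit J \<mu> / \<sigma>\<^sup>2 \<le> 4 * z" .
      have "1 / 2 ^ card J - (4 * deficit J \<mu> / \<sigma>\<^sup>2 + card J * \<sigma>\<^sup>2) / 4 \<le> \<mu> {}"
        by (rule point_mass_lower) (use J \<mu> \<sigma> in auto)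
      then have "1 / 2 ^ N - (4 * deficit J \<mu> / \<sigma>\<^sup>2 + z) / 4 \<le> \<mu> {}"
        unfolding z_def N_def by (simp only: mult.commute)
      from gen[OF this b] have 1: "1 / 2 ^ N - 5 * \<sigma>\<^sup>2 * N / 4 \<le> \<mu> {}"
        by (simp only: z_def mult.assoc)
      have "\<sigma>\<^sup>2 \<le> \<sigma>" using \<sigma> by (simp add: power2_eq_square)
      then have s2: "\<sigma>\<^sup>2 \<le> (1 / 2) ^ 2320" using \<sigma>(4) by (rule order_trans)
      have "5 * \<sigma>\<^sup>2 * N / 4 \<le> 2880 * \<sigma>\<^sup>2"
        using N mult_right_mono[of "real N" 2304 "\<sigma>\<^sup>2"] by (simp add: mult.commute)
      also have "\<dots> \<le> 2880 * (1 / 2) ^ 2320" using s2 by simp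
      also have "\<dots> = (2880 * (1 / 2) ^ 15) * (1 / 2) ^ 2305"
        by (simp only: mult.assoc power_add[symmetric]) simp
      also have "\<dots> \<le> 1 * (1 / 2) ^ 2305"
      proof (rule mult_right_mono)
        show "2880 * (1 / 2 :: real) ^ 15 \<le> 1" by (simp add: power_one_over)
      qed simp
      finally have 2: "5 * \<sigma>\<^sup>2 * N / 4 \<le> (1 / 2) ^ 2305" by (simp only: mult_1_left)
      have "(1 / 2 :: real) ^ 2304 \<le> (1 / 2) ^ N" using N by (intro power_decreasing) auto
      moreover have "(1 / 2 :: real) ^ 2304 = (1 / 2) ^ 2305 + (1 / 2) ^ 2305"
      proof -
        have "(1 / 2 :: real) ^ 2305 = (1 / 2) ^ 2304 * (1 / 2)"
          using power_Suc2[of "1 / 2 :: real" 2304] by (simp only: eval_nat_numeral(1)[symmetric] Suc_numeral semiring_norm)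
        then show ?thesis by argo
      qed
      moreover have "(1 / 2 :: real) ^ N = 1 / 2 ^ N" by (rule power_one_over)
      ultimately show ?thesis using 1 2 by argo
    qed
    have "4 * sqrt N \<le> N"
    proof -
      have "4 \<le> sqrt N" using N real_le_rsqrt[of 4 N] by simp
      then have "4 * sqrt N \<le> sqrt N * sqrt N" by (intro mult_right_mono) auto
      then show ?thesis by simp
    qed
    then have big: "4 * sqrt (card J) \<le> \<bar>ip J (sgv {}) (sgv {})\<bar>" by (simp add: sgv_norm N_def)
    have "\<beta> \<le> (1 / 2) ^ 2305 * (1 / 2) ^ 2305" unfolding \<beta>_def by (rule min.cobounded2)
    also have "\<dots> \<le> \<mu> {} * \<nu> {}" by (intro mult_mono pm \<mu> \<nu> d) (use \<mu> in auto)
    also have "\<dots> = \<mu> {} * \<nu> {} * of_bool (4 * sqrt (card J) \<le> \<bar>ip J (sgv {}) (sgv {})\<bar>)" using big by simp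
    also have "\<dots> \<le> (\<Sum>B\<in>Pow J. \<mu> {} * \<nu> B * of_bool (4 * sqrt (card J) \<le> \<bar>ip J (sgv {}) (sgv B)\<bar>))"
      using J \<mu> \<nu> by (intro member_le_sum[where f = "\<lambda>B. \<mu> {} * \<nu> B * of_bool (4 * sqrt (card J) \<le> \<bar>ip J (sgv {}) (sgv B)\<bar>)"]) auto
    also have "\<dots> \<le> (\<Sum>A\<in>Pow J. \<Sum>B\<in>Pow J. \<mu> A * \<nu> B * of_bool (4 * sqrt (card J) \<le> \<bar>ip J (sgv A) (sgv B)\<bar>))"
      using J \<mu> \<nu> by (intro member_le_sum[where f = "\<lambda>A. \<Sum>B\<in>Pow J. \<mu> A * \<nu> B * of_bool (4 * sqrt (card J) \<le> \<bar>ip J (sgv A) (sgv B)\<bar>)"]) (auto intro!: sum_nonneg)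
    finally show ?thesis .
  qed
  have pos: "0 < \<sigma> ^ 4" "0 < \<beta>" using \<sigma> \<beta>0 by (auto simp: \<beta>_def)
  show ?thesis
    by (intro exI[of _ "\<sigma> ^ 4"] exI[of _ \<beta>] conjI allI impI pos) (rule main)
qed

section \<open>Product kernels and the information needed for gap orthogonality\<close>

lemma deficit_nonneg:
  assumes J: "finite J" and \<mu>0: "\<And>A. A \<in> Pow J \<Longrightarrow> 0 \<le> \<mu> A" and \<mu>1: "(\<Sum>A\<in>Pow J. \<mu> A) = 1"
  shows "0 \<le> deficit J \<mu>"
proof -
  have "(\<Sum>A\<in>Pow J. \<mu> A * ln ((1 / 2 ^ card J) / (1 / 2 ^ card J)) + (\<mu> A - 1 / 2 ^ card J)) \<le>
    (\<Sum>A\<in>Pow J. \<mu> A * ln (\<mu> A / (1 / 2 ^ card J)))"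
    by (intro sum_mono gibbs_pointwise \<mu>0) auto
  then show ?thesis using J \<mu>1 by (simp add: deficit_def sum_subtractf card_Pow mult.commute)
qed

text \<open>With \<open>f\<close> a likelihood, \<mu> is the posterior of a uniform vector. Weighted
  by the mean likelihood, the posterior deficit is exactly the contribution of the observed output
  to the information.\<close>

lemma deficit_density:
  assumes J: "finite J" and f0: "\<And>A. A \<in> Pow J \<Longrightarrow> 0 \<le> f A" and F: "0 < avg (Pow J) f"
  defines "\<mu> \<equiv> (\<lambda>A. f A / (2 ^ card J * avg (Pow J) f))"
  shows "\<forall>A\<in>Pow J. 0 \<le> \<mu> A" "(\<Sum>A\<in>Pow J. \<mu> A) = 1"
    "avg (Pow J) f * deficit J \<mu> = avg (Pow J) (\<lambda>A. f A * ln (f A / avg (Pow J) f))"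
proof -
  define m where "m = avg (Pow J) f"
  have m: "0 < m" "(\<Sum>A\<in>Pow J. f A) = 2 ^ card J * m" using F J by (auto simp: m_def avg_def card_Pow)
  show "\<forall>A\<in>Pow J. 0 \<le> \<mu> A" using f0 m by (simp add: \<mu>_def m_def)
  show 1: "(\<Sum>A\<in>Pow J. \<mu> A) = 1"
    unfolding \<mu>_def m_def[symmetric] sum_divide_distrib[symmetric] using m by simp
  have "2 ^ card J * \<mu> A = f A / m" for A by (simp add: \<mu>_def m_def)
  then have "deficit J \<mu> = (\<Sum>A\<in>Pow J. f A / (2 ^ card J * m) * ln (f A / m))"
    unfolding deficit_def 1 by (simp add: \<mu>_def m_def)
  also have "\<dots> = (\<Sum>A\<in>Pow J. f A * ln (f A / m)) / (2 ^ card J * m)"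
    by (simp add: sum_divide_distrib)
  finally show "avg (Pow J) f * deficit J \<mu> = avg (Pow J) (\<lambda>A. f A * ln (f A / avg (Pow J) f))"
    unfolding m_def[symmetric] using m J by (simp add: avg_def card_Pow)
qed

definition ort_error :: "'a set \<Rightarrow> 't set \<Rightarrow> ('t \<Rightarrow> bool) \<Rightarrow> ('a set \<times> 'a set \<Rightarrow> 't \<Rightarrow> real) \<Rightarrow> real" where
  "ort_error J T out p = avg (Pow J \<times> Pow J) (\<lambda>(A, B). \<Sum>t\<in>T. p (A, B) t *
     of_bool ((4 * sqrt (card J) \<le> \<bar>ip J (sgv A) (sgv B)\<bar> \<and> \<not> out t) \<or> (\<bar>ip J (sgv A) (sgv B)\<bar> \<le> 2 * sqrt (card J) \<and> out t)))"

text \<open>Given the transcript, the posterior of the two vectors is a product, so its divergence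
  from uniform is the sum of the divergences of the factors.\<close>

lemma minfo_product_kernel:
  assumes J: "finite J" and T: "finite T"
    and f0: "\<And>t A. t \<in> T \<Longrightarrow> A \<in> Pow J \<Longrightarrow> 0 \<le> f t A" and g0: "\<And>t B. t \<in> T \<Longrightarrow> B \<in> Pow J \<Longrightarrow> 0 \<le> g t B"
  shows "minfo (Pow J \<times> Pow J) T (\<lambda>(A, B) t. f t A * g t B) =
    (\<Sum>t\<in>T. avg (Pow J) (g t) * avg (Pow J) (\<lambda>A. f t A * ln (f t A / avg (Pow J) (f t))) +
       avg (Pow J) (f t) * avg (Pow J) (\<lambda>B. g t B * ln (g t B / avg (Pow J) (g t))))"
proof -
  define F G where "F t = avg (Pow J) (f t)" and "G t = avg (Pow J) (g t)" for t
  have fg: "avg (Pow J) (\<lambda>A. avg (Pow J) (\<lambda>B. f t A * g t B)) = F t * G t" for t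
    unfolding F_def G_def by (simp add: avg_cmult avg_multc)
  have "minfo (Pow J \<times> Pow J) T (\<lambda>(A, B) t. f t A * g t B) =
     (\<Sum>t\<in>T. avg (Pow J) (\<lambda>A. avg (Pow J) (\<lambda>B. f t A * g t B * ln (f t A * g t B / (F t * G t)))))"
    unfolding minfo_def avg_Times by (simp add: avg_sum fg)
  also have "\<dots> = (\<Sum>t\<in>T. avg (Pow J) (\<lambda>A. avg (Pow J) (\<lambda>B. f t A * ln (f t A / F t) * g t B + f t A * (g t B * ln (g t B / G t)))))"
  proof (intro sum.cong refl avg_cong)
    fix t A B assume t: "t \<in> T" and A: "A \<in> Pow J" and B: "B \<in> Pow J"
    show "f t A * g t B * ln (f t A * g t B / (F t * G t)) = f t A * ln (f t A / F t) * g t B + f t A * (g t B * ln (g t B / G t))"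
    proof (cases "f t A = 0 \<or> g t B = 0")
      case False
      then have p: "0 < f t A" "0 < g t B" using f0[OF t A] g0[OF t B] by auto
      have "0 < F t" "0 < G t" unfolding F_def G_def
        using avg_pos[of "Pow J" A "f t"] avg_pos[of "Pow J" B "g t"] J A B p f0[OF t] g0[OF t] by auto
      then have "ln (f t A * g t B / (F t * G t)) = ln (f t A / F t) + ln (g t B / G t)"
        using p by (simp add: ln_div ln_mult_pos)
      then show ?thesis by (simp add: algebra_simps)
    qed auto
  qed
  also have "\<dots> = (\<Sum>t\<in>T. G t * avg (Pow J) (\<lambda>A. f t A * ln (f t A / F t)) + F t * avg (Pow J) (\<lambda>B. g t B * ln (g t B / G t)))"
    unfolding avg_add avg_cmult avg_multc F_def G_def by (simp add: mult.commute)
  finally show ?thesis by (simp add: F_def G_def)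
qed

text \<open>A transcript either has a posterior of large deficit and pays with information, or a
  large inner product has posterior probability at least \<beta> and it pays with error if it
  answers 0. A small inner product has probability at least 3/4, and a transcript answering 1 pays
  for that event with error.\<close>

lemma gap_orthogonality_info:
  "\<exists>c>0. \<exists>C>0. \<forall>(J :: 'a set) (T :: 't set) f g out. finite J \<longrightarrow> 16 \<le> card J \<longrightarrow> finite T \<longrightarrow>
     (\<forall>t\<in>T. \<forall>A\<in>Pow J. 0 \<le> f t A) \<longrightarrow> (\<forall>t\<in>T. \<forall>A\<in>Pow J. 0 \<le> g t A) \<longrightarrow>
     (\<forall>A\<in>Pow J. \<forall>B\<in>Pow J. (\<Sum>t\<in>T. f t A * g t B) = 1) \<longrightarrow>
     real (card J) * (c - C * ort_error J T out (\<lambda>(A, B) t. f t A * g t B)) \<le> minfo (Pow J \<times> Pow J) T (\<lambda>(A, B) t. f t A * g t B)"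
proof -
  obtain c \<beta> where c: "0 < c" and \<beta>: "0 < \<beta>"
    and anti: "\<forall>(J :: 'a set) \<mu> \<nu>. finite J \<longrightarrow> 16 \<le> card J \<longrightarrow>
     (\<forall>A\<in>Pow J. 0 \<le> \<mu> A) \<longrightarrow> (\<Sum>A\<in>Pow J. \<mu> A) = 1 \<longrightarrow> (\<forall>A\<in>Pow J. 0 \<le> \<nu> A) \<longrightarrow> (\<Sum>A\<in>Pow J. \<nu> A) = 1 \<longrightarrow>
     deficit J \<mu> \<le> c * real (card J) \<longrightarrow> deficit J \<nu> \<le> c * real (card J) \<longrightarrow>
     \<beta> \<le> (\<Sum>A\<in>Pow J. \<Sum>B\<in>Pow J. \<mu> A * \<nu> B * of_bool (4 * sqrt (card J) \<le> \<bar>ip J (sgv A) (sgv B)\<bar>))"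
    using anticoncentration_uniform by (elim exE conjE)
  have main: "real (card J) * (c * (3 / 4) - c * (1 + 1 / \<beta>) * ort_error J T out (\<lambda>(A, B) t. f t A * g t B)) \<le> minfo (Pow J \<times> Pow J) T (\<lambda>(A, B) t. f t A * g t B)"
    if J: "finite J" "16 \<le> card J" and T: "finite T"
      and f0: "\<forall>t\<in>T. \<forall>A\<in>Pow J. 0 \<le> f t A" and g0: "\<forall>t\<in>T. \<forall>A\<in>Pow J. 0 \<le> g t A"
      and one: "\<forall>A\<in>Pow J. \<forall>B\<in>Pow J. (\<Sum>t\<in>T. f t A * g t B) = 1"
    for J :: "'a set" and T :: "'t set" and f g out
  proof -
    define N where "N = real (card J)"
    have N: "16 \<le> N" using J by (simp add: N_def)
    define Z where "Z A B = \<bar>ip J (sgv A) (sgv B)\<bar>" for A B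
    define AA where "AA h = avg (Pow J) (\<lambda>A. avg (Pow J) (\<lambda>B. h A B))" for h :: "'a set \<Rightarrow> 'a set \<Rightarrow> real"
    define F G where "F t = avg (Pow J) (f t)" and "G t = avg (Pow J) (g t)" for t
    have F0: "0 \<le> F t" and G0: "0 \<le> G t" if "t \<in> T" for t
      using that f0 g0 by (auto simp: F_def G_def intro!: avg_nonneg)
    have AAfg: "AA (\<lambda>A B. f t A * g t B) = F t * G t" for t
      unfolding AA_def F_def G_def by (simp add: avg_cmult avg_multc)
    define e1 where "e1 t = AA (\<lambda>A B. f t A * g t B * of_bool (4 * sqrt N \<le> Z A B))" for t
    define e2 where "e2 t = AA (\<lambda>A B. f t A * g t B * of_bool (Z A B \<le> 2 * sqrt N))" for t
    define I where "I t = G t * avg (Pow J) (\<lambda>A. f t A * ln (f t A / F t)) + F t * avg (Pow J) (\<lambda>B. g t B * ln (g t B / G t))" for t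
    have e10: "0 \<le> e1 t" and e20: "0 \<le> e2 t" if "t \<in> T" for t
      using that f0 g0 by (auto simp: e1_def e2_def AA_def intro!: avg_nonneg)
    have err: "ort_error J T out (\<lambda>(A, B) t. f t A * g t B) = (\<Sum>t\<in>T. if out t then e2 t else e1 t)"
    proof -
      have "ort_error J T out (\<lambda>(A, B) t. f t A * g t B) = (\<Sum>t\<in>T. AA (\<lambda>A B. f t A * g t B *
         of_bool ((4 * sqrt N \<le> Z A B \<and> \<not> out t) \<or> (Z A B \<le> 2 * sqrt N \<and> out t))))"
        unfolding ort_error_def avg_Times AA_def N_def[symmetric] Z_def[symmetric] by (simp add: avg_sum)
      then show ?thesis by (simp add: e1_def e2_def if_distrib cong: if_cong sum.cong) (intro sum.cong refl, simp add: e1_def e2_def)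
    qed
    have mi: "minfo (Pow J \<times> Pow J) T (\<lambda>(A, B) t. f t A * g t B) = (\<Sum>t\<in>T. I t)"
      unfolding I_def F_def G_def by (rule minfo_product_kernel) (use J T f0 g0 in auto)
    have key: "0 \<le> I t \<and> F t * G t \<le> I t / (c * N) + e1 t / \<beta>" if t: "t \<in> T" for t
    proof (cases "F t = 0 \<or> G t = 0")
      case True
      have "f t A = 0" if "F t = 0" "A \<in> Pow J" for A
        using avg_eq_0_imp[of "Pow J" A "f t"] that J f0 t by (simp add: F_def)
      moreover have "g t A = 0" if "G t = 0" "A \<in> Pow J" for A
        using avg_eq_0_imp[of "Pow J" A "g t"] that J g0 t by (simp add: G_def)
      moreover have "avg (Pow J) (\<lambda>A. f t A * ln (f t A / F t)) = 0" if "F t = 0"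
        using that by (simp add: avg_def)
      moreover have "avg (Pow J) (\<lambda>A. g t A * ln (g t A / G t)) = 0" if "G t = 0"
        using that by (simp add: avg_def)
      ultimately have "I t = 0" using True by (auto simp: I_def)
      then show ?thesis using True e10[OF t] \<beta> by auto
    next
      case False
      then have pos: "0 < F t" "0 < G t" using F0[OF t] G0[OF t] by auto
      define \<mu> where "\<mu> = (\<lambda>A. f t A / (2 ^ card J * F t))"
      define \<nu> where "\<nu> = (\<lambda>A. g t A / (2 ^ card J * G t))"
      have mu: "\<forall>A\<in>Pow J. 0 \<le> \<mu> A" "(\<Sum>A\<in>Pow J. \<mu> A) = 1" "F t * deficit J \<mu> = avg (Pow J) (\<lambda>A. f t A * ln (f t A / F t))"
        unfolding \<mu>_def F_def using deficit_density[of J "f t"] J f0 t pos by (auto simp: F_def)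
      have nu: "\<forall>A\<in>Pow J. 0 \<le> \<nu> A" "(\<Sum>A\<in>Pow J. \<nu> A) = 1" "G t * deficit J \<nu> = avg (Pow J) (\<lambda>A. g t A * ln (g t A / G t))"
        unfolding \<nu>_def G_def using deficit_density[of J "g t"] J g0 t pos by (auto simp: G_def)
      have I: "I t = F t * G t * (deficit J \<mu> + deficit J \<nu>)"
        unfolding I_def mu(3)[symmetric] nu(3)[symmetric] by (simp add: algebra_simps)
      have d0: "0 \<le> deficit J \<mu>" "0 \<le> deficit J \<nu>"
        using deficit_nonneg[of J \<mu>] deficit_nonneg[of J \<nu>] J mu nu by auto
      have I0: "0 \<le> I t" unfolding I using pos d0 by simp
      have cN: "0 < c * N" using c N by simp
      show ?thesis
      proof (cases "deficit J \<mu> \<le> c * N \<and> deficit J \<nu> \<le> c * N")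
        case True
        then have "\<beta> \<le> (\<Sum>A\<in>Pow J. \<Sum>B\<in>Pow J. \<mu> A * \<nu> B * of_bool (4 * sqrt N \<le> Z A B))"
          using anti[rule_format, of J \<mu> \<nu>] J mu nu unfolding N_def Z_def by auto
        also have "\<dots> = (\<Sum>A\<in>Pow J. \<Sum>B\<in>Pow J. f t A * g t B * of_bool (4 * sqrt N \<le> Z A B)) / ((2 ^ card J * F t) * (2 ^ card J * G t))"
          unfolding sum_divide_distrib \<mu>_def \<nu>_def by (intro sum.cong refl) simp
        also have "\<dots> = e1 t / (F t * G t)"
          unfolding e1_def AA_def avg_def using J by (simp add: card_Pow sum_divide_distrib[symmetric])
        finally have "\<beta> \<le> e1 t / (F t * G t)" .
        then have "F t * G t \<le> e1 t / \<beta>" using pos \<beta> by (simp add: field_simps)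
        moreover have "0 \<le> I t / (c * N)" using I0 cN by simp
        ultimately show ?thesis using I0 by linarith
      next
        case False
        then have "c * N \<le> deficit J \<mu> + deficit J \<nu>" using d0 by linarith
        then have "F t * G t * (c * N) \<le> I t" unfolding I using pos by (intro mult_left_mono) auto
        then have "F t * G t \<le> I t / (c * N)" using cN by (simp add: pos_le_divide_eq)
        moreover have "0 \<le> e1 t / \<beta>" using e10[OF t] \<beta> by simp
        ultimately show ?thesis using I0 by linarith
      qed
    qed
    \<comment> \<open>Chebyshev's inequality: the inner product has mean square \<open>N\<close>,
      and the squared threshold is \<open>4 * N\<close>.\<close>
    have low: "3 / 4 \<le> (\<Sum>t\<in>T. e2 t)"
    proof -
      have "(\<Sum>t\<in>T. e2 t) = AA (\<lambda>A B. of_bool (Z A B \<le> 2 * sqrt N))"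
      proof -
        have "(\<Sum>t\<in>T. e2 t) = AA (\<lambda>A B. \<Sum>t\<in>T. f t A * g t B * of_bool (Z A B \<le> 2 * sqrt N))"
          unfolding e2_def AA_def by (simp only: avg_sum)
        also have "\<dots> = AA (\<lambda>A B. of_bool (Z A B \<le> 2 * sqrt N))"
          unfolding AA_def using one by (intro avg_cong refl) (simp add: sum_distrib_right[symmetric])
        finally show ?thesis .
      qed
      also have "\<dots> \<ge> AA (\<lambda>A B. 1 - (ip J (sgv A) (sgv B))\<^sup>2 / (4 * N))"
        unfolding AA_def
      proof (intro avg_mono)
        fix A B
        show "1 - (ip J (sgv A) (sgv B))\<^sup>2 / (4 * N) \<le> of_bool (Z A B \<le> 2 * sqrt N)"
        proof (cases "Z A B \<le> 2 * sqrt N")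
          case False
          then have "(2 * sqrt N)\<^sup>2 \<le> (Z A B)\<^sup>2" using N by (intro power_mono) auto
          then have "4 * N \<le> (ip J (sgv A) (sgv B))\<^sup>2" using N by (simp add: Z_def power_mult_distrib)
          then show ?thesis using N False by simp
        qed (use N in simp)
      qed
      moreover have "AA (\<lambda>A B. 1 - (ip J (sgv A) (sgv B))\<^sup>2 / (4 * N)) = 3 / 4"
      proof -
        have *: "avg (Pow J) (\<lambda>B. 1 - (ip J (sgv A) (sgv B))\<^sup>2 / (4 * N)) = 3 / 4" for A
          using J N by (simp add: avg_diff avg_divide avg_ip_square sgv_norm avg_const Pow_not_empty N_def[symmetric])
        show ?thesis unfolding AA_def * using J by (simp add: avg_const Pow_not_empty)
      qed
      ultimately show ?thesis by simp
    qed
    have e2le: "e2 t \<le> F t * G t" if t: "t \<in> T" for t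
      unfolding e2_def AAfg[symmetric] AA_def
      by (intro avg_mono mult_left_le) (use f0 g0 t in auto)
    have "(\<Sum>t\<in>T. e2 t) \<le> (\<Sum>t\<in>T. I t / (c * N) + (1 + 1 / \<beta>) * (if out t then e2 t else e1 t))"
    proof (rule sum_mono)
      fix t assume t: "t \<in> T"
      have k: "0 \<le> I t / (c * N)" using key[OF t] c N by simp
      show "e2 t \<le> I t / (c * N) + (1 + 1 / \<beta>) * (if out t then e2 t else e1 t)"
      proof (cases "out t")
        case True
        have "0 \<le> e2 t / \<beta>" using e20[OF t] \<beta> by simp
        then show ?thesis using True k by (simp add: distrib_right)
      next
        case False
        then show ?thesis using key[OF t] e2le[OF t] e10[OF t] by (simp add: distrib_right)
      qed
    qed
    also have "\<dots> = (\<Sum>t\<in>T. I t) / (c * N) + (1 + 1 / \<beta>) * (\<Sum>t\<in>T. if out t then e2 t else e1 t)"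
      by (simp only: sum.distrib sum_divide_distrib sum_distrib_left)
    finally have fin: "3 / 4 - (1 + 1 / \<beta>) * ort_error J T out (\<lambda>(A, B) t. f t A * g t B) \<le> (\<Sum>t\<in>T. I t) / (c * N)"
      using low unfolding err[symmetric] by linarith
    have cN: "0 < c * N" using c N by simp
    have "(3 / 4 - (1 + 1 / \<beta>) * ort_error J T out (\<lambda>(A, B) t. f t A * g t B)) * (c * N) \<le> (\<Sum>t\<in>T. I t)"
      using fin pos_le_divide_eq[OF cN] by simp
    then show ?thesis unfolding mi N_def by (simp add: algebra_simps)
  qed
  have pos: "0 < c * (3 / 4)" "0 < c * (1 + 1 / \<beta>)" using c \<beta> by (auto intro!: mult_pos_pos add_pos_pos)
  show ?thesis
    by (intro exI[of _ "c * (3 / 4)"] exI[of _ "c * (1 + 1 / \<beta>)"] conjI allI impI pos) (rule main)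
qed

section \<open>Hellinger distances of product kernels\<close>

lemma sum_permutes_pair:
  fixes w :: "'a \<Rightarrow> 'a \<Rightarrow> real"
  assumes "a \<in> S" "b \<in> S" "c \<in> S" "d \<in> S" "a \<noteq> b" "c \<noteq> d"
  shows "(\<Sum>p | p permutes S. w (p a) (p b)) = (\<Sum>p | p permutes S. w (p c) (p d))"
proof -
  define K where "K a b = (\<Sum>p | p permutes S. w (p a) (p b))" for a b
  \<comment> \<open>Composing with a permutation moves the positions \<open>a\<close>,
    \<open>b\<close>; transpositions connect any two ordered pairs of distinct positions.\<close>
  have comp: "K a b = K (q a) (q b)" if "q permutes S" for q a b
    unfolding K_def using sum_permutations_compose_right[OF that, of "\<lambda>p. w (p a) (p b)"] by simp
  have tr: "K a b = K (Transposition.transpose x y a) (Transposition.transpose x y b)" if "x \<in> S" "y \<in> S" for x y a b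
    by (rule comp) (use that in \<open>simp add: permutes_swap_id\<close>)
  have fst: "K a b = K a' b" if "a \<in> S" "a' \<in> S" "a \<noteq> b" "a' \<noteq> b" for a a' b
    using tr[OF that(1,2), of a b] that by (simp add: Transposition.transpose_def)
  have snd: "K a b = K a b'" if "b \<in> S" "b' \<in> S" "a \<noteq> b" "a \<noteq> b'" for a b b'
    using tr[OF that(1,2), of a b] that by (simp add: Transposition.transpose_def)
  have swap: "K a b = K b a" using tr[OF assms(1,2), of a b] by (simp add: Transposition.transpose_def)
  have "K a b = K c d"
  proof (cases "c = b")
    case False
    then show ?thesis using fst[of a c b] snd[of b d c] assms by auto
  next
    case True
    show ?thesis
    proof (cases "d = a")
      case True
      then show ?thesis using swap \<open>c = b\<close> by simp
    next
      case False
      then show ?thesis using snd[of b d a] fst[of a c d] assms True by auto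
    qed
  qed
  then show ?thesis by (simp add: K_def)
qed

text \<open>Average over all permutations: every ordered pair of distinct values is equally likely
  to fill the positions \<open>2 * i\<close>, \<open>2 * i + 1\<close>, so the mean weight is
  \<open>s\<close> times the mean of \<open>w\<close> over such pairs, and some permutation does not
  exceed it.\<close>

lemma light_perfect_matching:
  fixes w :: "nat \<Rightarrow> nat \<Rightarrow> real"
  assumes "0 < s"
  shows "\<exists>p. p permutes {..<2 * s} \<and>
    (\<Sum>i<s. w (p (2 * i)) (p (2 * i + 1))) \<le> (\<Sum>a<2 * s. \<Sum>b\<in>{..<2 * s} - {a}. w a b) / (2 * (2 * real s - 1))"
proof (rule ccontr)
  define t where "t = 2 * s"
  define W where "W = (\<Sum>a<t. \<Sum>b\<in>{..<t} - {a}. w a b)"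
  define P where "P = {p. p permutes {..<t}}"
  define k where "k = (\<Sum>p\<in>P. w (p 0) (p 1))"
  assume "\<not> ?thesis"
  then have neg: "W / (2 * (2 * real s - 1)) < (\<Sum>i<s. w (p (2 * i)) (p (2 * i + 1)))" if "p \<in> P" for p
    using that by (auto simp: W_def P_def t_def not_le)
  have P: "finite P" "P \<noteq> {}" "real (card P) > 0"
  proof -
    show f: "finite P" unfolding P_def by (rule finite_permutations) simp
    have "id \<in> P" by (simp add: P_def permutes_id)
    then show "P \<noteq> {}" by auto
    then show "real (card P) > 0" using f by (simp add: card_gt_0_iff)
  qed
  have t2: "2 \<le> t" using assms by (simp add: t_def)
  have pair: "(\<Sum>p\<in>P. w (p a) (p b)) = k" if "a < t" "b < t" "a \<noteq> b" for a b
    unfolding k_def P_def by (rule sum_permutes_pair) (use that t2 in auto)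
  have "real t * (real t - 1) * k = (\<Sum>a<t. \<Sum>b\<in>{..<t} - {a}. k)" using t2 by (simp add: of_nat_diff)
  also have "\<dots> = (\<Sum>a<t. \<Sum>b\<in>{..<t} - {a}. \<Sum>p\<in>P. w (p a) (p b))"
    by (intro sum.cong refl) (use pair in auto)
  also have "\<dots> = (\<Sum>p\<in>P. \<Sum>a<t. \<Sum>b\<in>{..<t} - {a}. w (p a) (p b))"
    by (rule trans[OF sum.cong[OF refl sum.swap] sum.swap])
  also have "\<dots> = (\<Sum>p\<in>P. W)"
  proof (rule sum.cong[OF refl])
    fix p assume "p \<in> P"
    then have p: "p permutes {..<t}" by (simp add: P_def)
    have "W = (\<Sum>a<t. \<Sum>b\<in>{..<t} - {p a}. w (p a) b)"
      unfolding W_def by (rule sum.permute[OF p, unfolded o_def])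
    also have "\<dots> = (\<Sum>a<t. \<Sum>b\<in>{..<t} - {a}. w (p a) (p b))"
    proof (rule sum.cong[OF refl])
      fix a
      have "bij_betw p ({..<t} - {a}) ({..<t} - {p a})"
      proof -
        have "p ` ({..<t} - {a}) = {..<t} - {p a}"
          unfolding image_set_diff[OF permutes_inj[OF p]] permutes_image[OF p] by simp
        then show ?thesis using inj_on_subset[OF permutes_inj[OF p]] by (simp add: bij_betw_def)
      qed
      then show "(\<Sum>b\<in>{..<t} - {p a}. w (p a) b) = (\<Sum>b\<in>{..<t} - {a}. w (p a) (p b))"
        by (rule sum.reindex_bij_betw[symmetric])
    qed
    finally show "(\<Sum>a<t. \<Sum>b\<in>{..<t} - {a}. w (p a) (p b)) = W" by simp
  qed
  finally have kW: "real t * (real t - 1) * k = card P * W" by simp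
  have "card P * (W / (2 * (2 * real s - 1))) = (\<Sum>p\<in>P. W / (2 * (2 * real s - 1)))" by simp
  also have "\<dots> < (\<Sum>p\<in>P. \<Sum>i<s. w (p (2 * i)) (p (2 * i + 1)))"
    using P neg by (intro sum_strict_mono) auto
  also have "\<dots> = (\<Sum>i<s. \<Sum>p\<in>P. w (p (2 * i)) (p (2 * i + 1)))" by (rule sum.swap)
  also have "\<dots> = (\<Sum>i<s. k)" by (intro sum.cong refl pair) (auto simp: t_def)
  also have "\<dots> = real s * k" by simp
  finally have lt: "card P * (W / (2 * (2 * real s - 1))) < real s * k" .
  have "card P * W = 2 * (2 * real s - 1) * (real s * k)"
    unfolding kW[symmetric] by (simp add: t_def algebra_simps)
  then have "card P * (W / (2 * (2 * real s - 1))) = real s * k"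
    using assms by (simp add: field_simps)
  then show False using lt by simp
qed

text \<open>Product over the levels of the loss \<open>t / (t - 1)\<close> of a matching of
  \<open>t = 2 ^ b\<close> parts. It stays bounded, which keeps the final constant independent of
  the number of sites.\<close>

fun tree_const :: "nat \<Rightarrow> real" where
  "tree_const 0 = 1"
| "tree_const (Suc a) = tree_const a * (2 ^ Suc a / (2 ^ Suc a - 1))"

text \<open>For \<open>a \<ge> 1\<close> the induction carries the sharper bound
  \<open>4 * (1 - 1 / 2 ^ a)\<close>, which absorbs the next factor because
  \<open>1 - 2 * y \<le> (1 - y)\<^sup>2\<close>.\<close>

lemma tree_const_le: "tree_const a \<le> 4" and tree_const_nonneg: "0 \<le> tree_const a"
proof -
  have n: "0 \<le> tree_const a" for a
    by (induction a) (auto intro!: mult_nonneg_nonneg divide_nonneg_nonneg one_le_power simp: algebra_simps simp del: power_Suc)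
  have s: "tree_const (Suc a) \<le> 4 * (1 - 1 / 2 ^ Suc a)" for a
  proof (induction a)
    case (Suc a)
    define y :: real where "y = 1 / 2 ^ Suc (Suc a)"
    have "1 < (2 :: real) ^ Suc (Suc a)" by (rule one_less_power) auto
    then have y: "0 < y" "y < 1" unfolding y_def by (auto simp del: power_Suc)
    have e: "2 ^ Suc (Suc a) / (2 ^ Suc (Suc a) - 1 :: real) = 1 / (1 - y)"
    proof -
      have "(2 :: real) ^ Suc (Suc a) = 1 / y" by (simp add: y_def)
      then show ?thesis using y by (simp only:) (simp add: field_simps)
    qed
    have "tree_const (Suc (Suc a)) = tree_const (Suc a) * (1 / (1 - y))"
      unfolding tree_const.simps(2)[of "Suc a"] e ..
    also have "\<dots> \<le> 4 * (1 - 1 / 2 ^ Suc a) * (1 / (1 - y))"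
      using y by (intro mult_right_mono Suc) auto
    also have "1 / 2 ^ Suc a = 2 * y" by (simp add: y_def)
    also have "4 * (1 - 2 * y) * (1 / (1 - y)) \<le> 4 * (1 - y)"
    proof -
      have "4 * (1 - 2 * y) \<le> 4 * (1 - y) * (1 - y)" by (simp add: algebra_simps)
      then show ?thesis using y by (simp add: divide_le_eq)
    qed
    finally show ?case by (simp only: y_def)
  qed simp
  show "0 \<le> tree_const a" by (rule n)
  show "tree_const a \<le> 4"
  proof (cases a)
    case (Suc b)
    have "4 * (1 - 1 / 2 ^ Suc b) \<le> (4::real)" by simp
    with s[of b] show ?thesis unfolding Suc by (rule order_trans)
  qed simp
qed

text \<open>The parts are joined in pairs along a light matching, and the induction hypothesis is
  applied to the half as many unions. By the assumption on pairs, the unions of \<open>t\<close>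
  parts along the matching weigh at most \<open>t / (t - 1)\<close> times the sum over the
  parts.\<close>

lemma tree_inequality:
  fixes H :: "'a set \<Rightarrow> real" and A :: "nat \<Rightarrow> 'a set"
  assumes pair: "\<And>t A. (\<And>p. p < t \<Longrightarrow> A p \<subseteq> I) \<Longrightarrow> disjoint_family_on A {..<t} \<Longrightarrow>
      (\<Sum>p<t. \<Sum>q\<in>{..<t} - {p}. H (A p \<union> A q)) \<le> 2 * real t * (\<Sum>p<t. H (A p))"
    and "\<And>p. p < 2 ^ a \<Longrightarrow> A p \<subseteq> I" "disjoint_family_on A {..<2 ^ a}"
  shows "H (\<Union>p<2 ^ a. A p) \<le> tree_const a * (\<Sum>p<2 ^ a. H (A p))"
  using assms(2,3)
proof (induction a arbitrary: A)
  case 0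
  have e: "{..<(2::nat) ^ 0} = {0}" by auto
  show ?case unfolding e by simp
next
  case (Suc a)
  define s :: nat where "s = 2 ^ a"
  have t: "2 ^ Suc a = 2 * s" by (simp add: s_def)
  have s0: "0 < s" by (simp add: s_def)
  have s1: "(1::real) \<le> real s" using s0 by linarith
  obtain \<pi> where \<pi>: "\<pi> permutes {..<2 * s}" and
    w: "(\<Sum>i<s. H (A (\<pi> (2 * i)) \<union> A (\<pi> (2 * i + 1)))) \<le> (\<Sum>p<2 * s. \<Sum>q\<in>{..<2 * s} - {p}. H (A p \<union> A q)) / (2 * (2 * real s - 1))"
    using light_perfect_matching[OF s0, of "\<lambda>p q. H (A p \<union> A q)"] by auto
  define B where "B i = A (\<pi> (2 * i)) \<union> A (\<pi> (2 * i + 1))" for i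
  have \<pi>lt: "\<pi> x < 2 * s" if "x < 2 * s" for x using permutes_in_image[OF \<pi>, of x] that by simp
  have AI: "A p \<subseteq> I" if "p < 2 * s" for p using Suc.prems(1) that by (simp add: s_def)
  have dA: "A p \<inter> A q = {}" if "p < 2 * s" "q < 2 * s" "p \<noteq> q" for p q
    using Suc.prems(2) that unfolding disjoint_family_on_def t by auto
  have dB: "disjoint_family_on B {..<2 ^ a}"
  proof (unfold disjoint_family_on_def, intro ballI impI)
    fix i j :: nat assume ij: "i \<in> {..<2 ^ a}" "j \<in> {..<2 ^ a}" "i \<noteq> j"
    have lt: "2 * i + 1 < 2 * s" "2 * j + 1 < 2 * s" using ij by (auto simp: s_def)
    have d: "A (\<pi> x) \<inter> A (\<pi> y) = {}" if "x < 2 * s" "y < 2 * s" "x \<noteq> y" for x y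
      using permutes_inj[OF \<pi>] that by (intro dA \<pi>lt) (auto simp: inj_eq)
    have ne: "2 * i \<noteq> 2 * j" "2 * i \<noteq> 2 * j + 1" "2 * i + 1 \<noteq> 2 * j" "2 * i + 1 \<noteq> 2 * j + 1"
      using ij(3) by presburger+
    have lt': "2 * i < 2 * s" "2 * j < 2 * s" using lt by auto
    show "B i \<inter> B j = {}"
      unfolding B_def Int_Un_distrib Int_Un_distrib2
      using d[OF lt' ne(1)] d[OF lt'(1) lt(2) ne(2)] d[OF lt(1) lt'(2) ne(3)] d[OF lt ne(4)] by simp
  qed
  have un: "(\<Union>p<2 ^ Suc a. A p) = (\<Union>i<2 ^ a. B i)"
  proof -
    have "(\<Union>p<2 * s. A p) = (\<Union>p\<in>\<pi> ` {..<2 * s}. A p)" using permutes_image[OF \<pi>] by simp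
    also have "\<dots> = (\<Union>x<2 * s. A (\<pi> x))" by simp
    also have "\<dots> = (\<Union>i<s. B i)"
    proof (intro equalityI subsetI)
      fix z assume "z \<in> (\<Union>x<2 * s. A (\<pi> x))"
      then obtain x where x: "x < 2 * s" "z \<in> A (\<pi> x)" by auto
      have "x = 2 * (x div 2) \<or> x = 2 * (x div 2) + 1" "x div 2 < s" using x by auto
      then show "z \<in> (\<Union>i<s. B i)" using x unfolding B_def by (metis UN_I UnCI lessThan_iff)
    next
      fix z assume "z \<in> (\<Union>i<s. B i)"
      then obtain i where i: "i < s" "z \<in> B i" by auto
      have "2 * i < 2 * s" "2 * i + 1 < 2 * s" using i by auto
      then show "z \<in> (\<Union>x<2 * s. A (\<pi> x))" using i unfolding B_def by (metis UN_I UnE lessThan_iff)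
    qed
    finally show ?thesis by (simp add: s_def)
  qed
  have "H (\<Union>p<2 ^ Suc a. A p) \<le> tree_const a * (\<Sum>i<2 ^ a. H (B i))"
    unfolding un
  proof (rule Suc.IH[OF _ dB])
    fix i :: nat assume "i < 2 ^ a"
    then have "2 * i < 2 * s" "2 * i + 1 < 2 * s" by (auto simp: s_def)
    then show "B i \<subseteq> I" unfolding B_def using AI \<pi>lt by (simp del: One_nat_def)
  qed
  also have "(\<Sum>i<2 ^ a. H (B i)) \<le> (2 ^ Suc a / (2 ^ Suc a - 1)) * (\<Sum>p<2 ^ Suc a. H (A p))"
  proof -
    have "(\<Sum>i<2 ^ a. H (B i)) \<le> (\<Sum>p<2 * s. \<Sum>q\<in>{..<2 * s} - {p}. H (A p \<union> A q)) / (2 * (2 * real s - 1))"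
      using w by (simp add: B_def s_def)
    also have "\<dots> \<le> (2 * real (2 * s) * (\<Sum>p<2 * s. H (A p))) / (2 * (2 * real s - 1))"
    proof (rule divide_right_mono)
      show "(\<Sum>p<2 * s. \<Sum>q\<in>{..<2 * s} - {p}. H (A p \<union> A q)) \<le> 2 * real (2 * s) * (\<Sum>p<2 * s. H (A p))"
        by (rule pair) (use AI dA in \<open>auto simp: disjoint_family_on_def\<close>)
    qed (use s1 in simp)
    also have "\<dots> = (2 * real s / (2 * real s - 1)) * (\<Sum>p<2 * s. H (A p))"
      using s1 by (simp add: field_simps)
    finally show ?thesis unfolding t by (simp add: s_def)
  qed
  finally show ?case using tree_const_nonneg[of a] by (simp add: mult_left_mono mult.assoc)
qed

text \<open>Around any centre \<open>y\<close>, the double sum is \<open>2 * t\<close> times the sum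
  of squares minus twice the square of the sum. Bounding each difference separately would give about
  \<open>4 * t\<close>, too much to be iterated over the levels of the tree.\<close>

lemma sum_sq_diff_pairs:
  fixes x :: "nat \<Rightarrow> real"
  shows "(\<Sum>p<t. \<Sum>q\<in>{..<t} - {p}. (x p - x q)\<^sup>2) \<le> 2 * real t * (\<Sum>p<t. (x p - y)\<^sup>2)"
proof -
  define z where "z p = x p - y" for p
  have "(\<Sum>p<t. \<Sum>q\<in>{..<t} - {p}. (x p - x q)\<^sup>2) = (\<Sum>p<t. \<Sum>q<t. (z p - z q)\<^sup>2)"
    by (intro sum.cong refl sum.mono_neutral_cong_left) (auto simp: z_def)
  also have "\<dots> = (\<Sum>p<t. \<Sum>q<t. (z p)\<^sup>2 + (z q)\<^sup>2 - 2 * (z p * z q))"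
    by (intro sum.cong refl) (simp add: power2_eq_square algebra_simps)
  also have "\<dots> = 2 * real t * (\<Sum>p<t. (z p)\<^sup>2) - 2 * (\<Sum>p<t. z p)\<^sup>2"
  proof -
    have "(\<Sum>p<t. z p)\<^sup>2 = (\<Sum>p<t. \<Sum>q<t. z p * z q)" by (simp add: power2_eq_square sum_product)
    then show ?thesis by (simp add: sum.distrib sum_subtractf sum_distrib_left mult.assoc)
  qed
  finally show ?thesis by (simp add: z_def)
qed

text \<open>Cut and paste: for disjoint \<open>c\<close>, \<open>d\<close> the product
  \<open>R c t * R d t\<close> equals \<open>R {} t * R (c \<union> d) t\<close>, and
  \<open>hdist\<close> of probability vectors depends only on such products. So the distance from
  \<open>R {}\<close> to a union is the distance between \<open>R c\<close> and \<open>R d\<close>,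
  and expanding the latter around the common base point \<open>R {}\<close> gives the inequality for
  pairs.\<close>

lemma hdist_product_family:
  fixes q :: "'i \<Rightarrow> 't \<Rightarrow> bool \<Rightarrow> real"
  assumes I: "finite I" and T: "finite T" and q0: "\<And>i t b. i \<in> I \<Longrightarrow> t \<in> T \<Longrightarrow> 0 \<le> q i t b"
    and R: "\<And>c t. c \<subseteq> I \<Longrightarrow> t \<in> T \<Longrightarrow> R c t = (\<Prod>i\<in>I. q i t (i \<in> c))"
    and R1: "\<And>c. c \<subseteq> I \<Longrightarrow> (\<Sum>t\<in>T. R c t) = 1"
    and F: "F \<subseteq> I" "card F = 2 ^ a"
  shows "hdist T (R {}) (R F) \<le> 4 * (\<Sum>i\<in>F. hdist T (R {}) (R {i}))"
proof -
  define H where "H c = hdist T (R {}) (R c)" for c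
  have R0: "0 \<le> R c t" if "c \<subseteq> I" "t \<in> T" for c t
    using that R q0 by (auto intro!: prod_nonneg)
  have expand: "hdist T (R c) (R d) = 2 - 2 * (\<Sum>t\<in>T. sqrt (R c t * R d t))" if "c \<subseteq> I" "d \<subseteq> I" for c d
  proof -
    have "hdist T (R c) (R d) = (\<Sum>t\<in>T. R c t + R d t - 2 * sqrt (R c t * R d t))"
      unfolding hdist_def by (intro sum.cong refl) (use R0 that in \<open>auto simp: power2_diff real_sqrt_mult\<close>)
    then show ?thesis using R1 that by (simp add: sum.distrib sum_subtractf sum_distrib_left)
  qed
  have cut: "hdist T (R c) (R d) = H (c \<union> d)" if cd: "c \<subseteq> I" "d \<subseteq> I" "c \<inter> d = {}" for c d
  proof -
    have "R c t * R d t = R {} t * R (c \<union> d) t" if "t \<in> T" for t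
    proof -
      have "q i t (i \<in> c) * q i t (i \<in> d) = q i t (i \<in> {}) * q i t (i \<in> c \<union> d)" for i
        using cd(3) by (cases "i \<in> c"; cases "i \<in> d") auto
      then show ?thesis using cd that by (simp only: R prod.distrib[symmetric] empty_subsetI Un_subset_iff)
    qed
    then show ?thesis unfolding H_def using cd by (simp add: expand)
  qed
  have pair: "(\<Sum>p<t. \<Sum>q\<in>{..<t} - {p}. H (A p \<union> A q)) \<le> 2 * real t * (\<Sum>p<t. H (A p))"
    if A: "\<And>p. p < t \<Longrightarrow> A p \<subseteq> I" "disjoint_family_on A {..<t}" for t A
  proof -
    have "(\<Sum>p<t. \<Sum>q\<in>{..<t} - {p}. H (A p \<union> A q)) = (\<Sum>p<t. \<Sum>q\<in>{..<t} - {p}. hdist T (R (A p)) (R (A q)))"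
      by (intro sum.cong refl cut[symmetric]) (use A in \<open>auto simp: disjoint_family_on_def\<close>)
    also have "\<dots> = (\<Sum>x\<in>T. \<Sum>p<t. \<Sum>q\<in>{..<t} - {p}. (sqrt (R (A p) x) - sqrt (R (A q) x))\<^sup>2)"
      unfolding hdist_def by (rule trans[OF sum.cong[OF refl sum.swap] sum.swap])
    also have "\<dots> \<le> (\<Sum>x\<in>T. 2 * real t * (\<Sum>p<t. (sqrt (R (A p) x) - sqrt (R {} x))\<^sup>2))"
      by (intro sum_mono sum_sq_diff_pairs)
    also have "\<dots> = 2 * real t * (\<Sum>p<t. H (A p))"
      unfolding H_def hdist_def sum_distrib_left[symmetric] by (subst sum.swap) (simp add: power2_commute)
    finally show ?thesis .
  qed
  have "finite F" using F I finite_subset by auto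
  then obtain e where e: "bij_betw e {..<(2::nat) ^ a} F"
    using F(2) ex_bij_betw_nat_finite[of F] by (metis atLeast0LessThan)
  have "H (\<Union>p<2 ^ a. {e p}) \<le> tree_const a * (\<Sum>p<2 ^ a. H {e p})"
  proof (rule tree_inequality[of I H, OF pair])
    show "{e p} \<subseteq> I" if "p < 2 ^ a" for p using e F that by (auto simp: bij_betw_def)
    show "disjoint_family_on (\<lambda>p. {e p}) {..<2 ^ a}"
      using e by (auto simp: bij_betw_def disjoint_family_on_def inj_on_def)
  qed
  also have "(\<Union>p<2 ^ a. {e p}) = F" using e by (auto simp: bij_betw_def)
  also have "(\<Sum>p<2 ^ a. H {e p}) = (\<Sum>i\<in>F. H {i})" using e by (rule sum.reindex_bij_betw)
  also have "tree_const a * (\<Sum>i\<in>F. H {i}) \<le> 4 * (\<Sum>i\<in>F. H {i})"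
    by (intro mult_right_mono tree_const_le sum_nonneg) (simp add: H_def hdist_nonneg)
  finally show ?thesis by (simp add: H_def)
qed

text \<open>A difference of squares of roots factorises as
  \<open>\<bar>a - b\<bar> * (a + b)\<close>; the Cauchy-Schwarz inequality is linearised with
  \<tau>, so that averages of \<open>hdist\<close> can be inserted.\<close>

lemma l1_le_hdist:
  fixes p q :: "'t \<Rightarrow> real"
  assumes "finite T" "\<And>t. t \<in> T \<Longrightarrow> 0 \<le> p t" "\<And>t. t \<in> T \<Longrightarrow> 0 \<le> q t"
    "(\<Sum>t\<in>T. p t) = 1" "(\<Sum>t\<in>T. q t) = 1" "0 < \<tau>"
  shows "(\<Sum>t\<in>T. \<bar>p t - q t\<bar>) \<le> \<tau> + hdist T p q / \<tau>"
proof -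
  have "(\<Sum>t\<in>T. \<bar>p t - q t\<bar>) \<le> (\<Sum>t\<in>T. (sqrt (p t) - sqrt (q t))\<^sup>2 / \<tau> + \<tau> / 2 * (p t + q t))"
  proof (rule sum_mono)
    fix t assume t: "t \<in> T"
    define a b where "a = sqrt (p t)" and "b = sqrt (q t)"
    have ab: "p t = a\<^sup>2" "q t = b\<^sup>2" "0 \<le> a" "0 \<le> b" using assms t by (auto simp: a_def b_def)
    have 1: "\<bar>p t - q t\<bar> = \<bar>a - b\<bar> * (a + b)"
    proof -
      have "p t - q t = (a - b) * (a + b)" unfolding ab by (simp add: power2_eq_square algebra_simps)
      then show ?thesis using ab by (simp add: abs_mult)
    qed
    have 2: "\<tau> * (\<bar>a - b\<bar> * (a + b)) \<le> (a - b)\<^sup>2 + \<tau>\<^sup>2 / 4 * (a + b)\<^sup>2"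
    proof -
      have "0 \<le> (\<bar>a - b\<bar> - \<tau> / 2 * (a + b))\<^sup>2" by simp
      also have "\<dots> = \<bar>a - b\<bar>\<^sup>2 - \<tau> * (\<bar>a - b\<bar> * (a + b)) + \<tau>\<^sup>2 / 4 * (a + b)\<^sup>2"
        by (simp add: power2_diff power2_eq_square algebra_simps)
      finally show ?thesis by simp
    qed
    have "(a + b)\<^sup>2 \<le> 2 * (a\<^sup>2 + b\<^sup>2)"
      using zero_le_power2[of "a - b"] by (simp add: power2_eq_square algebra_simps)
    then have 3: "\<tau>\<^sup>2 / 4 * (a + b)\<^sup>2 \<le> \<tau>\<^sup>2 / 4 * (2 * (a\<^sup>2 + b\<^sup>2))" by (intro mult_left_mono) auto
    have 4: "\<tau>\<^sup>2 / 4 * (2 * (a\<^sup>2 + b\<^sup>2)) = \<tau>\<^sup>2 / 2 * (p t + q t)" unfolding ab by simp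
    have "\<tau> * \<bar>p t - q t\<bar> \<le> (a - b)\<^sup>2 + \<tau>\<^sup>2 / 2 * (p t + q t)"
      unfolding 1 by (rule order_trans[OF 2 add_left_mono[OF 3[unfolded 4]]])
    then have "\<bar>p t - q t\<bar> \<le> ((a - b)\<^sup>2 + \<tau>\<^sup>2 / 2 * (p t + q t)) / \<tau>"
      using assms(6) by (simp add: pos_le_divide_eq mult.commute)
    also have "\<dots> = (a - b)\<^sup>2 / \<tau> + \<tau> / 2 * (p t + q t)" using assms(6) by (simp add: add_divide_distrib power2_eq_square)
    finally show "\<bar>p t - q t\<bar> \<le> (sqrt (p t) - sqrt (q t))\<^sup>2 / \<tau> + \<tau> / 2 * (p t + q t)" by (simp add: a_def b_def)
  qed
  also have "\<dots> = hdist T p q / \<tau> + \<tau> / 2 * ((\<Sum>t\<in>T. p t) + (\<Sum>t\<in>T. q t))"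
  proof -
    have "(\<Sum>t\<in>T. \<tau> / 2 * (p t + q t)) = \<tau> / 2 * ((\<Sum>t\<in>T. p t) + (\<Sum>t\<in>T. q t))"
      by (simp only: sum_distrib_left[symmetric] sum.distrib)
    then show ?thesis by (simp only: hdist_def sum.distrib sum_divide_distrib)
  qed
  finally show ?thesis using assms by simp
qed

section \<open>Transcripts and the input distribution\<close>

primrec transcripts :: "protocol \<Rightarrow> bool list set" where
  "transcripts (Output v) = {[]}"
| "transcripts (Speak i f P0 P1) = (#) True ` transcripts P1 \<union> (#) False ` transcripts P0"

text \<open>A site constrains the transcript only at the nodes where it speaks; reaching such a tree
  node without a further bit counts as disagreement.\<close>

fun agrees :: "protocol \<Rightarrow> bool list \<Rightarrow> nat \<Rightarrow> site_input \<Rightarrow> nat \<Rightarrow> bool" where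
  "agrees (Output v) t i b \<rho> = True"
| "agrees (Speak i' f P0 P1) [] i b \<rho> = False"
| "agrees (Speak i' f P0 P1) (x # t) i b \<rho> = ((i = i' \<longrightarrow> f b \<rho> = x) \<and> agrees (if x then P1 else P0) t i b \<rho>)"

lemma finite_transcripts: "finite (transcripts P)"
  by (induction P) auto

lemma transcript_in_transcripts: "transcript P B r \<in> transcripts P"
  by (induction P) auto

text \<open>The rectangle property: \<open>t\<close> fixes the path in the tree, and at each node
  one site alone decides. The speakers must lie among the \<open>k\<close> sites because only these
  are asked to agree.\<close>

lemma transcript_eq_iff:
  assumes "speakers P \<subseteq> {..<k}" "t \<in> transcripts P"
  shows "transcript P B r = t \<longleftrightarrow> (\<forall>i<k. agrees P t i (B i) (r i))"
  using assms
proof (induction P arbitrary: t)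
  case (Speak i' f P0 P1)
  have i': "i' < k" using Speak.prems by auto
  obtain x t' where t: "t = x # t'" "t' \<in> transcripts (if x then P1 else P0)"
  proof -
    from Speak.prems(2) consider t' where "t = True # t'" "t' \<in> transcripts P1" | t' where "t = False # t'" "t' \<in> transcripts P0"
      by auto
    then show ?thesis
    proof cases
      case (1 t')
      show ?thesis by (rule that[of True t']) (use 1 in auto)
    next
      case (2 t')
      show ?thesis by (rule that[of False t']) (use 2 in auto)
    qed
  qed
  have IH: "transcript (if x then P1 else P0) B r = t' \<longleftrightarrow> (\<forall>i<k. agrees (if x then P1 else P0) t' i (B i) (r i))"
    using Speak.IH Speak.prems(1) t(2) by (cases x) auto
  have "transcript (Speak i' f P0 P1) B r = t \<longleftrightarrow> f (B i') (r i') = x \<and> transcript (if x then P1 else P0) B r = t'"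
    unfolding t(1) by (cases x) auto
  also have "\<dots> \<longleftrightarrow> (\<forall>i<k. agrees (Speak i' f P0 P1) t i (B i) (r i))"
    unfolding IH t(1) using i' by auto
  finally show ?case .
qed simp

definition site_prob :: "(nat \<Rightarrow> nat pmf) \<Rightarrow> protocol \<Rightarrow> nat \<Rightarrow> bool list \<Rightarrow> site_input \<Rightarrow> real" where
  "site_prob coins P i t b = measure_pmf.prob (coins i) {\<rho>. agrees P t i b \<rho>}"

text \<open>Private coins are independent over the sites, so the rectangle turns into a product of
  probabilities.\<close>

lemma pmf_transcript:
  assumes "speakers P \<subseteq> {..<k}" "t \<in> transcripts P"
  shows "pmf (transcript_pmf k coins P B) t = (\<Prod>i<k. site_prob coins P i t (B i))"
proof -
  have "pmf (transcript_pmf k coins P B) t = measure_pmf.prob (Pi_pmf {..<k} 0 coins) (transcript P B -` {t})"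
    unfolding transcript_pmf_def by (rule pmf_map)
  also have "transcript P B -` {t} = Pi {..<k} (\<lambda>i. {\<rho>. agrees P t i (B i) \<rho>})"
    using transcript_eq_iff[OF assms] by auto
  finally show ?thesis by (simp add: measure_Pi_pmf_Pi site_prob_def)
qed

lemma set_transcript_pmf: "set_pmf (transcript_pmf k coins P B) \<subseteq> transcripts P"
  unfolding transcript_pmf_def using transcript_in_transcripts by auto

lemma sum_pmf_transcript: "(\<Sum>t\<in>transcripts P. pmf (transcript_pmf k coins P B) t) = 1"
  by (rule sum_pmf_eq_1[OF finite_transcripts set_transcript_pmf])

text \<open>The bits of the latent set \<open>w\<close>: \<open>(j, l)\<close> with \<open>l < n\<close> is the bit of the site \<open>d j l\<close>, while \<open>(j, n)\<close>
  and \<open>(j, n + 1)\<close> are the two bits of the special coordinate of block \<open>j\<close>.\<close>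

definition inp :: "nat \<Rightarrow> nat \<Rightarrow> nat \<Rightarrow> (nat \<Rightarrow> nat) \<Rightarrow> (nat \<Rightarrow> nat \<Rightarrow> nat) \<Rightarrow> (nat \<times> nat) set \<Rightarrow> input" where
  "inp k n N m d w = (\<lambda>i j l. i < k \<and> j < N \<and> l < n \<and>
     (if l = m j then (if i < k div 2 then (j, n) \<in> w else (j, Suc n) \<in> w) else i = d j l \<and> (j, l) \<in> w))"

section \<open>The input distribution as the image of a uniform measure\<close>

definition Ms :: "nat \<Rightarrow> nat \<Rightarrow> (nat \<Rightarrow> nat) set" where
  "Ms n N = PiE_dflt {..<N} 0 (\<lambda>_. {..<n})"

definition Ds :: "nat \<Rightarrow> nat \<Rightarrow> nat \<Rightarrow> (nat \<Rightarrow> nat \<Rightarrow> nat) set" where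
  "Ds k n N = PiE_dflt {..<N} (\<lambda>_. 0) (\<lambda>_. PiE_dflt {..<n} 0 (\<lambda>_. {..<k}))"

definition Js :: "nat \<Rightarrow> nat \<Rightarrow> (nat \<times> nat) set" where
  "Js n N = {..<N} \<times> {..<Suc (Suc n)}"

lemma finite_Js [simp]: "finite (Js n N)" by (simp add: Js_def)

lemma finite_Ms [simp]: "finite (Ms n N)" by (simp add: Ms_def finite_PiE_dflt)

lemma finite_Ds [simp]: "finite (Ds k n N)" by (simp add: Ds_def finite_PiE_dflt)

lemma Ms_nonempty: "0 < n \<Longrightarrow> Ms n N \<noteq> {}"
  by (auto simp: Ms_def PiE_dflt_empty_iff)

lemma Ds_nonempty: "0 < k \<Longrightarrow> Ds k n N \<noteq> {}"
  by (auto simp: Ds_def PiE_dflt_empty_iff)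

lemma pair_pmf_of_set:
  assumes "finite A" "A \<noteq> {}" "finite B" "B \<noteq> {}"
  shows "pair_pmf (pmf_of_set A) (pmf_of_set B) = pmf_of_set (A \<times> B)"
proof (rule pmf_eqI)
  fix x :: "'a \<times> 'b"
  obtain a b where x: "x = (a, b)" by (cases x)
  have AB: "A \<times> B \<noteq> {}" "finite (A \<times> B)" using assms by auto
  show "pmf (pair_pmf (pmf_of_set A) (pmf_of_set B)) x = pmf (pmf_of_set (A \<times> B)) x"
    unfolding x pmf_pair pmf_of_set[OF assms(2,1)] pmf_of_set[OF assms(4,3)] pmf_of_set[OF AB]
    by (simp add: indicator_def card_cartesian_product)
qed

text \<open>All random choices are uniform and independent, so \<open>nu\<close> is the image of a
  uniform law on a product of three finite sets. The mutually inverse maps \<Phi> and \<Psi> regroup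
  the blockwise tuples into \<open>m\<close>, \<open>d\<close> and one set \<open>w\<close> of
  latent bits; afterwards every expectation is an \<open>avg\<close>.\<close>

lemma nu_uniform:
  assumes "0 < k" "0 < n"
  shows "nu k n N = map_pmf (\<lambda>(m, d, w). (inp k n N m d w, m, d)) (pmf_of_set (Ms n N \<times> Ds k n N \<times> Pow (Js n N)))"
proof -
  define Dn where "Dn = PiE_dflt {..<n} 0 (\<lambda>_. {..<k})"
  define Us where "Us = PiE_dflt {..<n} False (\<lambda>_. UNIV :: bool set)"
  define X where "X = Dn \<times> Us \<times> {..<n} \<times> (UNIV :: bool set) \<times> (UNIV :: bool set)"
  define g where "g = (\<lambda>(d, u, m, s1, s2). ((\<lambda>i l. i < k \<and> l < n \<and>
            (if l = m then (if i < k div 2 then s1 else s2) else i = d l \<and> u l)) :: block, m :: nat, d :: nat \<Rightarrow> nat))"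
  \<comment> \<open>Chosen so that \<open>g\<close> sends it to the default value of
    \<open>nu\<close> outside the blocks, as \<open>Pi_pmf_map\<close> requires.\<close>
  define df :: "(nat \<Rightarrow> nat) \<times> (nat \<Rightarrow> bool) \<times> nat \<times> bool \<times> bool" where "df = (\<lambda>_. 0, \<lambda>_. False, 0, False, False)"
  have fin: "finite Dn" "finite Us" by (auto simp: Dn_def Us_def finite_PiE_dflt)
  have ne: "Dn \<noteq> {}" "Us \<noteq> {}" "{..<n} \<noteq> {}" using assms by (auto simp: Dn_def Us_def PiE_dflt_empty_iff)
  have Xf: "finite X" "X \<noteq> {}" using fin ne by (auto simp: X_def)
  have pd: "Pi_pmf {..<n} 0 (\<lambda>_. pmf_of_set {..<k}) = pmf_of_set Dn"
    unfolding Dn_def by (rule Pi_pmf_of_set) (use assms in auto)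
  have pu: "Pi_pmf {..<n} False (\<lambda>_. fair_bit) = pmf_of_set Us"
    unfolding Us_def fair_bit_def by (rule Pi_pmf_of_set) auto
  have "block_pmf k n = map_pmf g (pair_pmf (pmf_of_set Dn) (pair_pmf (pmf_of_set Us) (pair_pmf (pmf_of_set {..<n}) (pair_pmf fair_bit fair_bit))))"
    unfolding block_pmf_def pd pu g_def by (simp add: map_pmf_def pair_pmf_def bind_assoc_pmf bind_return_pmf)
  also have "pair_pmf (pmf_of_set Dn) (pair_pmf (pmf_of_set Us) (pair_pmf (pmf_of_set {..<n}) (pair_pmf fair_bit fair_bit))) = pmf_of_set X"
    unfolding X_def fair_bit_def using fin ne by (simp add: pair_pmf_of_set)
  finally have blk: "block_pmf k n = map_pmf g (pmf_of_set X)" .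
  define W where "W = PiE_dflt {..<N} df (\<lambda>_. X)"
  have Wf: "finite W" "W \<noteq> {}" using Xf by (auto simp: W_def finite_PiE_dflt PiE_dflt_empty_iff)
  have gd: "g df = (\<lambda>_ _. False, 0, \<lambda>_. 0)" by (auto simp: g_def df_def fun_eq_iff)
  have "Pi_pmf {..<N} (\<lambda>_ _. False, 0, \<lambda>_. 0) (\<lambda>_. block_pmf k n) = map_pmf (\<lambda>h. g \<circ> h) (Pi_pmf {..<N} df (\<lambda>_. pmf_of_set X))"
    unfolding blk by (rule Pi_pmf_map) (use gd in auto)
  also have "Pi_pmf {..<N} df (\<lambda>_. pmf_of_set X) = pmf_of_set W"
    unfolding W_def by (rule Pi_pmf_of_set) (use Xf in auto)
  finally have nu1: "nu k n N = map_pmf (\<lambda>h. (\<lambda>i j l. fst (g (h j)) i l, \<lambda>j. fst (snd (g (h j))), \<lambda>j. snd (snd (g (h j))))) (pmf_of_set W)"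
    unfolding nu_def by (simp add: pmf.map_comp o_def)
  define \<Phi> where "\<Phi> h = (\<lambda>j. fst (snd (snd (h j))), \<lambda>j. fst (h j),
      {(j, l). j < N \<and> l < Suc (Suc n) \<and> (if l < n then fst (snd (h j)) l else if l = n then fst (snd (snd (snd (h j)))) else snd (snd (snd (snd (h j)))))})"
    for h :: "nat \<Rightarrow> (nat \<Rightarrow> nat) \<times> (nat \<Rightarrow> bool) \<times> nat \<times> bool \<times> bool"
  define \<Psi> where "\<Psi> = (\<lambda>(m, d, w). \<lambda>j :: nat. if j < N then (d j :: nat \<Rightarrow> nat, \<lambda>l. l < n \<and> (j, l) \<in> w, m j :: nat, (j, n) \<in> w, (j, Suc n) \<in> w) else df)"
  have bij: "bij_betw \<Phi> W (Ms n N \<times> Ds k n N \<times> Pow (Js n N))"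
  proof (rule bij_betw_byWitness[where f' = \<Psi>])
    show "\<forall>h\<in>W. \<Psi> (\<Phi> h) = h"
    proof
      fix h assume h: "h \<in> W"
      show "\<Psi> (\<Phi> h) = h"
      proof
        fix j
        show "\<Psi> (\<Phi> h) j = h j"
        proof (cases "j < N")
          case True
          then have "h j \<in> X" using h by (auto simp: W_def PiE_dflt_def)
          then show ?thesis using True by (cases "h j") (auto simp: \<Psi>_def \<Phi>_def X_def Us_def PiE_dflt_def fun_eq_iff)
        next
          case False
          then have "h j = df" using h by (auto simp: W_def PiE_dflt_def)
          then show ?thesis using False by (simp add: \<Psi>_def \<Phi>_def)
        qed
      qed
    qed
    show "\<forall>x\<in>Ms n N \<times> Ds k n N \<times> Pow (Js n N). \<Phi> (\<Psi> x) = x"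
    proof
      fix x assume "x \<in> Ms n N \<times> Ds k n N \<times> Pow (Js n N)"
      then obtain m d w where x: "x = (m, d, w)" "m \<in> Ms n N" "d \<in> Ds k n N" "w \<subseteq> Js n N" by auto
      have "(\<lambda>j. fst (snd (snd (\<Psi> x j)))) = m"
        using x(2) by (auto simp: x(1) \<Psi>_def df_def Ms_def PiE_dflt_def fun_eq_iff)
      moreover have "(\<lambda>j. fst (\<Psi> x j)) = d"
        using x(3) by (auto simp: x(1) \<Psi>_def df_def Ds_def PiE_dflt_def fun_eq_iff)
      moreover have "{(j, l). j < N \<and> l < Suc (Suc n) \<and> (if l < n then fst (snd (\<Psi> x j)) l else if l = n then fst (snd (snd (snd (\<Psi> x j)))) else snd (snd (snd (snd (\<Psi> x j)))))} = w"
        using x(4) by (auto simp: x(1) \<Psi>_def Js_def less_Suc_eq split: if_splits)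
      ultimately show "\<Phi> (\<Psi> x) = x" unfolding \<Phi>_def x(1) by simp
    qed
    show "\<Phi> ` W \<subseteq> Ms n N \<times> Ds k n N \<times> Pow (Js n N)"
      by (auto simp: \<Phi>_def W_def X_def Ms_def Ds_def Js_def Dn_def PiE_dflt_def df_def split: prod.splits)
    show "\<Psi> ` (Ms n N \<times> Ds k n N \<times> Pow (Js n N)) \<subseteq> W"
      by (auto simp: \<Psi>_def W_def X_def Ms_def Ds_def Dn_def Us_def PiE_dflt_def)
  qed
  have "pmf_of_set (Ms n N \<times> Ds k n N \<times> Pow (Js n N)) = map_pmf \<Phi> (pmf_of_set W)"
    by (rule map_pmf_of_set_bij_betw[symmetric]) (use bij Wf in auto)
  then show ?thesis
    unfolding nu1 pmf.map_comp
  proof (simp only: pmf.map_comp, intro map_pmf_cong refl)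
    fix h assume "h \<in> set_pmf (pmf_of_set W)"
    then have h: "h \<in> W" using Wf by simp
    have out: "h j = df" if "\<not> j < N" for j using h that by (auto simp: W_def PiE_dflt_def)
    have "fst (g (h j)) i l = inp k n N (\<lambda>j. fst (snd (snd (h j)))) (\<lambda>j. fst (h j)) (snd (snd (\<Phi> h))) i j l" for i j l
    proof (cases "j < N")
      case False
      then show ?thesis using out gd by (simp add: inp_def)
    qed (auto simp: g_def inp_def \<Phi>_def split: prod.splits)
    then show "(\<lambda>i j l. fst (g (h j)) i l, \<lambda>j. fst (snd (g (h j))), \<lambda>j. snd (snd (g (h j)))) =
      ((\<lambda>(m, d, w). (inp k n N m d w, m, d)) \<circ> \<Phi>) h"
      by (auto simp: \<Phi>_def g_def split: prod.splits)
  qed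
qed

definition tker :: "nat \<Rightarrow> nat \<Rightarrow> nat \<Rightarrow> (nat \<Rightarrow> nat pmf) \<Rightarrow> protocol \<Rightarrow> (nat \<Rightarrow> nat) \<Rightarrow> (nat \<Rightarrow> nat \<Rightarrow> nat) \<Rightarrow> (nat \<times> nat) set \<Rightarrow> bool list \<Rightarrow> real" where
  "tker k n N coins P m d w t = pmf (transcript_pmf k coins P (inp k n N m d w)) t"

lemma prob_bind_pmf: "measure_pmf.prob (bind_pmf M f) E = measure_pmf.expectation M (\<lambda>x. measure_pmf.prob (f x) E)"
proof -
  have e: "measure_pmf.prob p E = pmf (map_pmf (\<lambda>x. x \<in> E) p) True" for p
    by (simp add: pmf_map vimage_def)
  show ?thesis unfolding e map_bind_pmf by (rule pmf_bind)
qed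

lemma prob_run:
  assumes "0 < k" "0 < n"
  shows "measure_pmf.prob (run_pmf k n N coins P) E =
    avg (Ms n N \<times> Ds k n N \<times> Pow (Js n N)) (\<lambda>(m, d, w). \<Sum>t\<in>transcripts P.
      tker k n N coins P m d w t * of_bool ((inp k n N m d w, m, d, t) \<in> E))"
proof -
  let ?W = "Ms n N \<times> Ds k n N \<times> Pow (Js n N)"
  have run: "run_pmf k n N coins P = bind_pmf (pmf_of_set ?W) (\<lambda>(m, d, w).
     map_pmf (\<lambda>t. (inp k n N m d w, m, d, t)) (transcript_pmf k coins P (inp k n N m d w)))"
    unfolding run_pmf_def nu_uniform[OF assms] bind_map_pmf
    by (intro bind_pmf_cong refl) (auto simp: map_pmf_def)
  have W: "finite ?W" "?W \<noteq> {}" using assms Ms_nonempty Ds_nonempty by auto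
  have one: "measure_pmf.prob (map_pmf (\<lambda>t. (inp k n N m d w, m, d, t)) (transcript_pmf k coins P (inp k n N m d w))) E =
    (\<Sum>t\<in>transcripts P. tker k n N coins P m d w t * of_bool ((inp k n N m d w, m, d, t) \<in> E))" for m d w
  proof -
    let ?p = "transcript_pmf k coins P (inp k n N m d w)"
    let ?A = "{t. (inp k n N m d w, m, d, t) \<in> E}"
    have "measure_pmf.prob (map_pmf (\<lambda>t. (inp k n N m d w, m, d, t)) ?p) E = measure_pmf.prob ?p ?A"
      by (simp add: vimage_def)
    also have "\<dots> = measure_pmf.prob ?p (?A \<inter> transcripts P)"
      by (rule measure_pmf.finite_measure_eq_AE) (use set_transcript_pmf[of k coins P "inp k n N m d w"] in \<open>auto simp: AE_measure_pmf_iff\<close>)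
    also have "\<dots> = (\<Sum>t\<in>?A \<inter> transcripts P. pmf ?p t)"
      using finite_transcripts by (intro measure_measure_pmf_finite) auto
    also have "\<dots> = (\<Sum>t\<in>transcripts P. pmf ?p t * of_bool (t \<in> ?A))"
      using finite_transcripts by (intro sum.mono_neutral_cong_left) auto
    finally show ?thesis by (simp add: tker_def)
  qed
  show ?thesis
    unfolding run prob_bind_pmf integral_pmf_of_set[OF W(2,1)] avg_def
    by (intro arg_cong2[where f = "(/)"] sum.cong refl) (auto simp del: measure_map_pmf simp: one)
qed

section \<open>The conditional mutual information of a run\<close>

text \<open>On the finite support every function is simple, so the discrete formula applies;
  injectivity identifies each triple of values with one point \<omega>, whose probability is the
  joint one.\<close>

lemma pmf_cond_mutual_info_eq:
  assumes fin: "finite (set_pmf p)" and inj: "inj_on (\<lambda>\<omega>. (X \<omega>, Y \<omega>, Z \<omega>)) (set_pmf p)"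
  shows "pmf_cond_mutual_info p X Y Z = (\<Sum>\<omega>\<in>set_pmf p. pmf p \<omega> * log 2 (pmf p \<omega> /
    (measure_pmf.prob p {x. X x = X \<omega> \<and> Z x = Z \<omega>} *
      (measure_pmf.prob p {x. Y x = Y \<omega> \<and> Z x = Z \<omega>} / measure_pmf.prob p {x. Z x = Z \<omega>}))))"
proof -
  define S where "S = set_pmf p"
  define M where "M = restrict_space (measure_pmf p) S"
  have spM: "space M = S" by (simp add: M_def space_restrict_space)
  have setsM: "sets M = Pow S" by (auto simp: M_def sets_restrict_space image_iff)
  have psM: "prob_space M"
    unfolding M_def S_def by (intro prob_space_restrict_space measure_pmf.emeasure_eq_1_AE) (auto simp: AE_measure_pmf_iff)
  interpret information_space M 2
    by (intro information_space.intro psM information_space_axioms.intro) simp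
  have sf: "simple_function M f" for f :: "'a \<Rightarrow> 'e"
    unfolding simple_function_def spM setsM using fin by (auto simp: S_def)
  have meas: "measure M (f -` {v} \<inter> space M) = measure_pmf.prob p {x. f x = v}" for f :: "'a \<Rightarrow> 'e" and v
  proof -
    have "measure M (f -` {v} \<inter> space M) = measure_pmf.prob p (f -` {v} \<inter> S)"
      unfolding spM unfolding M_def by (rule measure_restrict_space) auto
    also have "\<dots> = measure_pmf.prob p {x. f x = v}"
      by (rule measure_pmf.finite_measure_eq_AE) (auto simp: AE_measure_pmf_iff S_def)
    finally show ?thesis .
  qed
  have sd: "simple_distributed M f (\<lambda>v. measure_pmf.prob p {x. f x = v})" for f :: "'a \<Rightarrow> 'e"
    by (rule simple_distributedI[OF sf]) (auto simp: meas)
  have one: "measure_pmf.prob p {x. (X x, Y x, Z x) = (X \<omega>, Y \<omega>, Z \<omega>)} = pmf p \<omega>" if "\<omega> \<in> S" for \<omega>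
  proof -
    have "measure_pmf.prob p {x. (X x, Y x, Z x) = (X \<omega>, Y \<omega>, Z \<omega>)} = measure_pmf.prob p {\<omega>}"
      by (rule measure_pmf.finite_measure_eq_AE)
        (use inj that in \<open>auto simp: AE_measure_pmf_iff S_def inj_on_def\<close>)
    then show ?thesis by (simp add: measure_pmf_single)
  qed
  have "pmf_cond_mutual_info p X Y Z = conditional_mutual_information 2 (count_space (X ` space M)) (count_space (Y ` space M)) (count_space (Z ` space M)) X Y Z"
    by (simp add: pmf_cond_mutual_info_def spM M_def S_def)
  also have "\<dots> = (\<Sum>(x, y, z)\<in>(\<lambda>x. (X x, Y x, Z x)) ` space M. measure_pmf.prob p {x'. (X x', Y x', Z x') = (x, y, z)} *
      log 2 (measure_pmf.prob p {x'. (X x', Y x', Z x') = (x, y, z)} /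
        (measure_pmf.prob p {x'. (X x', Z x') = (x, z)} * (measure_pmf.prob p {x'. (Y x', Z x') = (y, z)} / measure_pmf.prob p {x'. Z x' = z}))))"
    by (rule conditional_mutual_information_eq[OF sd sd sd sd])
  also have "\<dots> = (\<Sum>\<omega>\<in>S. measure_pmf.prob p {x'. (X x', Y x', Z x') = (X \<omega>, Y \<omega>, Z \<omega>)} *
      log 2 (measure_pmf.prob p {x'. (X x', Y x', Z x') = (X \<omega>, Y \<omega>, Z \<omega>)} /
        (measure_pmf.prob p {x'. (X x', Z x') = (X \<omega>, Z \<omega>)} * (measure_pmf.prob p {x'. (Y x', Z x') = (Y \<omega>, Z \<omega>)} / measure_pmf.prob p {x'. Z x' = Z \<omega>}))))"
    unfolding spM using inj by (subst sum.reindex) (auto simp: S_def)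
  also have "\<dots> = (\<Sum>\<omega>\<in>S. pmf p \<omega> * log 2 (pmf p \<omega> /
        (measure_pmf.prob p {x'. (X x', Z x') = (X \<omega>, Z \<omega>)} * (measure_pmf.prob p {x'. (Y x', Z x') = (Y \<omega>, Z \<omega>)} / measure_pmf.prob p {x'. Z x' = Z \<omega>}))))"
    by (intro sum.cong refl) (simp only: one)
  finally show ?thesis by (simp add: S_def)
qed

lemma avg_of_bool_eq:
  assumes "finite A" "a \<in> A"
  shows "avg A (\<lambda>x. of_bool (x = a) * f x) = f a / card A"
proof -
  have "(\<Sum>x\<in>A. of_bool (x = a) * f x) = f a"
    using assms by (simp add: of_bool_def if_distrib if_distribR sum.delta cong: if_cong)
  then show ?thesis by (simp add: avg_def)
qed

lemma prob_run_given:
  assumes "0 < k" "0 < n" "m \<in> Ms n N" "d \<in> Ds k n N"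
  shows "measure_pmf.prob (run_pmf k n N coins P) {(b, m', d', t). (m' = m \<and> d' = d) \<and> Q b t} =
    avg (Pow (Js n N)) (\<lambda>w. \<Sum>t\<in>transcripts P. tker k n N coins P m d w t * of_bool (Q (inp k n N m d w) t))
      / (card (Ms n N) * card (Ds k n N))"
proof -
  let ?f = "\<lambda>m d. avg (Pow (Js n N)) (\<lambda>w. \<Sum>t\<in>transcripts P. tker k n N coins P m d w t * of_bool (Q (inp k n N m d w) t))"
  have "measure_pmf.prob (run_pmf k n N coins P) {(b, m', d', t). (m' = m \<and> d' = d) \<and> Q b t} =
    avg (Ms n N) (\<lambda>m'. avg (Ds k n N) (\<lambda>d'. avg (Pow (Js n N)) (\<lambda>w. \<Sum>t\<in>transcripts P.
      of_bool (m' = m) * (of_bool (d' = d) * (tker k n N coins P m' d' w t * of_bool (Q (inp k n N m' d' w) t))))))"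
    unfolding prob_run[OF assms(1,2)] avg_Times
    by (intro avg_cong refl) (auto simp: of_bool_conj intro!: avg_cong sum.cong)
  also have "\<dots> = avg (Ms n N) (\<lambda>m'. of_bool (m' = m) * avg (Ds k n N) (\<lambda>d'. of_bool (d' = d) * ?f m' d'))"
    by (simp only: sum_distrib_left[symmetric] avg_cmult)
  also have "\<dots> = ?f m d / (card (Ms n N) * card (Ds k n N))"
    unfolding avg_of_bool_eq[OF finite_Ms assms(3)] avg_of_bool_eq[OF finite_Ds assms(4)] by (simp add: mult.commute)
  finally show ?thesis .
qed

text \<open>The information about \<open>B\<close> equals that about the latent set
  \<open>w\<close>: several \<open>w\<close> may give the same input, but the kernel depends on
  \<open>w\<close> only through the input, and the fraction \<open>c\<close> of such
  \<open>w\<close> cancels. Division by \<open>ln 2\<close> turns nats into bits.\<close>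

lemma btx_info_eq:
  assumes "0 < k" "0 < n"
  shows "btx_info k n N coins P = avg (Ms n N) (\<lambda>m. avg (Ds k n N) (\<lambda>d.
    minfo (Pow (Js n N)) (transcripts P) (tker k n N coins P m d))) / ln 2"
proof -
  let ?run = "run_pmf k n N coins P"
  let ?T = "transcripts P"
  let ?J = "Pow (Js n N)"
  let ?W = "Ms n N \<times> Ds k n N \<times> ?J"
  let ?p = "tker k n N coins P"
  let ?i = "inp k n N"
  define xx where "xx = (\<lambda>(m, d, w) (t :: bool list). (?i m d w, m, d, t))"
  define kt where "kt b t = pmf (transcript_pmf k coins P b) t" for b t
  have W: "finite ?W" "?W \<noteq> {}" using assms Ms_nonempty Ds_nonempty by auto
  have p0: "0 \<le> ?p m d w t" for m d w t by (simp add: tker_def)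
  have p1: "(\<Sum>t\<in>?T. ?p m d w t) = 1" for m d w unfolding tker_def by (rule sum_pmf_transcript)
  have pmfrun: "pmf ?run \<omega> = avg ?W (\<lambda>(m, d, w). \<Sum>t\<in>?T. ?p m d w t * of_bool (xx (m, d, w) t = \<omega>))" for \<omega>
    unfolding measure_pmf_single[symmetric] prob_run[OF assms] xx_def by (intro avg_cong) auto
  have in_supp: "x \<in> ?W \<Longrightarrow> t \<in> ?T \<Longrightarrow> ?p (fst x) (fst (snd x)) (snd (snd x)) t \<noteq> 0 \<Longrightarrow> xx x t \<in> set_pmf ?run" for x t
  proof (rule ccontr)
    assume x: "x \<in> ?W" "t \<in> ?T" "?p (fst x) (fst (snd x)) (snd (snd x)) t \<noteq> 0" "xx x t \<notin> set_pmf ?run"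
    obtain m d w where xe: "x = (m, d, w)" by (cases x)
    have "pmf ?run (xx x t) = 0" using x(4) by (simp add: set_pmf_iff)
    define F where "F = (\<lambda>(m, d, w). \<Sum>t'\<in>?T. ?p m d w t' * of_bool (xx (m, d, w) t' = xx x t))"
    have "avg ?W F = 0" using \<open>pmf ?run (xx x t) = 0\<close> unfolding pmfrun F_def .
    moreover have "0 \<le> F y" for y
      using p0 by (auto simp: F_def intro!: sum_nonneg split: prod.split)
    ultimately have "F x = 0" using avg_eq_0_imp[of ?W x F] W(1) x(1) by blast
    then have "(\<Sum>t'\<in>?T. ?p m d w t' * of_bool (xx (m, d, w) t' = xx x t)) = 0"
      by (simp add: xe F_def)
    then have "?p m d w t * of_bool (xx (m, d, w) t = xx x t) = 0"
      using sum_nonneg_eq_0_iff[OF finite_transcripts[of P], of "\<lambda>t'. ?p m d w t' * of_bool (xx (m, d, w) t' = xx x t)"] p0 x(2) by auto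
    then show False using x(3) unfolding xe by simp
  qed
  have supp: "set_pmf ?run \<subseteq> (\<lambda>(x, t). xx x t) ` (?W \<times> ?T)"
  proof
    fix \<omega> assume w: "\<omega> \<in> set_pmf ?run"
    show "\<omega> \<in> (\<lambda>(x, t). xx x t) ` (?W \<times> ?T)"
    proof (rule ccontr)
      assume n: "\<omega> \<notin> (\<lambda>(x, t). xx x t) ` (?W \<times> ?T)"
      have "pmf ?run \<omega> = avg ?W (\<lambda>_. 0)"
        unfolding pmfrun
      proof (rule avg_cong[OF refl])
        fix x assume x: "x \<in> ?W"
        have "xx x t \<noteq> \<omega>" if "t \<in> ?T" for t using n x that by force
        then show "(case x of (m, d, w) \<Rightarrow> \<Sum>t\<in>?T. ?p m d w t * of_bool (xx (m, d, w) t = \<omega>)) = 0"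
          by (cases x) (auto intro!: sum.neutral)
      qed
      then have "pmf ?run \<omega> = 0" by (simp add: avg_def)
      then show False using w by (simp add: set_pmf_iff)
    qed
  qed
  then have fin: "finite (set_pmf ?run)" by (rule finite_subset) (use W finite_transcripts in auto)
  define L where "L = (\<lambda>(b, m, d, t). log 2 (kt b t / avg ?J (\<lambda>w. ?p m d w t)))"
  have "btx_info k n N coins P = (\<Sum>\<omega>\<in>set_pmf ?run. pmf ?run \<omega> * L \<omega>)"
    unfolding btx_info_def
  proof (subst pmf_cond_mutual_info_eq[OF fin])
    show "inj_on (\<lambda>\<omega>. ((\<lambda>(B, M, D, t). B) \<omega>, (\<lambda>(B, M, D, t). t) \<omega>, (\<lambda>(B, M, D, t). (M, D)) \<omega>)) (set_pmf ?run)"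
      by (auto simp: inj_on_def)
    show "(\<Sum>\<omega>\<in>set_pmf ?run. pmf ?run \<omega> * log 2 (pmf ?run \<omega> /
       (measure_pmf.prob ?run {x. (\<lambda>(B, M, D, t). B) x = (\<lambda>(B, M, D, t). B) \<omega> \<and> (\<lambda>(B, M, D, t). (M, D)) x = (\<lambda>(B, M, D, t). (M, D)) \<omega>} *
        (measure_pmf.prob ?run {x. (\<lambda>(B, M, D, t). t) x = (\<lambda>(B, M, D, t). t) \<omega> \<and> (\<lambda>(B, M, D, t). (M, D)) x = (\<lambda>(B, M, D, t). (M, D)) \<omega>} /
         measure_pmf.prob ?run {x. (\<lambda>(B, M, D, t). (M, D)) x = (\<lambda>(B, M, D, t). (M, D)) \<omega>})))) =
      (\<Sum>\<omega>\<in>set_pmf ?run. pmf ?run \<omega> * L \<omega>)"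
    proof (intro sum.cong refl arg_cong2[where f = "(*)"])
      fix \<omega> assume w: "\<omega> \<in> set_pmf ?run"
      then obtain m d w0 t where om: "\<omega> = (?i m d w0, m, d, t)" and md: "m \<in> Ms n N" "d \<in> Ds k n N" "w0 \<in> ?J" "t \<in> ?T"
        using supp by (auto simp: xx_def)
      define b where "b = ?i m d w0"
      define z where "z = 1 / (real (card (Ms n N)) * real (card (Ds k n N)))"
      define c where "c = avg ?J (\<lambda>w. of_bool (?i m d w = b))"
      have z: "0 < z" unfolding z_def using assms Ms_nonempty Ds_nonempty by (simp add: card_gt_0_iff)
      have c: "0 < c" unfolding c_def by (rule avg_pos[of _ w0]) (use md in \<open>auto simp: b_def\<close>)
      have pr: "measure_pmf.prob ?run {(b', m', d', t'). (m' = m \<and> d' = d) \<and> Q b' t'} =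
         avg ?J (\<lambda>w. \<Sum>t\<in>?T. ?p m d w t * of_bool (Q (?i m d w) t)) * z" for Q
        unfolding prob_run_given[OF assms md(1,2)] z_def by simp
      have T1: "(\<Sum>t'\<in>?T. f t' * of_bool (t' = t)) = f t" for f :: "bool list \<Rightarrow> real"
        using md finite_transcripts[of P] by (simp add: of_bool_def if_distrib sum.delta cong: if_cong)
      have Z: "measure_pmf.prob ?run {x. (\<lambda>(B, M, D, t). (M, D)) x = (m, d)} = z"
      proof -
        have e: "{x. (\<lambda>(B, M, D, t). (M, D)) x = (m, d)} = {(b', m', d', t'). (m' = m \<and> d' = d) \<and> True}" by auto
        show ?thesis unfolding e pr by (simp add: p1 avg_const Pow_not_empty)
      qed
      have YZ: "measure_pmf.prob ?run {x. (\<lambda>(B, M, D, t). t) x = t \<and> (\<lambda>(B, M, D, t). (M, D)) x = (m, d)} = avg ?J (\<lambda>w. ?p m d w t) * z"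
      proof -
        have e: "{x. (\<lambda>(B, M, D, t). t) x = t \<and> (\<lambda>(B, M, D, t). (M, D)) x = (m, d)} = {(b', m', d', t'). (m' = m \<and> d' = d) \<and> t' = t}" by auto
        show ?thesis unfolding e pr T1 ..
      qed
      have XZ: "measure_pmf.prob ?run {x. (\<lambda>(B, M, D, t). B) x = b \<and> (\<lambda>(B, M, D, t). (M, D)) x = (m, d)} = c * z"
      proof -
        have e: "{x. (\<lambda>(B, M, D, t). B) x = b \<and> (\<lambda>(B, M, D, t). (M, D)) x = (m, d)} = {(b', m', d', t'). (m' = m \<and> d' = d) \<and> b' = b}" by auto
        show ?thesis unfolding e pr c_def by (simp add: sum_distrib_right[symmetric] p1)
      qed
      have XYZ: "pmf ?run \<omega> = kt b t * c * z"
      proof -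
        have "pmf ?run \<omega> = measure_pmf.prob ?run {(b', m', d', t'). (m' = m \<and> d' = d) \<and> (b' = b \<and> t' = t)}"
          unfolding om measure_pmf_single[symmetric] b_def by (rule arg_cong[where f = "measure_pmf.prob ?run"]) auto
        also have "\<dots> = avg ?J (\<lambda>w. \<Sum>t'\<in>?T. ?p m d w t' * of_bool (?i m d w = b \<and> t' = t)) * z" by (rule pr)
        also have "avg ?J (\<lambda>w. \<Sum>t'\<in>?T. ?p m d w t' * of_bool (?i m d w = b \<and> t' = t)) = avg ?J (\<lambda>w. kt b t * of_bool (?i m d w = b))"
        proof (rule avg_cong[OF refl])
          fix w
          have "(\<Sum>t'\<in>?T. ?p m d w t' * of_bool (?i m d w = b \<and> t' = t)) = (\<Sum>t'\<in>?T. (?p m d w t' * of_bool (?i m d w = b)) * of_bool (t' = t))"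
            by (simp add: of_bool_conj mult.assoc)
          also have "\<dots> = ?p m d w t * of_bool (?i m d w = b)" by (rule T1)
          finally show "(\<Sum>t'\<in>?T. ?p m d w t' * of_bool (?i m d w = b \<and> t' = t)) = kt b t * of_bool (?i m d w = b)"
            by (auto simp: tker_def kt_def)
        qed
        finally show ?thesis by (simp add: avg_cmult c_def)
      qed
      have om': "(\<lambda>(B, M, D, t). B) \<omega> = b" "(\<lambda>(B, M, D, t). t) \<omega> = t" "(\<lambda>(B, M, D, t). (M, D)) \<omega> = (m, d)"
        by (auto simp: om b_def)
      have Lo: "L \<omega> = log 2 (kt b t / avg ?J (\<lambda>w. ?p m d w t))" by (simp add: L_def om b_def)
      show "log 2 (pmf ?run \<omega> /
       (measure_pmf.prob ?run {x. (\<lambda>(B, M, D, t). B) x = (\<lambda>(B, M, D, t). B) \<omega> \<and> (\<lambda>(B, M, D, t). (M, D)) x = (\<lambda>(B, M, D, t). (M, D)) \<omega>} *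
        (measure_pmf.prob ?run {x. (\<lambda>(B, M, D, t). t) x = (\<lambda>(B, M, D, t). t) \<omega> \<and> (\<lambda>(B, M, D, t). (M, D)) x = (\<lambda>(B, M, D, t). (M, D)) \<omega>} /
         measure_pmf.prob ?run {x. (\<lambda>(B, M, D, t). (M, D)) x = (\<lambda>(B, M, D, t). (M, D)) \<omega>}))) = L \<omega>"
        unfolding om' XZ YZ Z XYZ Lo using z c by simp
    qed
  qed
  also have "\<dots> = (\<Sum>\<omega>\<in>set_pmf ?run. avg ?W (\<lambda>(m, d, w). \<Sum>t\<in>?T. ?p m d w t * of_bool (xx (m, d, w) t = \<omega>)) * L \<omega>)"
    by (simp only: pmfrun)
  also have "\<dots> = avg ?W (\<lambda>(m, d, w). \<Sum>t\<in>?T. ?p m d w t * L (xx (m, d, w) t))"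
  proof -
    have "(\<Sum>\<omega>\<in>set_pmf ?run. avg ?W (\<lambda>(m, d, w). \<Sum>t\<in>?T. ?p m d w t * of_bool (xx (m, d, w) t = \<omega>)) * L \<omega>) =
      avg ?W (\<lambda>x. \<Sum>\<omega>\<in>set_pmf ?run. (case x of (m, d, w) \<Rightarrow> \<Sum>t\<in>?T. ?p m d w t * of_bool (xx (m, d, w) t = \<omega>)) * L \<omega>)"
      by (simp only: avg_sum avg_multc)
    also have "\<dots> = avg ?W (\<lambda>(m, d, w). \<Sum>t\<in>?T. ?p m d w t * L (xx (m, d, w) t))"
    proof (rule avg_cong[OF refl])
      fix x assume x: "x \<in> ?W"
      obtain m d w where xe: "x = (m, d, w)" by (cases x)
      have "(\<Sum>\<omega>\<in>set_pmf ?run. (\<Sum>t\<in>?T. ?p m d w t * of_bool (xx (m, d, w) t = \<omega>)) * L \<omega>) =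
        (\<Sum>t\<in>?T. ?p m d w t * (\<Sum>\<omega>\<in>set_pmf ?run. of_bool (xx (m, d, w) t = \<omega>) * L \<omega>))"
        unfolding sum_distrib_right sum_distrib_left by (subst sum.swap) (simp only: mult.assoc)
      also have "\<dots> = (\<Sum>t\<in>?T. ?p m d w t * L (xx (m, d, w) t))"
      proof (rule sum.cong[OF refl])
        fix t assume t: "t \<in> ?T"
        show "?p m d w t * (\<Sum>\<omega>\<in>set_pmf ?run. of_bool (xx (m, d, w) t = \<omega>) * L \<omega>) = ?p m d w t * L (xx (m, d, w) t)"
        proof (cases "?p m d w t = 0")
          case False
          then have "xx (m, d, w) t \<in> set_pmf ?run" using in_supp[OF x t] by (simp add: xe)
          then have "(\<Sum>\<omega>\<in>set_pmf ?run. of_bool (xx (m, d, w) t = \<omega>) * L \<omega>) = L (xx (m, d, w) t)"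
            using fin by (simp add: of_bool_def if_distrib if_distribR sum.delta' cong: if_cong)
          then show ?thesis by simp
        qed simp
      qed
      finally show "(\<Sum>\<omega>\<in>set_pmf ?run. (case x of (m, d, w) \<Rightarrow> \<Sum>t\<in>?T. ?p m d w t * of_bool (xx (m, d, w) t = \<omega>)) * L \<omega>) =
        (case x of (m, d, w) \<Rightarrow> \<Sum>t\<in>?T. ?p m d w t * L (xx (m, d, w) t))"
        by (simp add: xe)
    qed
    finally show ?thesis .
  qed
  also have "\<dots> = avg (Ms n N) (\<lambda>m. avg (Ds k n N) (\<lambda>d. minfo ?J ?T (?p m d) / ln 2))"
  proof -
    have *: "?p m d w t * L (xx (m, d, w) t) = ?p m d w t * ln (?p m d w t / avg ?J (\<lambda>w. ?p m d w t)) / ln 2" for m d w t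
      by (simp add: L_def xx_def log_def kt_def tker_def)
    show ?thesis unfolding avg_Times minfo_def avg_divide[symmetric] sum_divide_distrib by (simp add: *)
  qed
  finally show ?thesis by (simp add: avg_divide)
qed

section \<open>The special bits solve gap orthogonality\<close>

text \<open>With \<open>4 \<le> k\<close> the half \<open>k div 2\<close> is at least 2, so the
  single 1 of an ordinary coordinate never counts; as powers of 2, both \<open>k\<close> and its
  half can be merged by the binary tree.\<close>

locale btx_protocol =
  fixes k n N a :: nat and coins :: "nat \<Rightarrow> nat pmf" and P :: protocol
  assumes k_pow: "k = 2 ^ a" and k4: "4 \<le> k" and n1: "1 \<le> n" and speakers: "speakers P \<subseteq> {..<k}"
begin

abbreviation "T \<equiv> transcripts P"

definition "E = {..<N} \<times> {..<n}"
definition "S = {..<N} \<times> {n, Suc n}"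
definition "ker B t = (\<Prod>i<k. site_prob coins P i t (B i))"
text \<open>The ordinary latent bits read by site \<open>i\<close>. These sets are disjoint for
  different sites, which keeps the transcript law a product after averaging.\<close>

definition "Dd d i = {(j, l). (j, l) \<in> E \<and> d j l = (i::nat)}"

lemma kn0: "0 < k" "0 < n" using k4 n1 by auto

lemma finE [simp]: "finite E" and finS [simp]: "finite S" by (simp_all add: E_def S_def)

lemma SE: "Js n N = S \<union> E" "S \<inter> E = {}"
  by (auto simp: Js_def S_def E_def)

lemma PowE_ne: "Pow E \<noteq> {}" by auto

lemma ker_pmf: "t \<in> T \<Longrightarrow> ker B t = pmf (transcript_pmf k coins P B) t"
  unfolding ker_def by (rule pmf_transcript[OF speakers, symmetric])

lemma ker_nonneg: "0 \<le> ker B t"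
  unfolding ker_def site_prob_def by (intro prod_nonneg) simp

lemma ker_sum: "(\<Sum>t\<in>T. ker B t) = 1"
  using sum_pmf_transcript[where P = P and k = k and coins = coins and B = B] ker_pmf by simp

lemma tker_ker: "t \<in> T \<Longrightarrow> tker k n N coins P m d w t = ker (inp k n N m d w) t"
  unfolding tker_def by (simp add: ker_pmf)

lemma avg_ker_sum: "finite \<Omega> \<Longrightarrow> \<Omega> \<noteq> {} \<Longrightarrow> (\<Sum>t\<in>T. avg \<Omega> (\<lambda>x. ker (B x) t)) = 1"
  unfolding avg_sum[symmetric] ker_sum by (rule avg_const)

lemma ker_avg_product:
  assumes "\<And>i C. C \<subseteq> E \<Longrightarrow> B C i = B (C \<inter> Dd d i) i"
  shows "avg (Pow E) (\<lambda>C. ker (B C) t) = (\<Prod>i<k. avg (Pow E) (\<lambda>C. site_prob coins P i t (B (C \<inter> Dd d i) i)))"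
proof -
  have "avg (Pow E) (\<lambda>C. ker (B C) t) = avg (Pow E) (\<lambda>C. \<Prod>i<k. site_prob coins P i t (B (C \<inter> Dd d i) i))"
    unfolding ker_def
  proof (rule avg_cong[OF refl])
    fix C assume "C \<in> Pow E"
    then have "B C i = B (C \<inter> Dd d i) i" for i using assms by blast
    then show "(\<Prod>i<k. site_prob coins P i t (B C i)) = (\<Prod>i<k. site_prob coins P i t (B (C \<inter> Dd d i) i))"
      by metis
  qed
  also have "\<dots> = (\<Prod>i<k. avg (Pow E) (\<lambda>C. site_prob coins P i t (B (C \<inter> Dd d i) i)))"
    by (rule avg_Pow_indep_prod[where f = "\<lambda>i C. site_prob coins P i t (B C i)"]) (auto simp: Dd_def)
  finally show ?thesis .
qed

definition "pS m d A t = avg (Pow E) (\<lambda>C. tker k n N coins P m d (A \<union> C) t)"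

lemma pS_ker: "t \<in> T \<Longrightarrow> pS m d A t = avg (Pow E) (\<lambda>C. ker (inp k n N m d (A \<union> C)) t)"
  unfolding pS_def by (simp add: tker_ker)

definition "emb X Y = X \<times> {n} \<union> Y \<times> {Suc n}"

lemma emb_bij: "bij_betw (\<lambda>(X, Y). emb X Y) (Pow {..<N} \<times> Pow {..<N}) (Pow S)"
proof (rule bij_betw_byWitness[where f' = "\<lambda>A. ({j. (j, n) \<in> A}, {j. (j, Suc n) \<in> A})"])
  show "\<forall>A\<in>Pow S. (\<lambda>(X, Y). emb X Y) ({j. (j, n) \<in> A}, {j. (j, Suc n) \<in> A}) = A"
    by (auto simp: emb_def S_def)
qed (auto simp: emb_def S_def)

lemma inp_emb:
  assumes "C \<subseteq> E"
  shows "i < k div 2 \<Longrightarrow> inp k n N m d (emb X Y \<union> C) i = inp k n N m d (emb X {} \<union> (C \<inter> Dd d i)) i"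
    and "\<not> i < k div 2 \<Longrightarrow> inp k n N m d (emb X Y \<union> C) i = inp k n N m d (emb {} Y \<union> (C \<inter> Dd d i)) i"
  using assms by (auto simp: inp_def emb_def Dd_def E_def fun_eq_iff)

text \<open>Sites of the first half see only the special bits \<open>X\<close>, those of the second
  half only \<open>Y\<close>; grouping the factors by halves gives the two-party product kernel of
  gap orthogonality.\<close>

lemma pS_product:
  "\<exists>f g. (\<forall>t\<in>T. \<forall>X. 0 \<le> f t X) \<and> (\<forall>t\<in>T. \<forall>Y. 0 \<le> g t Y) \<and> (\<forall>t\<in>T. \<forall>X Y. pS m d (emb X Y) t = f t X * (g t Y :: real))"
proof -
  define f where "f t X = (\<Prod>i<k div 2. avg (Pow E) (\<lambda>C. site_prob coins P i t (inp k n N m d (emb X {} \<union> (C \<inter> Dd d i)) i)))" for t X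
  define g where "g t Y = (\<Prod>i\<in>{k div 2..<k}. avg (Pow E) (\<lambda>C. site_prob coins P i t (inp k n N m d (emb {} Y \<union> (C \<inter> Dd d i)) i)))" for t Y
  have "pS m d (emb X Y) t = f t X * g t Y" if t: "t \<in> T" for t X Y
  proof -
    have dep: "inp k n N m d (emb X Y \<union> C) i = inp k n N m d (emb X Y \<union> (C \<inter> Dd d i)) i" if "C \<subseteq> E" for i C
      using that by (auto simp: inp_def emb_def Dd_def E_def fun_eq_iff)
    have "pS m d (emb X Y) t = (\<Prod>i<k. avg (Pow E) (\<lambda>C. site_prob coins P i t (inp k n N m d (emb X Y \<union> (C \<inter> Dd d i)) i)))"
      unfolding pS_ker[OF t] by (rule ker_avg_product) (rule dep)
    also have "{..<k} = {..<k div 2} \<union> {k div 2..<k}" by auto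
    also have "(\<Prod>i\<in>{..<k div 2} \<union> {k div 2..<k}. avg (Pow E) (\<lambda>C. site_prob coins P i t (inp k n N m d (emb X Y \<union> (C \<inter> Dd d i)) i))) =
      (\<Prod>i<k div 2. avg (Pow E) (\<lambda>C. site_prob coins P i t (inp k n N m d (emb X Y \<union> (C \<inter> Dd d i)) i))) *
      (\<Prod>i\<in>{k div 2..<k}. avg (Pow E) (\<lambda>C. site_prob coins P i t (inp k n N m d (emb X Y \<union> (C \<inter> Dd d i)) i)))"
      by (rule prod.union_disjoint) auto
    also have "\<dots> = f t X * g t Y"
      unfolding f_def g_def
    proof (intro arg_cong2[where f = "(*)"] prod.cong refl avg_cong)
      fix i C assume "C \<in> Pow E"
      then have CE: "C \<inter> Dd d i \<subseteq> E" by auto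
      show "site_prob coins P i t (inp k n N m d (emb X Y \<union> (C \<inter> Dd d i)) i) = site_prob coins P i t (inp k n N m d (emb X {} \<union> (C \<inter> Dd d i)) i)"
        if "i \<in> {..<k div 2}"
        using inp_emb(1)[OF CE, of i m d X Y] that by simp
      show "site_prob coins P i t (inp k n N m d (emb X Y \<union> (C \<inter> Dd d i)) i) = site_prob coins P i t (inp k n N m d (emb {} Y \<union> (C \<inter> Dd d i)) i)"
        if "i \<in> {k div 2..<k}"
        using inp_emb(2)[OF CE, of i m d X Y] that by simp
    qed
    finally show ?thesis .
  qed
  moreover have "0 \<le> f t X" "0 \<le> g t X" for t X
    unfolding f_def g_def site_prob_def by (intro prod_nonneg avg_nonneg ballI; simp)+
  ultimately show ?thesis by (intro exI[of _ f] exI[of _ g]) auto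
qed

text \<open>The special column has 0, \<open>k div 2\<close> or \<open>k\<close> ones according to
  its two bits; an ordinary column has at most one, and \<open>k div 2 \<ge> 2\<close>.\<close>

lemma k_XOR_inp:
  assumes m: "m \<in> Ms n N" and j: "j < N" and C: "C \<subseteq> E"
  shows "k_XOR k n (\<lambda>i l. inp k n N m d (emb X Y \<union> C) i j l) \<longleftrightarrow> (j \<in> X) \<noteq> (j \<in> Y)"
proof -
  define b where "b = (\<lambda>i l. inp k n N m d (emb X Y \<union> C) i j l)"
  have mj: "m j < n" using m j by (auto simp: Ms_def PiE_dflt_def)
  have half: "k div 2 + k div 2 = k" "2 \<le> k div 2"
  proof -
    have "even k" using k_pow k4 by (cases a) auto
    then show "k div 2 + k div 2 = k" by presburger
    show "2 \<le> k div 2" using k4 by presburger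
  qed
  have sp: "b i (m j) \<longleftrightarrow> i < k \<and> (if i < k div 2 then j \<in> X else j \<in> Y)" for i
    using j mj C by (auto simp: b_def inp_def emb_def E_def)
  have "card {i. i < k \<and> b i (m j)} = k div 2 \<longleftrightarrow> (j \<in> X) \<noteq> (j \<in> Y)"
  proof -
    have "{i. i < k \<and> b i (m j)} = (if j \<in> X then {..<k div 2} else {}) \<union> (if j \<in> Y then {k div 2..<k} else {})"
      using half by (auto simp: sp)
    moreover have "card {k div 2..<k} = k div 2" using half by simp
    moreover have "card ({..<k div 2} \<union> {k div 2..<k}) = k div 2 + k div 2"
      using half by (subst card_Un_disjoint) auto
    ultimately show ?thesis using half by auto
  qed
  moreover have "card {i. i < k \<and> b i l} \<noteq> k div 2" if "l \<noteq> m j" for l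
  proof -
    have "{i. i < k \<and> b i l} \<subseteq> {d j l}" using that by (auto simp: b_def inp_def)
    then have "card {i. i < k \<and> b i l} \<le> card {d j l}" by (intro card_mono) auto
    then show ?thesis using half by simp
  qed
  ultimately show ?thesis unfolding k_XOR_def b_def[symmetric] using mj by metis
qed

text \<open>With \<open>ip\<close> the inner product, \<open>(N - ip) / 2\<close> blocks have value
  1, so the deviation is \<open>\<bar>ip\<bar> / 2\<close>, and
  \<open>1 / \<epsilon> = sqrt N\<close>.\<close>

lemma answer_inp:
  assumes m: "m \<in> Ms n N" and C: "C \<subseteq> E" and XY: "X \<subseteq> {..<N}" "Y \<subseteq> {..<N}"
    and \<epsilon>: "0 < \<epsilon>" "1 / \<epsilon>\<^sup>2 = real N"
  shows "\<not> k_BTX_answer k n N \<epsilon> (inp k n N m d (emb X Y \<union> C)) v \<longleftrightarrow>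
    (4 * sqrt N \<le> \<bar>ip {..<N} (sgv X) (sgv Y)\<bar> \<and> \<not> v) \<or> (\<bar>ip {..<N} (sgv X) (sgv Y)\<bar> \<le> 2 * sqrt N \<and> v)"
proof -
  have "(1 / \<epsilon>)\<^sup>2 = real N" using \<epsilon> by (simp add: power_divide)
  then have eps: "1 / \<epsilon> = sqrt N" using \<epsilon> by (metis less_imp_le real_sqrt_unique zero_le_divide_1_iff)
  then have eps2: "2 / \<epsilon> = 2 * sqrt N" by (metis mult.right_neutral times_divide_eq_right)
  define x where "x = (\<Sum>j<N. of_bool ((j \<in> X) \<noteq> (j \<in> Y)) :: real)"
  have "btx_deviation k n N \<epsilon> (inp k n N m d (emb X Y \<union> C)) = \<bar>x - 1 / (2 * \<epsilon>\<^sup>2)\<bar>"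
    unfolding btx_deviation_def x_def using k_XOR_inp[OF m _ C] by simp
  also have "1 / (2 * \<epsilon>\<^sup>2) = real N / 2" using \<epsilon>(2) by (simp add: divide_simps)
  also have "\<bar>x - real N / 2\<bar> = \<bar>ip {..<N} (sgv X) (sgv Y)\<bar> / 2"
  proof -
    have "ip {..<N} (sgv X) (sgv Y) = (\<Sum>j<N. 1 - 2 * of_bool ((j \<in> X) \<noteq> (j \<in> Y)))"
      unfolding ip_def by (intro sum.cong refl) (auto simp: sg_def)
    also have "\<dots> = real N - 2 * x" by (simp add: x_def sum_subtractf sum_distrib_left)
    finally show ?thesis by (simp add: abs_if)
  qed
  finally have dev: "btx_deviation k n N \<epsilon> (inp k n N m d (emb X Y \<union> C)) = \<bar>ip {..<N} (sgv X) (sgv Y)\<bar> / 2" .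
  show ?thesis unfolding k_BTX_answer_def dev eps eps2 by auto
qed

lemma avg_Js: "avg (Pow (Js n N)) f = avg (Pow S) (\<lambda>A. avg (Pow E) (\<lambda>C. f (A \<union> C)))"
  unfolding SE(1) by (rule avg_Pow_union) (use SE in auto)

lemma btx_error_eq:
  assumes \<epsilon>: "0 < \<epsilon>" "1 / \<epsilon>\<^sup>2 = real N"
  shows "btx_error k n N \<epsilon> coins P = avg (Ms n N) (\<lambda>m. avg (Ds k n N) (\<lambda>d.
    ort_error {..<N} T (protocol_output P) (\<lambda>(X, Y) t. pS m d (emb X Y) t)))"
proof -
  have "btx_error k n N \<epsilon> coins P = avg (Ms n N) (\<lambda>m. avg (Ds k n N) (\<lambda>d. avg (Pow S) (\<lambda>A. avg (Pow E) (\<lambda>C.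
     \<Sum>t\<in>T. tker k n N coins P m d (A \<union> C) t * of_bool (\<not> k_BTX_answer k n N \<epsilon> (inp k n N m d (A \<union> C)) (protocol_output P t))))))"
    unfolding btx_error_def prob_run[OF kn0] avg_Times by (simp add: avg_Js)
  also have "\<dots> = avg (Ms n N) (\<lambda>m. avg (Ds k n N) (\<lambda>d. avg (Pow {..<N} \<times> Pow {..<N}) (\<lambda>(X, Y). avg (Pow E) (\<lambda>C.
     \<Sum>t\<in>T. tker k n N coins P m d (emb X Y \<union> C) t * of_bool (\<not> k_BTX_answer k n N \<epsilon> (inp k n N m d (emb X Y \<union> C)) (protocol_output P t))))))"
    unfolding avg_bij[OF emb_bij] by (simp add: case_prod_unfold)
  also have "\<dots> = avg (Ms n N) (\<lambda>m. avg (Ds k n N) (\<lambda>d.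
    ort_error {..<N} T (protocol_output P) (\<lambda>(X, Y) t. pS m d (emb X Y) t)))"
    unfolding ort_error_def
  proof (intro avg_cong refl)
    fix m d x assume m: "m \<in> Ms n N" and x: "x \<in> Pow {..<N} \<times> Pow {..<N}"
    obtain X Y where xe: "x = (X, Y)" "X \<subseteq> {..<N}" "Y \<subseteq> {..<N}" using x by auto
    let ?w = "\<lambda>t. of_bool ((4 * sqrt (card {..<N}) \<le> \<bar>ip {..<N} (sgv X) (sgv Y)\<bar> \<and> \<not> protocol_output P t) \<or>
       (\<bar>ip {..<N} (sgv X) (sgv Y)\<bar> \<le> 2 * sqrt (card {..<N}) \<and> protocol_output P t)) :: real"
    have "avg (Pow E) (\<lambda>C. \<Sum>t\<in>T. tker k n N coins P m d (emb X Y \<union> C) t * of_bool (\<not> k_BTX_answer k n N \<epsilon> (inp k n N m d (emb X Y \<union> C)) (protocol_output P t))) =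
      avg (Pow E) (\<lambda>C. \<Sum>t\<in>T. tker k n N coins P m d (emb X Y \<union> C) t * ?w t)"
      by (intro avg_cong refl sum.cong arg_cong2[where f = "(*)"] arg_cong[where f = of_bool])
        (use answer_inp[OF m _ xe(2,3) \<epsilon>] in simp)
    also have "\<dots> = (\<Sum>t\<in>T. pS m d (emb X Y) t * ?w t)"
      unfolding pS_def by (simp only: avg_sum avg_multc)
    finally show "(case x of (X, Y) \<Rightarrow> avg (Pow E) (\<lambda>C. \<Sum>t\<in>T. tker k n N coins P m d (emb X Y \<union> C) t * of_bool (\<not> k_BTX_answer k n N \<epsilon> (inp k n N m d (emb X Y \<union> C)) (protocol_output P t)))) =
      (case x of (A, B) \<Rightarrow> \<Sum>t\<in>T. (case (A, B) of (X, Y) \<Rightarrow> pS m d (emb X Y)) t * of_bool ((4 * sqrt (card {..<N}) \<le> \<bar>ip {..<N} (sgv A) (sgv B)\<bar> \<and> \<not> protocol_output P t) \<or>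
       (\<bar>ip {..<N} (sgv A) (sgv B)\<bar> \<le> 2 * sqrt (card {..<N}) \<and> protocol_output P t)))"
      unfolding xe(1) by simp
  qed
  finally show ?thesis .
qed

lemma minfo_emb: "minfo (Pow S) T (pS m d) = minfo (Pow {..<N} \<times> Pow {..<N}) T (\<lambda>(X, Y) t. pS m d (emb X Y) t)"
  unfolding minfo_def avg_bij[OF emb_bij] by (simp add: case_prod_unfold)

lemma pS_nonneg: "0 \<le> pS m d A t"
  unfolding pS_def tker_def by (intro avg_nonneg) simp

lemma pS_sum: "(\<Sum>t\<in>T. pS m d A t) = 1"
proof -
  have "(\<Sum>t\<in>T. pS m d A t) = (\<Sum>t\<in>T. avg (Pow E) (\<lambda>C. ker (inp k n N m d (A \<union> C)) t))"
    by (intro sum.cong refl pS_ker)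
  also have "\<dots> = 1" by (rule avg_ker_sum) auto
  finally show ?thesis .
qed

text \<open>In nats: \<open>info\<close> concerns all latent bits, \<open>infoS\<close> the special
  ones with the others averaged out.\<close>

definition "info = avg (Ms n N) (\<lambda>m. avg (Ds k n N) (\<lambda>d. minfo (Pow (Js n N)) T (tker k n N coins P m d)))"
definition "infoS = avg (Ms n N) (\<lambda>m. avg (Ds k n N) (\<lambda>d. minfo (Pow S) T (pS m d)))"
definition "pe m d A e b t = avg (Pow E) (\<lambda>C. tker k n N coins P m d (A \<union> bitset e b C) t)"

lemma minfo_split:
  "minfo (Pow S) T (pS m d) + avg (Pow S) (\<lambda>A. \<Sum>e\<in>E. hdist T (pe m d A e False) (pe m d A e True) / 4)
     \<le> minfo (Pow (Js n N)) T (tker k n N coins P m d)"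
proof -
  have "minfo (Pow S) T (\<lambda>A t. avg (Pow E) (\<lambda>C. tker k n N coins P m d (A \<union> C) t)) +
    avg (Pow S) (\<lambda>A. \<Sum>e\<in>E. hdist T (\<lambda>t. avg (Pow E) (\<lambda>C. tker k n N coins P m d (A \<union> bitset e False C) t))
      (\<lambda>t. avg (Pow E) (\<lambda>C. tker k n N coins P m d (A \<union> bitset e True C) t)) / 4)
    \<le> minfo (Pow (S \<union> E)) T (tker k n N coins P m d)"
    by (rule minfo_bits_lower) (use SE finite_transcripts sum_pmf_transcript in \<open>auto simp: tker_def\<close>)
  then show ?thesis unfolding SE(1) pS_def[abs_def] pe_def[abs_def] .
qed

lemma info_ge_infoS: "infoS \<le> info"
  unfolding info_def infoS_def
proof (intro avg_mono)
  fix m d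
  have "0 \<le> avg (Pow S) (\<lambda>A. \<Sum>e\<in>E. hdist T (pe m d A e False) (pe m d A e True) / 4)"
    by (intro avg_nonneg sum_nonneg) (simp add: hdist_nonneg)
  then show "minfo (Pow S) T (pS m d) \<le> minfo (Pow (Js n N)) T (tker k n N coins P m d)"
    using minfo_split[of m d] by linarith
qed

lemma infoS_nonneg: "0 \<le> infoS"
  unfolding infoS_def by (intro avg_nonneg minfo_nonneg) (use finite_transcripts pS_nonneg pS_sum in auto)

text \<open>The bound for fixed \<open>m\<close>, \<open>d\<close> is affine in the conditional
  error, so its average involves just the overall error.\<close>

lemma infoS_lower:
  assumes ort: "\<forall>(J :: nat set) (T :: bool list set) f g out. finite J \<longrightarrow> 16 \<le> card J \<longrightarrow> finite T \<longrightarrow>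
     (\<forall>t\<in>T. \<forall>A\<in>Pow J. 0 \<le> f t A) \<longrightarrow> (\<forall>t\<in>T. \<forall>A\<in>Pow J. 0 \<le> g t A) \<longrightarrow>
     (\<forall>A\<in>Pow J. \<forall>B\<in>Pow J. (\<Sum>t\<in>T. f t A * g t B) = 1) \<longrightarrow>
     real (card J) * (c - K * ort_error J T out (\<lambda>(A, B) t. f t A * g t B)) \<le> minfo (Pow J \<times> Pow J) T (\<lambda>(A, B) t. f t A * g t B)"
    and N: "16 \<le> N" and \<epsilon>: "0 < \<epsilon>" "1 / \<epsilon>\<^sup>2 = real N"
  shows "real N * (c - K * btx_error k n N \<epsilon> coins P) \<le> infoS"
proof -
  let ?e = "\<lambda>m d. ort_error {..<N} T (protocol_output P) (\<lambda>(X, Y) t. pS m d (emb X Y) t)"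
  have each: "real N * (c - K * ?e m d) \<le> minfo (Pow S) T (pS m d)" for m d
  proof -
    obtain f g where fg: "\<forall>t\<in>T. \<forall>X. 0 \<le> f t X" "\<forall>t\<in>T. \<forall>Y. 0 \<le> g t Y" "\<forall>t\<in>T. \<forall>X Y. pS m d (emb X Y) t = f t X * g t Y"
      using pS_product by blast
    have one: "(\<Sum>t\<in>T. f t X * g t Y) = 1" for X Y using pS_sum[of m d "emb X Y"] fg(3) by simp
    have "real (card {..<N}) * (c - K * ort_error {..<N} T (protocol_output P) (\<lambda>(A, B) t. f t A * g t B)) \<le>
       minfo (Pow {..<N} \<times> Pow {..<N}) T (\<lambda>(A, B) t. f t A * g t B)"
      by (rule ort[rule_format]) (use N fg one finite_transcripts in auto)
    moreover have "ort_error {..<N} T (protocol_output P) (\<lambda>(A, B) t. f t A * g t B) = ?e m d"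
      unfolding ort_error_def using fg(3) by (intro avg_cong refl) (auto intro!: sum.cong)
    moreover have "minfo (Pow {..<N} \<times> Pow {..<N}) T (\<lambda>(A, B) t. f t A * g t B) = minfo (Pow S) T (pS m d)"
      unfolding minfo_emb unfolding minfo_def
    proof (intro avg_cong refl sum.cong)
      fix x t assume t: "t \<in> T"
      have *: "(case x of (A, B) \<Rightarrow> \<lambda>t. f t A * g t B) t = (case x of (X, Y) \<Rightarrow> pS m d (emb X Y)) t" for x
        using fg(3) t by (cases x) auto
      show "(case x of (A, B) \<Rightarrow> \<lambda>t. f t A * g t B) t * ln ((case x of (A, B) \<Rightarrow> \<lambda>t. f t A * g t B) t / avg (Pow {..<N} \<times> Pow {..<N}) (\<lambda>w. (case w of (A, B) \<Rightarrow> \<lambda>t. f t A * g t B) t)) =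
        (case x of (X, Y) \<Rightarrow> pS m d (emb X Y)) t * ln ((case x of (X, Y) \<Rightarrow> pS m d (emb X Y)) t / avg (Pow {..<N} \<times> Pow {..<N}) (\<lambda>w. (case w of (X, Y) \<Rightarrow> pS m d (emb X Y)) t))"
        unfolding * ..
    qed
    ultimately show ?thesis by simp
  qed
  have "avg (Ms n N) (\<lambda>m. avg (Ds k n N) (\<lambda>d. real N * (c - K * ?e m d))) \<le> infoS"
    unfolding infoS_def by (intro avg_mono each)
  moreover have "avg (Ms n N) (\<lambda>m. avg (Ds k n N) (\<lambda>d. real N * (c - K * ?e m d))) = real N * (c - K * btx_error k n N \<epsilon> coins P)"
    unfolding btx_error_eq[OF \<epsilon>] using Ms_nonempty[OF kn0(2)] Ds_nonempty[OF kn0(1)]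
    by (simp add: avg_cmult avg_diff avg_const)
  ultimately show ?thesis by simp
qed

end

section \<open>Moving the special coordinate\<close>

text \<open>Exchanging the current value of a component with a fresh one is an involution of
  \<open>\<Omega> \<times> B\<close>, so redrawing a uniform component preserves the mean.\<close>

lemma avg_resample:
  assumes "finite B" "B \<noteq> {}"
    and upd: "\<And>x b. x \<in> \<Omega> \<Longrightarrow> b \<in> B \<Longrightarrow> upd x b \<in> \<Omega>" and get: "\<And>x. x \<in> \<Omega> \<Longrightarrow> get x \<in> B"
    and gu: "\<And>x b. x \<in> \<Omega> \<Longrightarrow> b \<in> B \<Longrightarrow> get (upd x b) = b" and uu: "\<And>x b. x \<in> \<Omega> \<Longrightarrow> b \<in> B \<Longrightarrow> upd (upd x b) (get x) = x"
  shows "avg \<Omega> f = avg \<Omega> (\<lambda>x. avg B (\<lambda>b. f (upd x b)))"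
proof -
  have bij: "bij_betw (\<lambda>(x, b). (upd x b, get x)) (\<Omega> \<times> B) (\<Omega> \<times> B)"
    by (rule bij_betw_byWitness[where f' = "\<lambda>(x, b). (upd x b, get x)"]) (use assms in auto)
  have "avg \<Omega> f = avg \<Omega> (\<lambda>x. avg B (\<lambda>b. f x))" using assms by (simp add: avg_const)
  also have "\<dots> = avg (\<Omega> \<times> B) (\<lambda>x. f (fst x))" by (simp add: avg_Times)
  also have "\<dots> = avg (\<Omega> \<times> B) (\<lambda>x. f (fst ((\<lambda>(x, b). (upd x b, get x)) x)))" by (rule avg_bij[OF bij])
  also have "\<dots> = avg \<Omega> (\<lambda>x. avg B (\<lambda>b. f (upd x b)))" by (simp add: avg_Times)
  finally show ?thesis .
qed

lemma avg_Ms_resample: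
  assumes "j < N" "0 < n"
  shows "avg (Ms n N) f = avg (Ms n N) (\<lambda>m. avg {..<n} (\<lambda>l. f (m(j := l))))"
  by (rule avg_resample[where get = "\<lambda>m. m j"]) (use assms in \<open>auto simp: Ms_def PiE_dflt_def\<close>)

lemma avg_Ds_resample:
  assumes "j < N" "l < n" "0 < k"
  shows "avg (Ds k n N) f = avg (Ds k n N) (\<lambda>d. avg {..<k} (\<lambda>i. f (d(j := (d j)(l := i)))))"
  by (rule avg_resample[where get = "\<lambda>d. d j l"]) (use assms in \<open>auto simp: Ds_def PiE_dflt_def\<close>)

section \<open>Transcript laws with one column forced\<close>

context btx_protocol
begin

definition over :: "input \<Rightarrow> nat \<Rightarrow> nat \<Rightarrow> nat set \<Rightarrow> input" where
  "over B j l c = (\<lambda>i j' l'. if j' = j \<and> l' = l then i \<in> c else B i j' l')"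

definition "V m d A j l c t = avg (Pow E) (\<lambda>C. ker (over (inp k n N m d (A \<union> C)) j l c) t)"
definition "col bb = {i. i < k \<and> (if i < k div 2 then fst bb else snd bb)}"
text \<open>Clearing the special bits of block \<open>j\<close> makes its special coordinate a zero
  column, which looks like an ordinary coordinate without a 1.\<close>

definition "strip j A = A - {(j, n), (j, Suc n)}"
definition "aset j bb = (if fst bb then {(j, n)} else {}) \<union> (if snd bb then {(j, Suc n)} else {})"
definition "BB = {(True, False), (False, True), (True, True)}"
text \<open>The link between both kinds of coordinates: up to constants it dominates the effect of a
  full special column, and its mean over the sites is a lower bound for the information about an
  ordinary bit.\<close>

definition "Hs m d A j l = (\<Sum>i<k. hdist T (V m d A j l {}) (V m d A j l {i}))"
definition "tv m d A j l bb = (\<Sum>t\<in>T. \<bar>V m d (strip j A) j l (col bb) t - V m d (strip j A) j l {} t\<bar>)"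
definition "\<Psi> j l m = avg (Ds k n N) (\<lambda>d. avg (Pow S) (\<lambda>A. Hs m d (strip j A) j l))"

lemma V_nonneg: "0 \<le> V m d A j l c t"
  unfolding V_def by (intro avg_nonneg ker_nonneg)

lemma V_sum: "(\<Sum>t\<in>T. V m d A j l c t) = 1"
  unfolding V_def by (rule avg_ker_sum) auto

lemma strip_sub: "A \<subseteq> S \<Longrightarrow> strip j A \<subseteq> S" by (auto simp: strip_def)

lemma V_product: "V m d A j l c t = (\<Prod>i<k. avg (Pow E) (\<lambda>C. site_prob coins P i t
    (\<lambda>j' l'. if j' = j \<and> l' = l then i \<in> c else inp k n N m d (A \<union> (C \<inter> Dd d i)) i j' l')))"
  if "A \<subseteq> S"
proof -
  have dep: "over (inp k n N m d (A \<union> C)) j l c i = over (inp k n N m d (A \<union> (C \<inter> Dd d i))) j l c i" if "C \<subseteq> E" for i C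
    using that \<open>A \<subseteq> S\<close> by (auto simp: over_def inp_def Dd_def E_def fun_eq_iff)
  show ?thesis unfolding V_def using ker_avg_product[of "\<lambda>C. over (inp k n N m d (A \<union> C)) j l c" d t, OF dep]
    by (simp add: over_def)
qed

text \<open>A nonzero special column consists of \<open>k div 2\<close> or \<open>k\<close> sites, a
  power of 2, so \<open>hdist_product_family\<close> applies to the product form of
  \<open>V\<close>.\<close>

lemma Hs_tree:
  assumes A: "A \<subseteq> S" and bb: "bb \<in> BB"
  shows "hdist T (V m d A j l {}) (V m d A j l (col bb)) \<le> 4 * Hs m d A j l"
proof -
  have even: "k div 2 + k div 2 = k" and half: "\<exists>b. k div 2 = 2 ^ b"
    using k_pow k4 by (cases a; auto)+
  have "\<exists>b. card (col bb) = 2 ^ b"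
  proof -
    have "col bb = {..<k div 2} \<or> col bb = {k div 2..<k} \<or> col bb = {..<k}"
      using bb even by (auto simp: BB_def col_def)
    moreover have "card {k div 2..<k} = k div 2" using even by simp
    ultimately show ?thesis using half k_pow by auto
  qed
  then obtain b where b: "card (col bb) = 2 ^ b" by auto
  have "hdist T (V m d A j l {}) (V m d A j l (col bb)) \<le> 4 * (\<Sum>i\<in>col bb. hdist T (V m d A j l {}) (V m d A j l {i}))"
  proof (rule hdist_product_family[where I = "{..<k}" and q = "\<lambda>i t b. avg (Pow E) (\<lambda>C. site_prob coins P i t
    (\<lambda>j' l'. if j' = j \<and> l' = l then b else inp k n N m d (A \<union> (C \<inter> Dd d i)) i j' l'))"])
    show "V m d A j l c t = (\<Prod>i\<in>{..<k}. avg (Pow E) (\<lambda>C. site_prob coins P i t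
       (\<lambda>j' l'. if j' = j \<and> l' = l then i \<in> c else inp k n N m d (A \<union> (C \<inter> Dd d i)) i j' l')))" for c t
      by (rule V_product[OF A])
    show "card (col bb) = 2 ^ b" by (rule b)
  qed (auto simp: finite_transcripts V_sum col_def site_prob_def intro!: avg_nonneg)
  also have "(\<Sum>i\<in>col bb. hdist T (V m d A j l {}) (V m d A j l {i})) \<le> Hs m d A j l"
    unfolding Hs_def by (intro sum_mono2 hdist_nonneg) (auto simp: col_def)
  finally show ?thesis by simp
qed

lemma tv_le_Hs:
  assumes A: "A \<subseteq> S" and bb: "bb \<in> BB" and \<tau>: "0 < \<tau>"
  shows "tv m d A j l bb \<le> \<tau> + 4 * Hs m d (strip j A) j l / \<tau>"
proof -
  have "tv m d A j l bb \<le> \<tau> + hdist T (V m d (strip j A) j l (col bb)) (V m d (strip j A) j l {}) / \<tau>"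
    unfolding tv_def by (rule l1_le_hdist) (use finite_transcripts V_nonneg V_sum \<tau> in auto)
  also have "hdist T (V m d (strip j A) j l (col bb)) (V m d (strip j A) j l {}) \<le> 4 * Hs m d (strip j A) j l"
    using Hs_tree[OF strip_sub[OF A] bb] by (simp add: hdist_def power2_commute)
  finally show ?thesis using \<tau> by (simp add: divide_right_mono)
qed

lemma pS_V:
  assumes "j < N" "m j < n" "t \<in> T"
  shows "pS m d (strip j A \<union> aset j bb) t = V m d (strip j A) j (m j) (col bb) t"
  unfolding pS_ker[OF assms(3)] V_def
proof (intro avg_cong refl arg_cong2[where f = ker])
  fix C assume "C \<in> Pow E"
  then have "(j', n) \<notin> C" "(j', Suc n) \<notin> C" for j' by (auto simp: E_def)
  then show "inp k n N m d (strip j A \<union> aset j bb \<union> C) = over (inp k n N m d (strip j A \<union> C)) j (m j) (col bb)"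
    using assms by (auto simp: inp_def over_def strip_def aset_def col_def fun_eq_iff)
qed

text \<open>Away from the special coordinate, the latent bit \<open>(j, l)\<close> decides between
  the zero column and the unit column of its owner \<open>d j l\<close>: its information is governed
  by one of the distances in \<open>Hs\<close>.\<close>

lemma pe_V:
  assumes "j < N" "l < n" "l \<noteq> m j" "A \<subseteq> S" "d j l < k" "t \<in> T"
  shows "pe m d A (j, l) b t = V m d A j l (if b then {d j l} else {}) t"
proof -
  have "pe m d A (j, l) b t = avg (Pow E) (\<lambda>C. ker (inp k n N m d (A \<union> bitset (j, l) b C)) t)"
    unfolding pe_def using assms(6) by (simp add: tker_ker)
  also have "\<dots> = V m d A j l (if b then {d j l} else {}) t"
    unfolding V_def
  proof (intro avg_cong refl arg_cong2[where f = ker])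
    fix C assume "C \<in> Pow E"
    have "(j, l) \<notin> A" using assms by (auto simp: S_def)
    then show "inp k n N m d (A \<union> bitset (j, l) b C) = over (inp k n N m d (A \<union> C)) j l (if b then {d j l} else {})"
      using assms by (auto simp: inp_def over_def bitset_def fun_eq_iff)
  qed
  finally show ?thesis .
qed

text \<open>With cleared special bits, a special position \<open>m'\<close> is a zero column, and so
  is an ordinary \<open>m'\<close> whose bit is erased; coordinate \<open>l\<close> is overwritten
  on both sides. The two experiments thus differ by erasing one ordinary bit.\<close>

lemma V_move:
  assumes "m' \<noteq> l" "A \<subseteq> S"
  shows "V (m(j := m')) d (strip j A) j l c t =
    avg (Pow E) (\<lambda>C. ker (over (inp k n N (m(j := l)) d (strip j A \<union> (C - {(j, m')}))) j l c) t)"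
  unfolding V_def
proof (intro avg_cong refl arg_cong2[where f = ker])
  fix C assume "C \<in> Pow E"
  then have n: "(j', n) \<notin> C" "(j', Suc n) \<notin> C" for j' by (auto simp: E_def)
  have s: "(j', l') \<notin> strip j A" if "l' < n" for j' l' using assms(2) that by (auto simp: strip_def S_def)
  show "over (inp k n N (m(j := m')) d (strip j A \<union> C)) j l c = over (inp k n N (m(j := l)) d (strip j A \<union> (C - {(j, m')}))) j l c"
    using n s assms(1) by (auto simp: inp_def over_def fun_eq_iff strip_def)
qed

lemma mean_sign_small:
  assumes j: "j < N" and l: "l < n" and n2: "2 \<le> n" and \<tau>: "0 < \<tau>"
  shows "avg (Pow E) (\<lambda>C. \<bar>avg ({..<n} - {l}) (\<lambda>m'. sg (j, m') C)\<bar>) \<le> \<tau> / 2 + 1 / (2 * \<tau> * (real n - 1))"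
proof -
  define M' where "M' = {..<n} - {l}"
  define D where "D = {j} \<times> M'"
  have card: "real (card M') = real n - 1" using l by (simp add: M'_def of_nat_diff)
  have D: "D \<subseteq> E" "finite D" using j by (auto simp: D_def M'_def E_def)
  define u where "u C = avg M' (\<lambda>m'. sg (j, m') C)" for C
  have ueq: "u C = (\<Sum>e\<in>D. (1 / (real n - 1)) * sg e C)" for C
    unfolding u_def avg_def card D_def by (simp add: sum.cartesian_product' sum_divide_distrib)
  have sq: "avg (Pow E) (\<lambda>C. (u C)\<^sup>2) = 1 / (real n - 1)"
  proof -
    have "u C = u (C \<inter> D)" for C
      unfolding u_def by (rule avg_cong) (auto simp: sg_def D_def)
    then have "avg (Pow E) (\<lambda>C. (u C)\<^sup>2) = avg (Pow E) (\<lambda>C. (u (C \<inter> D))\<^sup>2)" by simp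
    also have "\<dots> = avg (Pow D) (\<lambda>C. (u C)\<^sup>2)" by (rule avg_Pow_Int) (use D in auto)
    also have "\<dots> = (\<Sum>e\<in>D. (1 / (real n - 1))\<^sup>2)"
      unfolding ueq by (rule avg_Pow_sg_square[OF D(2)])
    also have "\<dots> = (real n - 1) * (1 / (real n - 1))\<^sup>2"
      using card by (simp add: D_def card_cartesian_product)
    also have "\<dots> = 1 / (real n - 1)" using n2 by (simp add: power2_eq_square)
    finally show ?thesis .
  qed
  have "avg (Pow E) (\<lambda>C. \<bar>u C\<bar>) \<le> avg (Pow E) (\<lambda>C. \<tau> / 2 + (1 / (2 * \<tau>)) * (u C)\<^sup>2)"
  proof (rule avg_mono)
    fix C
    have "0 \<le> (\<bar>u C\<bar> - \<tau>)\<^sup>2" by simp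
    then have "2 * \<tau> * \<bar>u C\<bar> \<le> \<tau>\<^sup>2 + (u C)\<^sup>2" by (simp add: power2_diff algebra_simps)
    then have "\<bar>u C\<bar> \<le> (\<tau>\<^sup>2 + (u C)\<^sup>2) / (2 * \<tau>)" using \<tau> by (simp add: pos_le_divide_eq mult.commute)
    also have "\<dots> = \<tau> / 2 + (1 / (2 * \<tau>)) * (u C)\<^sup>2" using \<tau> by (simp add: add_divide_distrib power2_eq_square)
    finally show "\<bar>u C\<bar> \<le> \<tau> / 2 + (1 / (2 * \<tau>)) * (u C)\<^sup>2" .
  qed
  also have "\<dots> = \<tau> / 2 + 1 / (2 * \<tau>) * (1 / (real n - 1))"
    unfolding avg_add avg_cmult sq using finE PowE_ne by (subst avg_const) auto
  finally show ?thesis by (simp add: u_def M'_def)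
qed

text \<open>Forcing a uniformly random non-special coordinate to be zero hardly changes the law of the
  other coordinates, so the position of the special coordinate may be moved away from \<open>l\<close>.\<close>

lemma tv_move:
  assumes j: "j < N" and l: "l < n" and n2: "2 \<le> n" and \<tau>: "0 < \<tau>" and A: "A \<subseteq> S"
  shows "tv (m(j := l)) d A j l bb \<le>
    avg ({..<n} - {l}) (\<lambda>m'. tv (m(j := m')) d A j l bb) + (\<tau> + 1 / (\<tau> * (real n - 1)))"
proof -
  define M' where "M' = {..<n} - {l}"
  have M': "finite M'" "M' \<noteq> {}"
  proof -
    have "(if l = 0 then 1 else 0) \<in> M'" using n2 by (auto simp: M'_def)
    then show "M' \<noteq> {}" by auto
  qed (simp add: M'_def)
  define X where "X c C t = ker (over (inp k n N (m(j := l)) d (strip j A \<union> C)) j l c) t" for c C t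
  define w where "w C = avg M' (\<lambda>m'. sg (j, m') C)" for C
  define W where "W m' = V (m(j := m')) d (strip j A) j l" for m'
  have Wl: "W l c t = avg (Pow E) (\<lambda>C. X c C t)" for c t by (simp add: W_def V_def X_def)
  \<comment> \<open>Erasing the bit \<open>(j, m')\<close> has density \<open>1 - sg\<close>, which
    is 0 or 2. Averaged over \<open>m'\<close> the density is \<open>1 - w C\<close>, where
    \<open>w C\<close> is a mean of \<open>n - 1\<close> independent signs and hence small on
    average.\<close>
  have mv: "avg M' (\<lambda>m'. W m' c t) = avg (Pow E) (\<lambda>C. (1 - w C) * X c C t)" for c t
  proof -
    have "avg M' (\<lambda>m'. W m' c t) = avg M' (\<lambda>m'. avg (Pow E) (\<lambda>C. (1 - sg (j, m') C) * X c C t))"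
    proof (rule avg_cong[OF refl])
      fix m' assume m': "m' \<in> M'"
      have "W m' c t = avg (Pow E) (\<lambda>C. X c (C - {(j, m')}) t)"
        unfolding W_def X_def by (rule V_move) (use m' A in \<open>auto simp: M'_def\<close>)
      also have "\<dots> = avg (Pow E) (\<lambda>C. if (j, m') \<in> C then 0 else 2 * X c C t)"
        by (rule avg_Pow_flip_out) (use m' j in \<open>auto simp: M'_def E_def\<close>)
      also have "\<dots> = avg (Pow E) (\<lambda>C. (1 - sg (j, m') C) * X c C t)"
        by (rule avg_cong) (auto simp: sg_def)
      finally show "W m' c t = avg (Pow E) (\<lambda>C. (1 - sg (j, m') C) * X c C t)" .
    qed
    also have "\<dots> = avg (Pow E) (\<lambda>C. avg M' (\<lambda>m'. (1 - sg (j, m') C) * X c C t))" by (rule avg_swap)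
    also have "\<dots> = avg (Pow E) (\<lambda>C. (1 - w C) * X c C t)"
      unfolding avg_multc avg_diff w_def using M' by (simp add: avg_const)
    finally show ?thesis .
  qed
  have split: "W l c t = avg M' (\<lambda>m'. W m' c t) + avg (Pow E) (\<lambda>C. w C * X c C t)" for c t
    unfolding Wl mv avg_add[symmetric] by (rule avg_cong) (auto simp: algebra_simps)
  have X0: "0 \<le> X c C t" for c C t unfolding X_def by (rule ker_nonneg)
  have X1: "(\<Sum>t\<in>T. X c C t) = 1" for c C unfolding X_def by (rule ker_sum)
  have "tv (m(j := l)) d A j l bb = (\<Sum>t\<in>T. \<bar>W l (col bb) t - W l {} t\<bar>)"
    by (simp add: tv_def W_def)
  also have "\<dots> \<le> (\<Sum>t\<in>T. avg M' (\<lambda>m'. \<bar>W m' (col bb) t - W m' {} t\<bar>) + avg (Pow E) (\<lambda>C. \<bar>w C\<bar> * (X (col bb) C t + X {} C t)))"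
  proof (rule sum_mono)
    fix t
    have "W l (col bb) t - W l {} t = avg M' (\<lambda>m'. W m' (col bb) t - W m' {} t) + avg (Pow E) (\<lambda>C. w C * (X (col bb) C t - X {} C t))"
      unfolding split[of "col bb"] split[of "{}"] avg_diff right_diff_distrib by simp
    also have "\<bar>\<dots>\<bar> \<le> avg M' (\<lambda>m'. \<bar>W m' (col bb) t - W m' {} t\<bar>) + avg (Pow E) (\<lambda>C. \<bar>w C * (X (col bb) C t - X {} C t)\<bar>)"
      by (intro order_trans[OF abs_triangle_ineq] add_mono avg_abs)
    also have "avg (Pow E) (\<lambda>C. \<bar>w C * (X (col bb) C t - X {} C t)\<bar>) \<le> avg (Pow E) (\<lambda>C. \<bar>w C\<bar> * (X (col bb) C t + X {} C t))"
    proof (rule avg_mono)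
      fix C
      have "\<bar>X (col bb) C t - X {} C t\<bar> \<le> X (col bb) C t + X {} C t"
        using X0[of "col bb" C t] X0[of "{}" C t] by linarith
      then show "\<bar>w C * (X (col bb) C t - X {} C t)\<bar> \<le> \<bar>w C\<bar> * (X (col bb) C t + X {} C t)"
        unfolding abs_mult by (intro mult_left_mono) auto
    qed
    finally show "\<bar>W l (col bb) t - W l {} t\<bar> \<le> avg M' (\<lambda>m'. \<bar>W m' (col bb) t - W m' {} t\<bar>) + avg (Pow E) (\<lambda>C. \<bar>w C\<bar> * (X (col bb) C t + X {} C t))"
      by simp
  qed
  also have "\<dots> = avg M' (\<lambda>m'. tv (m(j := m')) d A j l bb) + avg (Pow E) (\<lambda>C. \<bar>w C\<bar> * 2)"
  proof -
    have "(\<Sum>t\<in>T. avg (Pow E) (\<lambda>C. \<bar>w C\<bar> * (X (col bb) C t + X {} C t))) = avg (Pow E) (\<lambda>C. \<bar>w C\<bar> * 2)"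
      unfolding avg_sum[symmetric] sum_distrib_left[symmetric] sum.distrib X1 by simp
    moreover have "(\<Sum>t\<in>T. avg M' (\<lambda>m'. \<bar>W m' (col bb) t - W m' {} t\<bar>)) = avg M' (\<lambda>m'. tv (m(j := m')) d A j l bb)"
      unfolding avg_sum[symmetric] tv_def W_def ..
    ultimately show ?thesis by (simp add: sum.distrib)
  qed
  finally have 1: "tv (m(j := l)) d A j l bb \<le> avg M' (\<lambda>m'. tv (m(j := m')) d A j l bb) + avg (Pow E) (\<lambda>C. \<bar>w C\<bar> * 2)" .
  have 2: "avg (Pow E) (\<lambda>C. \<bar>w C\<bar> * 2) \<le> \<tau> + 1 / (\<tau> * (real n - 1))"
  proof -
    have "avg (Pow E) (\<lambda>C. \<bar>w C\<bar>) \<le> \<tau> / 2 + 1 / (2 * \<tau> * (real n - 1))"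
      unfolding w_def M'_def by (rule mean_sign_small[OF j l n2 \<tau>])
    then have "avg (Pow E) (\<lambda>C. \<bar>w C\<bar>) * 2 \<le> (\<tau> / 2 + 1 / (2 * \<tau> * (real n - 1))) * 2" by (rule mult_right_mono) simp
    also have "\<dots> = \<tau> + 1 / (\<tau> * (real n - 1))" by (simp add: distrib_right)
    finally show ?thesis unfolding avg_multc .
  qed
  show ?thesis using 1 2 unfolding M'_def by linarith
qed

section \<open>Information seen at the ordinary coordinates\<close>

lemma avg_strip:
  assumes "j < N"
  shows "avg (Pow S) (\<lambda>A. of_bool (A \<inter> {(j, n), (j, Suc n)} = {}) * \<phi> A) = avg (Pow S) (\<lambda>A. \<phi> (strip j A)) / 4"
proof -
  define B where "B = {(j, n), (j, Suc n)}"
  have S: "S = (S - B) \<union> B" using assms by (auto simp: S_def B_def)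
  have split: "avg (Pow S) f = avg (Pow (S - B)) (\<lambda>A. avg (Pow B) (\<lambda>C. f (A \<union> C)))" for f
    by (subst S, rule avg_Pow_union) (auto simp: B_def)
  have PB: "finite (Pow B)" "card (Pow B) = 4" "{} \<in> Pow B" by (auto simp: B_def card_Pow)
  have "avg (Pow S) (\<lambda>A. of_bool (A \<inter> B = {}) * \<phi> A) = avg (Pow (S - B)) (\<lambda>A. avg (Pow B) (\<lambda>C. of_bool (C = {}) * \<phi> (A \<union> C)))"
    unfolding split[of "\<lambda>A. of_bool (A \<inter> B = {}) * \<phi> A"]
  proof (intro avg_cong refl arg_cong2[where f = "(*)"] arg_cong[where f = of_bool])
    fix A C assume "A \<in> Pow (S - B)" "C \<in> Pow B"
    then show "((A \<union> C) \<inter> B = {}) = (C = {})" by auto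
  qed
  also have "\<dots> = avg (Pow (S - B)) (\<lambda>A. \<phi> A / 4)"
    by (intro avg_cong refl) (simp add: avg_of_bool_eq[OF PB(1,3)] PB(2))
  also have "\<dots> = avg (Pow S) (\<lambda>A. \<phi> (strip j A)) / 4"
  proof -
    have "avg (Pow S) (\<lambda>A. \<phi> (strip j A)) = avg (Pow (S - B)) (\<lambda>A. avg (Pow B) (\<lambda>C. \<phi> A))"
      unfolding split[of "\<lambda>A. \<phi> (strip j A)"]
    proof (intro avg_cong refl arg_cong[where f = \<phi>])
      fix A C assume "A \<in> Pow (S - B)" "C \<in> Pow B"
      then show "strip j (A \<union> C) = A" by (auto simp: strip_def B_def)
    qed
    also have "\<dots> = avg (Pow (S - B)) \<phi>" using PB by (subst avg_const) auto
    finally show ?thesis by (simp add: avg_divide)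
  qed
  finally show ?thesis by (simp add: B_def)
qed

text \<open>A forced coordinate does not read its owner \<open>d j l\<close>, which may therefore be
  redrawn uniformly without changing the two laws to be compared.\<close>

lemma V_resample: "V m (d(j := (d j)(l := i))) A j l c t = V m d A j l c t"
proof -
  have "over (inp k n N m (d(j := (d j)(l := i))) w) j l c = over (inp k n N m d w) j l c" for w
    by (auto simp: over_def inp_def fun_eq_iff)
  then show ?thesis by (simp add: V_def)
qed

text \<open>Total sensitivity over all blocks and all coordinates that are not special. The special
  position \<open>m'\<close> is averaged separately, the form reached when the special coordinate is
  moved.\<close>

definition "\<Theta> = (\<Sum>j<N. \<Sum>l<n. avg {..<n} (\<lambda>m'. of_bool (l \<noteq> m') * avg (Ms n N) (\<lambda>m. \<Psi> j l (m(j := m')))))"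

text \<open>An ordinary bit contributes a quarter of its \<open>hdist\<close>; restricting to
  cleared special bits of its block costs another factor 4, and the uniform owner turns the sum over
  the sites into \<open>k\<close> times a mean.\<close>

lemma info_lower: "\<Theta> / (16 * real k) \<le> info"
proof -
  define h where "h m d A j l = hdist T (V m d A j l {}) (V m d A j l {d j l})" for m d A j l
  have h0: "0 \<le> h m d A j l" for m d A j l by (simp add: h_def hdist_nonneg)
  have \<Theta>eq: "\<Theta> = (\<Sum>j<N. \<Sum>l<n. avg (Ms n N) (\<lambda>m. of_bool (l \<noteq> m j) * \<Psi> j l m))"
    unfolding \<Theta>_def
  proof (intro sum.cong refl)
    fix j l assume j: "j \<in> {..<N}"
    have "avg (Ms n N) (\<lambda>m. of_bool (l \<noteq> m j) * \<Psi> j l m) = avg (Ms n N) (\<lambda>m. avg {..<n} (\<lambda>m'. of_bool (l \<noteq> (m(j := m')) j) * \<Psi> j l (m(j := m'))))"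
      by (rule avg_Ms_resample) (use j kn0 in auto)
    also have "\<dots> = avg {..<n} (\<lambda>m'. avg (Ms n N) (\<lambda>m. of_bool (l \<noteq> m') * \<Psi> j l (m(j := m'))))"
      unfolding fun_upd_same by (rule avg_swap)
    finally show "avg {..<n} (\<lambda>m'. of_bool (l \<noteq> m') * avg (Ms n N) (\<lambda>m. \<Psi> j l (m(j := m')))) = avg (Ms n N) (\<lambda>m. of_bool (l \<noteq> m j) * \<Psi> j l m)"
      unfolding avg_cmult by simp
  qed
  have \<Psi>eq: "\<Psi> j l m = real k * avg (Ds k n N) (\<lambda>d. avg (Pow S) (\<lambda>A. h m d (strip j A) j l))" if "j < N" "l < n" for j l m
  proof -
    have "avg (Ds k n N) (\<lambda>d. avg (Pow S) (\<lambda>A. h m d (strip j A) j l)) =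
      avg (Ds k n N) (\<lambda>d. avg {..<k} (\<lambda>i. avg (Pow S) (\<lambda>A. h m (d(j := (d j)(l := i))) (strip j A) j l)))"
      by (rule avg_Ds_resample) (use that kn0 in auto)
    also have "\<dots> = avg (Ds k n N) (\<lambda>d. avg {..<k} (\<lambda>i. avg (Pow S) (\<lambda>A. hdist T (V m d (strip j A) j l {}) (V m d (strip j A) j l {i}))))"
      unfolding h_def V_resample hdist_def by simp
    also have "\<dots> = avg (Ds k n N) (\<lambda>d. avg (Pow S) (\<lambda>A. Hs m d (strip j A) j l / real k))"
      unfolding Hs_def by (subst avg_swap) (simp add: avg_def)
    finally show ?thesis using kn0 by (simp add: \<Psi>_def avg_divide)
  qed
  have "\<Theta> / (16 * real k) = (\<Sum>j<N. \<Sum>l<n. avg (Ms n N) (\<lambda>m. of_bool (l \<noteq> m j) * avg (Ds k n N) (\<lambda>d. avg (Pow S) (\<lambda>A. h m d (strip j A) j l) / 16)))"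
    unfolding \<Theta>eq sum_divide_distrib avg_divide[symmetric]
    by (intro sum.cong refl avg_cong) (use kn0 in \<open>simp add: \<Psi>eq avg_divide\<close>)
  also have "\<dots> = (\<Sum>j<N. \<Sum>l<n. avg (Ms n N) (\<lambda>m. avg (Ds k n N) (\<lambda>d. avg (Pow S) (\<lambda>A. of_bool (l \<noteq> m j) * (of_bool (A \<inter> {(j, n), (j, Suc n)} = {}) * (h m d A j l / 4))))))"
  proof (intro sum.cong refl avg_cong)
    fix j l m assume "j \<in> {..<N}"
    then have j: "j < N" by simp
    have "avg (Pow S) (\<lambda>A. h m d (strip j A) j l) / 16 = avg (Pow S) (\<lambda>A. of_bool (A \<inter> {(j, n), (j, Suc n)} = {}) * (h m d A j l / 4))" for d
      unfolding avg_strip[OF j] by (simp add: avg_divide)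
    then show "of_bool (l \<noteq> m j) * avg (Ds k n N) (\<lambda>d. avg (Pow S) (\<lambda>A. h m d (strip j A) j l) / 16) =
      avg (Ds k n N) (\<lambda>d. avg (Pow S) (\<lambda>A. of_bool (l \<noteq> m j) * (of_bool (A \<inter> {(j, n), (j, Suc n)} = {}) * (h m d A j l / 4))))"
      by (simp only: avg_cmult)
  qed
  also have "\<dots> = avg (Ms n N) (\<lambda>m. avg (Ds k n N) (\<lambda>d. avg (Pow S) (\<lambda>A. \<Sum>j<N. \<Sum>l<n. of_bool (l \<noteq> m j) * (of_bool (A \<inter> {(j, n), (j, Suc n)} = {}) * (h m d A j l / 4)))))"
    by (simp only: avg_sum)
  also have "\<dots> \<le> avg (Ms n N) (\<lambda>m. avg (Ds k n N) (\<lambda>d. avg (Pow S) (\<lambda>A. \<Sum>j<N. \<Sum>l<n. hdist T (pe m d A (j, l) False) (pe m d A (j, l) True) / 4)))"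
  proof (intro avg_mono sum_mono)
    fix m d A j l assume a: "m \<in> Ms n N" "d \<in> Ds k n N" "A \<in> Pow S" "j \<in> {..<N}" "l \<in> {..<n}"
    have dk: "d j l < k" using a by (auto simp: Ds_def PiE_dflt_def)
    show "of_bool (l \<noteq> m j) * (of_bool (A \<inter> {(j, n), (j, Suc n)} = {}) * (h m d A j l / 4)) \<le> hdist T (pe m d A (j, l) False) (pe m d A (j, l) True) / 4"
    proof (cases "l = m j")
      case True
      then show ?thesis by (simp add: hdist_nonneg)
    next
      case False
      have "hdist T (pe m d A (j, l) False) (pe m d A (j, l) True) = h m d A j l"
        unfolding h_def hdist_def by (intro sum.cong refl) (use a False dk pe_V in auto)
      then show ?thesis using False h0[of m d A j l] by (simp add: of_bool_def)
    qed
  qed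
  also have "\<dots> \<le> info"
    unfolding info_def
  proof (intro avg_mono)
    fix m d
    have "avg (Pow S) (\<lambda>A. \<Sum>j<N. \<Sum>l<n. hdist T (pe m d A (j, l) False) (pe m d A (j, l) True) / 4) =
      avg (Pow S) (\<lambda>A. \<Sum>e\<in>E. hdist T (pe m d A e False) (pe m d A e True) / 4)"
      unfolding E_def by (simp add: sum.cartesian_product')
    moreover have "0 \<le> minfo (Pow S) T (pS m d)"
      by (intro minfo_nonneg) (use finite_transcripts pS_nonneg pS_sum in auto)
    ultimately show "avg (Pow S) (\<lambda>A. \<Sum>j<N. \<Sum>l<n. hdist T (pe m d A (j, l) False) (pe m d A (j, l) True) / 4) \<le> minfo (Pow (Js n N)) T (tker k n N coins P m d)"
      using minfo_split[of m d] by linarith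
  qed
  finally show ?thesis .
qed

text \<open>Changing a special bit replaces one column of block \<open>j\<close> by another. Both
  are compared with the zero column, and summing over all nonzero patterns covers whichever occur.
  The factor 2 counts the two special bits of a block.\<close>

lemma minfo_S_upper:
  assumes m: "m \<in> Ms n N"
  shows "minfo (Pow S) T (pS m d) \<le> (\<Sum>j<N. 2 * (\<Sum>bb\<in>BB. avg (Pow S) (\<lambda>A. tv m d A j (m j) bb)))"
proof -
  have "minfo (Pow S) T (pS m d) \<le> (\<Sum>e\<in>S. avg (Pow S) (\<lambda>A. \<Sum>t\<in>T. \<bar>pS m d (bitset e False A) t - pS m d (bitset e True A) t\<bar> / 2))"
    by (rule minfo_bits_upper) (use finite_transcripts pS_nonneg in auto)
  also have "\<dots> \<le> (\<Sum>e\<in>S. avg (Pow S) (\<lambda>A. \<Sum>bb\<in>BB. tv m d A (fst e) (m (fst e)) bb))"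
  proof (intro sum_mono avg_mono)
    fix e A assume e: "e \<in> S" and A: "A \<in> Pow S"
    define j where "j = fst e"
    have j: "j < N" "e = (j, n) \<or> e = (j, Suc n)" using e by (auto simp: S_def j_def)
    have mj: "m j < n" using m j by (auto simp: Ms_def PiE_dflt_def)
    define B where "B = strip j A"
    have col0: "col (False, False) = {}" by (auto simp: col_def)
    have rep: "\<exists>bb\<in>insert (False, False) BB. bitset e b A = B \<union> aset j bb" for b
    proof -
      define bb where "bb = ((j, n) \<in> bitset e b A, (j, Suc n) \<in> bitset e b A)"
      have "bitset e b A = B \<union> aset j bb"
        using j(2) unfolding bb_def B_def strip_def aset_def bitset_def by auto
      moreover have "bb \<in> insert (False, False) BB" by (cases bb) (auto simp: BB_def)
      ultimately show ?thesis by blast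
    qed
    have one: "\<bar>pS m d (bitset e b A) t - V m d B j (m j) {} t\<bar> \<le> (\<Sum>bb\<in>BB. \<bar>V m d B j (m j) (col bb) t - V m d B j (m j) {} t\<bar>)"
      if t: "t \<in> T" for b t
    proof -
      obtain bb where bb: "bb \<in> insert (False, False) BB" "bitset e b A = B \<union> aset j bb" using rep by blast
      have eq: "pS m d (bitset e b A) t = V m d B j (m j) (col bb) t"
        unfolding bb(2) B_def by (rule pS_V[where m = m, OF j(1) mj t])
      show ?thesis
      proof (cases "bb = (False, False)")
        case True
        then show ?thesis unfolding eq by (simp add: col0 sum_nonneg)
      next
        case False
        then have "bb \<in> BB" using bb by auto
        then show ?thesis unfolding eq
          by (intro member_le_sum[where f = "\<lambda>bb. \<bar>V m d B j (m j) (col bb) t - V m d B j (m j) {} t\<bar>"]) (auto simp: BB_def)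
      qed
    qed
    have "(\<Sum>t\<in>T. \<bar>pS m d (bitset e False A) t - pS m d (bitset e True A) t\<bar> / 2) \<le> (\<Sum>t\<in>T. \<Sum>bb\<in>BB. \<bar>V m d B j (m j) (col bb) t - V m d B j (m j) {} t\<bar>)"
    proof (rule sum_mono)
      fix t assume t: "t \<in> T"
      show "\<bar>pS m d (bitset e False A) t - pS m d (bitset e True A) t\<bar> / 2 \<le> (\<Sum>bb\<in>BB. \<bar>V m d B j (m j) (col bb) t - V m d B j (m j) {} t\<bar>)"
      proof -
        have "\<bar>x - y\<bar> / 2 \<le> s" if "\<bar>x - v\<bar> \<le> s" "\<bar>y - v\<bar> \<le> s" for x y v s :: real
        proof -
          have "\<bar>x - y\<bar> \<le> 2 * s" using that by linarith
          then show ?thesis by simp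
        qed
        from this[OF one[OF t, of False] one[OF t, of True]] show ?thesis .
      qed
    qed
    also have "\<dots> = (\<Sum>bb\<in>BB. tv m d A j (m j) bb)"
      unfolding tv_def B_def by (rule sum.swap)
    finally show "(\<Sum>t\<in>T. \<bar>pS m d (bitset e False A) t - pS m d (bitset e True A) t\<bar> / 2) \<le> (\<Sum>bb\<in>BB. tv m d A (fst e) (m (fst e)) bb)"
      by (simp add: j_def)
  qed
  also have "\<dots> = (\<Sum>j<N. \<Sum>x\<in>{n, Suc n}. \<Sum>bb\<in>BB. avg (Pow S) (\<lambda>A. tv m d A j (m j) bb))"
    unfolding S_def by (simp add: sum.cartesian_product' avg_sum)
  finally show ?thesis by simp
qed

text \<open>Six is two special bits times three nonzero columns. One \<tau> comes from moving the
  special coordinate, the other from passing to Hellinger distances, where the factor 4 of the tree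
  turns 6 into 24. Here \<open>l\<close> and \<open>m'\<close> are averaged over
  \<open>n * (n - 1)\<close> pairs, whereas \<Theta> carries only \<open>1 / n\<close>; hence the
  division by \<open>n - 1\<close>.\<close>

lemma infoS_upper:
  assumes n2: "2 \<le> n" and \<tau>: "0 < \<tau>"
  shows "infoS \<le> 6 * real N * (2 * \<tau> + 1 / (\<tau> * (real n - 1))) + 24 * \<Theta> / (\<tau> * (real n - 1))"
proof -
  define R where "R = 2 * \<tau> + 1 / (\<tau> * (real n - 1))"
  define M' where "M' l = {..<n} - {l}" for l
  have M': "finite (M' l)" "card (M' l) = n - 1" "M' l \<noteq> {}" if "l < n" for l
  proof -
    have "(if l = 0 then 1 else 0) \<in> M' l" using n2 by (auto simp: M'_def)
    then show "M' l \<noteq> {}" by auto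
  qed (use that in \<open>auto simp: M'_def\<close>)
  have nM: "real (n - 1) = real n - 1" using n2 by (simp add: of_nat_diff)
  have BB: "finite BB" "card BB = 3" by (auto simp: BB_def)
  have ne: "Ms n N \<noteq> {}" "Ds k n N \<noteq> {}" "Pow S \<noteq> {}" "{..<n} \<noteq> {}"
    using Ms_nonempty[OF kn0(2)] Ds_nonempty[OF kn0(1)] kn0 by auto
  have step: "tv (m(j := l)) d A j l bb \<le> R + (4 / \<tau>) * avg (M' l) (\<lambda>m'. Hs (m(j := m')) d (strip j A) j l)"
    if "j < N" "l < n" "A \<in> Pow S" "bb \<in> BB" for m d A j l bb
  proof -
    have 1: "tv (m(j := l)) d A j l bb \<le> avg (M' l) (\<lambda>m'. tv (m(j := m')) d A j l bb) + (\<tau> + 1 / (\<tau> * (real n - 1)))"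
      unfolding M'_def by (rule tv_move) (use that n2 \<tau> in auto)
    have "avg (M' l) (\<lambda>m'. tv (m(j := m')) d A j l bb) \<le> avg (M' l) (\<lambda>m'. \<tau> + (4 / \<tau>) * Hs (m(j := m')) d (strip j A) j l)"
    proof (rule avg_mono)
      fix m'
      show "tv (m(j := m')) d A j l bb \<le> \<tau> + (4 / \<tau>) * Hs (m(j := m')) d (strip j A) j l"
        using tv_le_Hs[of A bb \<tau> "m(j := m')" d j l] that \<tau> by simp
    qed
    also have "\<dots> = \<tau> + (4 / \<tau>) * avg (M' l) (\<lambda>m'. Hs (m(j := m')) d (strip j A) j l)"
      unfolding avg_add avg_cmult using M'[OF that(2)] by (subst avg_const) auto
    finally show ?thesis using 1 unfolding R_def by linarith
  qed
  have block: "avg (Ms n N) (\<lambda>m. avg (Ds k n N) (\<lambda>d. avg (Pow S) (\<lambda>A. tv m d A j (m j) bb))) \<le>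
    R + (4 / \<tau>) * avg {..<n} (\<lambda>l. avg (M' l) (\<lambda>m'. avg (Ms n N) (\<lambda>m. \<Psi> j l (m(j := m')))))"
    if j: "j < N" and bb: "bb \<in> BB" for j bb
  proof -
    have "avg (Ms n N) (\<lambda>m. avg (Ds k n N) (\<lambda>d. avg (Pow S) (\<lambda>A. tv m d A j (m j) bb))) =
      avg (Ms n N) (\<lambda>m. avg {..<n} (\<lambda>l. avg (Ds k n N) (\<lambda>d. avg (Pow S) (\<lambda>A. tv (m(j := l)) d A j ((m(j := l)) j) bb))))"
      by (rule avg_Ms_resample) (use j kn0 in auto)
    also have "\<dots> \<le> avg (Ms n N) (\<lambda>m. avg {..<n} (\<lambda>l. avg (Ds k n N) (\<lambda>d. avg (Pow S) (\<lambda>A. R + (4 / \<tau>) * avg (M' l) (\<lambda>m'. Hs (m(j := m')) d (strip j A) j l)))))"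
      unfolding fun_upd_same by (intro avg_mono step) (use j bb in auto)
    also have "\<dots> = R + (4 / \<tau>) * avg (Ms n N) (\<lambda>m. avg {..<n} (\<lambda>l. avg (Ds k n N) (\<lambda>d. avg (Pow S) (\<lambda>A. avg (M' l) (\<lambda>m'. Hs (m(j := m')) d (strip j A) j l)))))"
      unfolding avg_add avg_cmult using ne by (simp add: avg_const)
    also have "avg (Ms n N) (\<lambda>m. avg {..<n} (\<lambda>l. avg (Ds k n N) (\<lambda>d. avg (Pow S) (\<lambda>A. avg (M' l) (\<lambda>m'. Hs (m(j := m')) d (strip j A) j l))))) =
      avg {..<n} (\<lambda>l. avg (M' l) (\<lambda>m'. avg (Ms n N) (\<lambda>m. \<Psi> j l (m(j := m')))))"
      unfolding \<Psi>_def avg_swap[of "Pow S" "M' _"] avg_swap[of "Ds k n N" "M' _"] avg_swap[of "Ms n N" "{..<n}"] avg_swap[of "Ms n N" "M' _"] ..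
    finally show ?thesis .
  qed
  have "infoS \<le> avg (Ms n N) (\<lambda>m. avg (Ds k n N) (\<lambda>d. \<Sum>j<N. 2 * (\<Sum>bb\<in>BB. avg (Pow S) (\<lambda>A. tv m d A j (m j) bb))))"
    unfolding infoS_def by (intro avg_mono minfo_S_upper)
  also have "\<dots> = (\<Sum>j<N. 2 * (\<Sum>bb\<in>BB. avg (Ms n N) (\<lambda>m. avg (Ds k n N) (\<lambda>d. avg (Pow S) (\<lambda>A. tv m d A j (m j) bb)))))"
    by (simp only: avg_sum avg_cmult)
  also have "\<dots> \<le> (\<Sum>j<N. 2 * (\<Sum>bb\<in>BB. R + (4 / \<tau>) * avg {..<n} (\<lambda>l. avg (M' l) (\<lambda>m'. avg (Ms n N) (\<lambda>m. \<Psi> j l (m(j := m')))))))"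
    by (intro sum_mono mult_left_mono block) auto
  also have "\<dots> = 6 * real N * R + (24 / \<tau>) * (\<Sum>j<N. avg {..<n} (\<lambda>l. avg (M' l) (\<lambda>m'. avg (Ms n N) (\<lambda>m. \<Psi> j l (m(j := m'))))))"
    using BB by (simp add: sum.distrib sum_distrib_left distrib_left)
  also have "(\<Sum>j<N. avg {..<n} (\<lambda>l. avg (M' l) (\<lambda>m'. avg (Ms n N) (\<lambda>m. \<Psi> j l (m(j := m')))))) = \<Theta> / (real n - 1)"
    unfolding \<Theta>_def sum_divide_distrib
  proof (intro sum.cong refl)
    fix j
    define \<phi> where "\<phi> l m' = avg (Ms n N) (\<lambda>m. \<Psi> j l (m(j := m')))" for l m'
    have eq: "avg (M' l) (\<phi> l) = real n * avg {..<n} (\<lambda>m'. of_bool (l \<noteq> m') * \<phi> l m') / (real n - 1)" if l: "l < n" for l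
    proof -
      have "(\<Sum>m'\<in>M' l. \<phi> l m') = (\<Sum>m'<n. of_bool (l \<noteq> m') * \<phi> l m')"
        unfolding M'_def by (intro sum.mono_neutral_cong_left) auto
      then show ?thesis using M'(2)[OF l] n2 nM by (simp add: avg_def)
    qed
    have "avg {..<n} (\<lambda>l. avg (M' l) (\<phi> l)) = avg {..<n} (\<lambda>l. real n * avg {..<n} (\<lambda>m'. of_bool (l \<noteq> m') * \<phi> l m') / (real n - 1))"
      by (rule avg_cong) (use eq in auto)
    also have "\<dots> = real n * avg {..<n} (\<lambda>l. avg {..<n} (\<lambda>m'. of_bool (l \<noteq> m') * \<phi> l m')) / (real n - 1)"
      by (simp only: avg_divide avg_cmult)
    also have "real n * avg {..<n} (\<lambda>l. avg {..<n} (\<lambda>m'. of_bool (l \<noteq> m') * \<phi> l m')) = (\<Sum>l<n. avg {..<n} (\<lambda>m'. of_bool (l \<noteq> m') * \<phi> l m'))"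
    proof -
      have "real n * avg {..<n} q = (\<Sum>l<n. q l)" for q using n2 by (simp add: avg_def)
      then show ?thesis .
    qed
    finally show "avg {..<n} (\<lambda>l. avg (M' l) (\<lambda>m'. avg (Ms n N) (\<lambda>m. \<Psi> j l (m(j := m'))))) =
      (\<Sum>l<n. avg {..<n} (\<lambda>m'. of_bool (l \<noteq> m') * avg (Ms n N) (\<lambda>m. \<Psi> j l (m(j := m')))) / (real n - 1))"
      by (simp add: \<phi>_def sum_divide_distrib)
  qed
  finally show ?thesis by (simp add: R_def)
qed

end

text \<open>The condition \<open>\<epsilon> \<le> 1 / 4\<close> means \<open>N \<ge> 16\<close>. For
  smaller \<open>N\<close> the inner product, at most \<open>N\<close> in absolute value, never
  reaches \<open>4 * sqrt N\<close>, so a silent protocol answering 0 would be correct. For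
  \<open>k = 2\<close> a lone 1 in an ordinary coordinate would already be half of the
  sites.\<close>

theorem theorem7:
  shows "\<exists>\<delta>>0. \<exists>c>0. \<forall>(k::nat) (n::nat) (N::nat) (\<epsilon>::real) (coins :: nat \<Rightarrow> nat pmf) (P :: protocol).
    (\<exists>a. k = 2 ^ a) \<longrightarrow> 4 \<le> k \<longrightarrow> 1 \<le> n \<longrightarrow>
    0 < \<epsilon> \<longrightarrow> \<epsilon> \<le> 1 / 4 \<longrightarrow> 1 / \<epsilon>\<^sup>2 = real N \<longrightarrow>
    speakers P \<subseteq> {..<k} \<longrightarrow>
    btx_error k n N \<epsilon> coins P \<le> \<delta> \<longrightarrow>
    btx_info k n N coins P \<ge> c * (real n / (real k * \<epsilon>\<^sup>2))"
proof -
  obtain c0 K where c0: "0 < c0" and K: "0 < K" and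
    ort: "\<forall>(J :: nat set) (T :: bool list set) f g out. finite J \<longrightarrow> 16 \<le> card J \<longrightarrow> finite T \<longrightarrow>
     (\<forall>t\<in>T. \<forall>A\<in>Pow J. 0 \<le> f t A) \<longrightarrow> (\<forall>t\<in>T. \<forall>A\<in>Pow J. 0 \<le> g t A) \<longrightarrow>
     (\<forall>A\<in>Pow J. \<forall>B\<in>Pow J. (\<Sum>t\<in>T. f t A * g t B) = 1) \<longrightarrow>
     real (card J) * (c0 - K * ort_error J T out (\<lambda>(A, B) t. f t A * g t B)) \<le> minfo (Pow J \<times> Pow J) T (\<lambda>(A, B) t. f t A * g t B)"
    using gap_orthogonality_info by (elim exE conjE)
  define c1 where "c1 = c0 / 2"
  \<comment> \<open>With this error at least half of \<open>c0\<close> survives in the affine bound,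
    namely \<open>c1\<close>.\<close>
  define \<delta> where "\<delta> = c0 / (2 * K)"
  \<comment> \<open>Then \<open>6 * 2 * \<tau> = c1 / 4\<close>, and \<open>n > n0\<close> makes
    \<open>6 / (\<tau> * (n - 1))\<close> at most \<open>c1 / 4\<close>: the error terms take at
    most half of the lower bound \<open>c1\<close> per block.\<close>
  define \<tau> where "\<tau> = c1 / 48"
  define n0 where "n0 = 24 / (\<tau> * c1) + 2"
  \<comment> \<open>For \<open>n \<le> n0\<close> the special bits suffice. Otherwise
    \<open>1536 = 24 * 16 * 2 * 2\<close>, one 2 from the remaining half of \<open>c1\<close> and
    one from \<open>n \<le> 2 * (n - 1)\<close>.\<close>
  define c where "c = min (c1 / n0) (c1 * \<tau> / 1536)"
  have c1: "0 < c1" and \<delta>: "0 < \<delta>" and \<tau>: "0 < \<tau>" using c0 K by (auto simp: c1_def \<delta>_def \<tau>_def)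
  have n0: "2 < n0" unfolding n0_def using c1 \<tau> by simp
  have c: "0 < c" unfolding c_def using c1 \<tau> n0 by simp
  have main: "c * (real n / (real k * \<epsilon>\<^sup>2)) \<le> btx_info k n N coins P"
    if k: "\<exists>a. k = 2 ^ a" "4 \<le> k" and n: "1 \<le> n" and \<epsilon>: "0 < \<epsilon>" "\<epsilon> \<le> 1 / 4" "1 / \<epsilon>\<^sup>2 = real N"
      and sp: "speakers P \<subseteq> {..<k}" and err: "btx_error k n N \<epsilon> coins P \<le> \<delta>"
    for k n N :: nat and \<epsilon> :: real and coins :: "nat \<Rightarrow> nat pmf" and P
  proof -
    obtain a where a: "k = 2 ^ a" using k by auto
    interpret btx_protocol k n N a coins P by unfold_locales (use a k n sp in auto)
    have N16: "16 \<le> N"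
    proof -
      have "4 \<le> 1 / \<epsilon>" using \<epsilon> by (simp add: field_simps)
      then have "4\<^sup>2 \<le> (1 / \<epsilon>)\<^sup>2" by (intro power_mono) auto
      then have "16 \<le> real N" using \<epsilon>(3) by (simp add: power_divide)
      then show ?thesis by simp
    qed
    have goal_eq: "real n / (real k * \<epsilon>\<^sup>2) = real n * real N / real k"
      using \<epsilon>(3)[symmetric] by simp
    have S: "real N * c1 \<le> infoS"
    proof -
      have "real N * (c0 - K * btx_error k n N \<epsilon> coins P) \<le> infoS"
        by (rule infoS_lower[OF ort N16 \<epsilon>(1,3)])
      moreover have "K * btx_error k n N \<epsilon> coins P \<le> K * \<delta>" using err K by (intro mult_left_mono) auto
      moreover have "K * \<delta> = c1" using K by (simp add: \<delta>_def c1_def)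
      ultimately have "c1 \<le> c0 - K * btx_error k n N \<epsilon> coins P" by (simp add: c1_def)
      then have "real N * c1 \<le> real N * (c0 - K * btx_error k n N \<epsilon> coins P)" by (intro mult_left_mono) auto
      then show ?thesis using infoS_lower[OF ort N16 \<epsilon>(1,3)] by linarith
    qed
    have k1: "1 \<le> real k" using k by simp
    have low: "c * (real n * real N / real k) \<le> info"
    proof (cases "real n \<le> n0")
      case True
      have "c * (real n * real N / real k) \<le> (c1 / n0) * (n0 * real N / 1)"
        using True c k1 n0 by (intro mult_mono frac_le) (auto simp: c_def)
      also have "\<dots> = real N * c1" using n0 by simp
      also have "\<dots> \<le> info" using S info_ge_infoS by linarith
      finally show ?thesis .
    next
      case False
      then have nbig: "n0 < real n" by simp
      then have n2: "2 \<le> n" using n0 by linarith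
      define x where "x = real n - 1"
      have x: "24 / (\<tau> * c1) \<le> x" "1 \<le> x" "real n \<le> 2 * x" using nbig n0 n2 by (auto simp: x_def n0_def)
      have "infoS \<le> 6 * real N * (2 * \<tau> + 1 / (\<tau> * x)) + 24 * \<Theta> / (\<tau> * x)"
        unfolding x_def by (rule infoS_upper[OF n2 \<tau>])
      also have "24 * \<Theta> / (\<tau> * x) \<le> 24 * (16 * real k * info) / (\<tau> * x)"
        using info_lower k1 \<tau> x by (intro divide_right_mono mult_left_mono) (auto simp: field_simps)
      also have "6 * real N * (2 * \<tau> + 1 / (\<tau> * x)) \<le> real N * (c1 / 2)"
      proof -
        have "24 \<le> x * (\<tau> * c1)" using x(1) c1 \<tau> by (simp add: divide_le_eq)
        then have "1 / (\<tau> * x) \<le> c1 / 24" using \<tau> x c1 by (simp add: field_simps)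
        then have "6 * (2 * \<tau> + 1 / (\<tau> * x)) \<le> c1 / 2" by (simp add: \<tau>_def)
        then have "real N * (6 * (2 * \<tau> + 1 / (\<tau> * x))) \<le> real N * (c1 / 2)" by (intro mult_left_mono) auto
        then show ?thesis by (simp add: mult_ac)
      qed
      finally have "real N * c1 \<le> real N * (c1 / 2) + 24 * (16 * real k * info) / (\<tau> * x)" using S by linarith
      then have "real N * (c1 / 2) \<le> 24 * (16 * real k * info) / (\<tau> * x)" by argo
      then have "real N * (c1 / 2) * (\<tau> * x) \<le> 384 * real k * info" using \<tau> x by (simp add: pos_le_divide_eq)
      then have 1: "real N * c1 * \<tau> * (2 * x) / (1536 * real k) \<le> info" using k1 by (simp add: field_simps)
      have "c * (real n * real N / real k) \<le> (c1 * \<tau> / 1536) * ((2 * x) * real N / real k)"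
        using x k1 c1 \<tau> min.cobounded2[of "c1 / n0" "c1 * \<tau> / 1536", folded c_def]
        by (intro mult_mono divide_right_mono) auto
      also have "\<dots> = real N * c1 * \<tau> * (2 * x) / (1536 * real k)" by simp
      finally show ?thesis using 1 by linarith
    qed
    also have "info \<le> btx_info k n N coins P"
    proof -
      have i0: "0 \<le> info" using infoS_nonneg info_ge_infoS by linarith
      have l: "0 < ln (2::real)" "ln (2::real) \<le> 1" using ln_le_minus_one[of "2::real"] by auto
      have "info * ln 2 \<le> info * 1" using i0 l by (intro mult_left_mono) auto
      then have "info \<le> info / ln 2" using l by (simp add: pos_le_divide_eq)
      then show ?thesis unfolding btx_info_eq[OF kn0] info_def .
    qed
    finally show ?thesis unfolding goal_eq .
  qed
  show ?thesis
    by (intro exI[of _ \<delta>] exI[of _ c] conjI allI impI \<delta> c) (rule main)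
qed

end
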